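(* Let $\mathcal{H}$ be a simply connected three-dimensional Lie group with Lie algebra $\mathfrak{h}$, let $\mathbf{T}$ be an operator defining a geometric evolution equation $\frac{\partial \mathbf{g}}{\partial t}=\mathbf{T}[\mathbf{g}]$ for Riemannian metrics on $\mathcal{H}$, and let $\mathbf{g}$ be a left invariant Riemannian metric on $\mathcal{H}$. If $\mathbf{g}$ is an algebraic $\mathbf{T}$-soliton, then $\mathbf{g}$ is a $\mathbf{T}$-soliton.
   Context: $\mathbf{T}$ assigns to each Riemannian metric $\mathbf{g}$ on $\mathcal{H}$ a symmetric $(0,2)$-tensor field $\mathbf{T}[\mathbf{g}]$ on $\mathcal{H}$. For a symmetric $(0,2)$-tensor $\mathbf{A}$ on a Riemannian manifold with metric $\mathbf{g}$, the operator $\widehat{\mathbf{A}}$ is the $(1,1)$-tensor defined by $\mathbf{g}(\widehat{\mathbf{A}}(X),Y)=\mathbf{A}(X,Y)$ for all vector fields $X,Y$. Algebraic $\mathbf{T}$-soliton: a left invariant metric $\mathbf{g}$ on $\mathcal{H}$ is an algebraic $\mathbf{T}$-soliton if there is $\kappa\in\mathbb{R}$ such that the operator $\mathbf{D}=\widehat{\mathbf{T}[\mathbf{g}]}-\kappa\,\mathrm{Id}:\mathfrak{h}\to\mathfrak{h}$ is a derivation of the Lie algebra $\mathfrak{h}$ (implicit in the definition: $\mathbf{T}[\mathbf{g}]$ is left invariant, so that $\widehat{\mathbf{T}[\mathbf{g}]}$ is an endomorphism of $\mathfrak{h}$). $\mathbf{T}$-soliton: a metric $\mathbf{g}$ is a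 $\mathbf{T}$-soliton if there are a vector field $\mathbf{X}$ on $\mathcal{H}$ and $\beta\in\mathbb{R}$ with $\beta\,\mathbf{g}+\mathcal{L}_{\mathbf{X}}\mathbf{g}=\mathbf{T}[\mathbf{g}]$, where $\mathcal{L}_{\mathbf{X}}$ is the Lie derivative. *)

theory Defs
  imports "HOL-Analysis.Analysis"
begin

section \<open>Smooth manifolds\<close>

text \<open>Smoothness is used on open sets \<open>S\<close> only; in finite dimension, having all iterated
  directional derivatives differentiable is the same as being of class \<open>C\<close> infinity.\<close>

primrec k_smooth_on ::
  "nat \<Rightarrow> 'e::euclidean_space set \<Rightarrow> ('e \<Rightarrow> 'f::real_normed_vector) \<Rightarrow> bool" where
  "k_smooth_on 0 S f \<longleftrightarrow> continuous_on S f"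
| "k_smooth_on (Suc k) S f \<longleftrightarrow>
     (\<forall>x\<in>S. f differentiable (at x)) \<and>
     (\<forall>v. k_smooth_on k S (\<lambda>x. frechet_derivative f (at x) v))"

definition smooth_on :: "'e::euclidean_space set \<Rightarrow> ('e \<Rightarrow> 'f::real_normed_vector) \<Rightarrow> bool" where
  "smooth_on S f \<longleftrightarrow> (\<forall>k. k_smooth_on k S f)"

text \<open>A chart is a pair of its domain and its coordinate map; the values of the coordinate map
  outside the domain are irrelevant.\<close>

type_synonym ('m, 'e) chart = "'m set \<times> ('m \<Rightarrow> 'e)"

definition smooth_atlas :: "('m::topological_space, 'e::euclidean_space) chart set \<Rightarrow> bool" where
  "smooth_atlas \<A> \<longleftrightarrow>
     (\<Union>(U, \<phi>)\<in>\<A>. U) = UNIV \<and>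
     (\<forall>(U, \<phi>)\<in>\<A>. open U \<and> open (\<phi> ` U) \<and> homeomorphism U (\<phi> ` U) \<phi> (inv_into U \<phi>)) \<and>
     (\<forall>(U, \<phi>)\<in>\<A>. \<forall>(V, \<psi>)\<in>\<A>. smooth_on (\<phi> ` (U \<inter> V)) (\<psi> \<circ> inv_into U \<phi>))"

definition prod_atlas ::
  "('m, 'e) chart set \<Rightarrow> ('n, 'f) chart set \<Rightarrow> ('m \<times> 'n, 'e \<times> 'f) chart set" where
  "prod_atlas \<A> \<B> = {(U \<times> V, map_prod \<phi> \<psi>) | U \<phi> V \<psi>. (U, \<phi>) \<in> \<A> \<and> (V, \<psi>) \<in> \<B>}"

definition smooth_map ::
  "('m::topological_space, 'e::euclidean_space) chart set \<Rightarrow>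
   ('n::topological_space, 'f::euclidean_space) chart set \<Rightarrow> ('m \<Rightarrow> 'n) \<Rightarrow> bool" where
  "smooth_map \<A> \<B> F \<longleftrightarrow>
     continuous_on UNIV F \<and>
     (\<forall>(U, \<phi>)\<in>\<A>. \<forall>(V, \<psi>)\<in>\<B>. smooth_on (\<phi> ` (U \<inter> F -` V)) (\<psi> \<circ> F \<circ> inv_into U \<phi>))"

definition smooth_functions ::
  "('m::topological_space, 'e::euclidean_space) chart set \<Rightarrow> ('m \<Rightarrow> real) set" where
  "smooth_functions \<A> = {f. smooth_map \<A> {(UNIV, \<lambda>x. x)} f}"

section \<open>Tangent vectors, vector fields and tensor fields\<close>

text \<open>Tangent vectors at \<open>p\<close> are the derivations at \<open>p\<close> of the algebra of smooth functions.
  Their value on non-smooth functions is fixed to be \<open>0\<close>, so that equality of tangent vectors is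
  equality in HOL.\<close>

type_synonym 'm tangent = "('m \<Rightarrow> real) \<Rightarrow> real"
type_synonym 'm vfield = "'m \<Rightarrow> 'm tangent"
type_synonym 'm tensor2 = "'m \<Rightarrow> 'm tangent \<Rightarrow> 'm tangent \<Rightarrow> real"

definition tangent_space ::
  "('m::topological_space, 'e::euclidean_space) chart set \<Rightarrow> 'm \<Rightarrow> 'm tangent set" where
  "tangent_space \<A> p = {v.
     (\<forall>f. f \<notin> smooth_functions \<A> \<longrightarrow> v f = 0) \<and>
     (\<forall>f\<in>smooth_functions \<A>. \<forall>h\<in>smooth_functions \<A>. v (\<lambda>x. f x + h x) = v f + v h) \<and>
     (\<forall>c. \<forall>f\<in>smooth_functions \<A>. v (\<lambda>x. c * f x) = c * v f) \<and>
     (\<forall>f\<in>smooth_functions \<A>. \<forall>h\<in>smooth_functions \<A>.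
        v (\<lambda>x. f x * h x) = f p * v h + h p * v f)}"

definition vector_fields ::
  "('m::topological_space, 'e::euclidean_space) chart set \<Rightarrow> 'm vfield set" where
  "vector_fields \<A> = {X.
     (\<forall>p. X p \<in> tangent_space \<A> p) \<and>
     (\<forall>f\<in>smooth_functions \<A>. (\<lambda>p. X p f) \<in> smooth_functions \<A>)}"

definition lie_bracket :: "'m vfield \<Rightarrow> 'm vfield \<Rightarrow> 'm vfield" where
  "lie_bracket X Y = (\<lambda>p f. X p (\<lambda>q. Y q f) - Y p (\<lambda>q. X q f))"

text \<open>Tensors vanish by convention on arguments that are not tangent vectors at the base point,
  so that equality of tensor fields is equality in HOL.\<close>

definition symmetric_tensors ::
  "('m::topological_space, 'e::euclidean_space) chart set \<Rightarrow> 'm tensor2 set" where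
  "symmetric_tensors \<A> = {A.
     (\<forall>p v w. v \<notin> tangent_space \<A> p \<or> w \<notin> tangent_space \<A> p \<longrightarrow> A p v w = 0) \<and>
     (\<forall>p. \<forall>v\<in>tangent_space \<A> p. \<forall>w\<in>tangent_space \<A> p. A p v w = A p w v) \<and>
     (\<forall>p. \<forall>u\<in>tangent_space \<A> p. \<forall>v\<in>tangent_space \<A> p. \<forall>w\<in>tangent_space \<A> p.
        A p (\<lambda>f. u f + v f) w = A p u w + A p v w) \<and>
     (\<forall>p c. \<forall>v\<in>tangent_space \<A> p. \<forall>w\<in>tangent_space \<A> p.
        A p (\<lambda>f. c * v f) w = c * A p v w) \<and>
     (\<forall>X\<in>vector_fields \<A>. \<forall>Y\<in>vector_fields \<A>.
        (\<lambda>p. A p (X p) (Y p)) \<in> smooth_functions \<A>)}"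

definition riemannian_metrics ::
  "('m::topological_space, 'e::euclidean_space) chart set \<Rightarrow> 'm tensor2 set" where
  "riemannian_metrics \<A> = {g\<in>symmetric_tensors \<A>.
     \<forall>p. \<forall>v\<in>tangent_space \<A> p. v \<noteq> (\<lambda>f. 0) \<longrightarrow> g p v v > 0}"

definition lie_derivative :: "'m vfield \<Rightarrow> 'm tensor2 \<Rightarrow> 'm vfield \<Rightarrow> 'm vfield \<Rightarrow> 'm \<Rightarrow> real" where
  "lie_derivative X A Y Z p =
     X p (\<lambda>q. A q (Y q) (Z q)) - A p (lie_bracket X Y p) (Z p) - A p (Y p) (lie_bracket X Z p)"

text \<open>The (1,1)-tensor obtained from \<open>A\<close> by raising an index with \<open>g\<close>, acting on vector fields.\<close>

definition hat ::
  "('m::topological_space, 'e::euclidean_space) chart set \<Rightarrow> 'm tensor2 \<Rightarrow> 'm tensor2 \<Rightarrow>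
   'm vfield \<Rightarrow> 'm vfield" where
  "hat \<A> g A X = (\<lambda>p. THE w. w \<in> tangent_space \<A> p \<and>
     (\<forall>u\<in>tangent_space \<A> p. g p w u = A p (X p) u))"

section \<open>Lie groups\<close>

definition lie_group ::
  "('m::{t2_space,second_countable_topology} \<Rightarrow> 'm \<Rightarrow> 'm) \<Rightarrow> 'm \<Rightarrow> ('m \<Rightarrow> 'm) \<Rightarrow>
   ('m, 'e::euclidean_space) chart set \<Rightarrow> bool" where
  "lie_group mul e \<iota> \<A> \<longleftrightarrow>
     Groups.group mul e \<iota> \<and> smooth_atlas \<A> \<and>
     smooth_map (prod_atlas \<A> \<A>) \<A> (\<lambda>(x, y). mul x y) \<and> smooth_map \<A> \<A> \<iota>"

definition pushforward ::
  "('m::topological_space, 'e::euclidean_space) chart set \<Rightarrow> ('m \<Rightarrow> 'm) \<Rightarrow>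
   'm tangent \<Rightarrow> 'm tangent" where
  "pushforward \<A> F v = (\<lambda>f. if f \<in> smooth_functions \<A> then v (f \<circ> F) else 0)"

definition lie_algebra ::
  "('m \<Rightarrow> 'm \<Rightarrow> 'm) \<Rightarrow> ('m::topological_space, 'e::euclidean_space) chart set \<Rightarrow>
   'm vfield set" where
  "lie_algebra mul \<A> = {X\<in>vector_fields \<A>.
     \<forall>a p. pushforward \<A> (mul a) (X p) = X (mul a p)}"

definition left_invariant ::
  "('m \<Rightarrow> 'm \<Rightarrow> 'm) \<Rightarrow> ('m::topological_space, 'e::euclidean_space) chart set \<Rightarrow>
   'm tensor2 \<Rightarrow> bool" where
  "left_invariant mul \<A> A \<longleftrightarrow>
     (\<forall>a p. \<forall>v\<in>tangent_space \<A> p. \<forall>w\<in>tangent_space \<A> p.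
        A (mul a p) (pushforward \<A> (mul a) v) (pushforward \<A> (mul a) w) = A p v w)"

definition lie_algebra_derivation :: "'m vfield set \<Rightarrow> ('m vfield \<Rightarrow> 'm vfield) \<Rightarrow> bool" where
  "lie_algebra_derivation \<hh> D \<longleftrightarrow>
     (\<forall>X\<in>\<hh>. D X \<in> \<hh>) \<and>
     (\<forall>X\<in>\<hh>. \<forall>Y\<in>\<hh>. D (\<lambda>p f. X p f + Y p f) = (\<lambda>p f. D X p f + D Y p f)) \<and>
     (\<forall>c. \<forall>X\<in>\<hh>. D (\<lambda>p f. c * X p f) = (\<lambda>p f. c * D X p f)) \<and>
     (\<forall>X\<in>\<hh>. \<forall>Y\<in>\<hh>. D (lie_bracket X Y) =
        (\<lambda>p f. lie_bracket (D X) Y p f + lie_bracket X (D Y) p f))"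

section \<open>Solitons\<close>

definition geometric_operator ::
  "('m::topological_space, 'e::euclidean_space) chart set \<Rightarrow> ('m tensor2 \<Rightarrow> 'm tensor2) \<Rightarrow> bool" where
  "geometric_operator \<A> T \<longleftrightarrow> (\<forall>g\<in>riemannian_metrics \<A>. T g \<in> symmetric_tensors \<A>)"

definition algebraic_soliton ::
  "('m \<Rightarrow> 'm \<Rightarrow> 'm) \<Rightarrow> ('m::topological_space, 'e::euclidean_space) chart set \<Rightarrow>
   ('m tensor2 \<Rightarrow> 'm tensor2) \<Rightarrow> 'm tensor2 \<Rightarrow> bool" where
  "algebraic_soliton mul \<A> T g \<longleftrightarrow>
     g \<in> riemannian_metrics \<A> \<and> left_invariant mul \<A> g \<and> left_invariant mul \<A> (T g) \<and>
     (\<exists>\<kappa>. lie_algebra_derivation (lie_algebra mul \<A>)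
        (\<lambda>X p f. hat \<A> g (T g) X p f - \<kappa> * X p f))"

definition soliton ::
  "('m::topological_space, 'e::euclidean_space) chart set \<Rightarrow>
   ('m tensor2 \<Rightarrow> 'm tensor2) \<Rightarrow> 'm tensor2 \<Rightarrow> bool" where
  "soliton \<A> T g \<longleftrightarrow> g \<in> riemannian_metrics \<A> \<and>
     (\<exists>X\<in>vector_fields \<A>. \<exists>\<beta>. \<forall>Y\<in>vector_fields \<A>. \<forall>Z\<in>vector_fields \<A>. \<forall>p.
        \<beta> * g p (Y p) (Z p) + lie_derivative X g Y Z p = T g p (Y p) (Z p))"

end

theory Submission
  imports Defs
begin

text \<open>If \<open>D\<close> is a derivation of the Lie algebra and \<open>X\<close> is a vector field with
  \<open>[X, Y] = - D Y / 2\<close> for all left invariant \<open>Y\<close>, then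
  \<open>(L\<^sub>X g)(Y, Z) = (g (D Y, Z) + g (Y, D Z)) / 2\<close>, which is \<open>T[g] - \<kappa> g\<close> for
  \<open>D = hat T[g] - \<kappa> Id\<close> because \<open>T[g]\<close> and \<open>g\<close> are symmetric. To find \<open>X\<close> without integrating
  \<open>D\<close> to a group of automorphisms, write \<open>X = (1/2) \<Sum> y\<^sub>i R\<^sub>i\<close> and \<open>D Y = \<Sum> \<alpha>\<^sub>i(Y) R\<^sub>i\<close> in a right
  invariant frame. As the \<open>R\<^sub>i\<close> commute with left invariant fields, the condition on \<open>X\<close> becomes
  \<open>dy\<^sub>i = \<alpha>\<^sub>i\<close>, and the derivation property of \<open>D\<close> says exactly that the one-forms \<open>\<alpha>\<^sub>i\<close> are closed.
  They are exact because the group is simply connected.\<close>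

section \<open>Calculus of smooth functions\<close>

text \<open>For left invariant Y, Z the coefficient of R_i in [D Y, Z] + [Y, D Z] - D [Y, Z] is
  Y(\<alpha>_i(Z)) - Z(\<alpha>_i(Y)) - \<alpha>_i([Y, Z]), which is Cartan's formula for
  d\<alpha>_i(Y, Z); since left invariant fields form a frame, these values decide closedness. The
  primitives y_i are fixed up to constants, and changing the constants alters X only by a right
  invariant field, which has no effect on its brackets with left invariant fields. Two obstacles
  shape the proof. Tangent vectors are derivations of the algebra of globally smooth functions, so
  whatever is constructed in a chart must be extended by a cutoff before a tangent vector can act on
  it. Simple connectedness is a statement about continuous homotopies, along which a one-form cannot
  be integrated directly, so local primitives are continued along them instead.\<close>

lemma k_smooth_on_cong:
  assumes "open S" "\<And>x. x \<in> S \<Longrightarrow> f x = g x"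
  shows "k_smooth_on k S f \<longleftrightarrow> k_smooth_on k S g"
proof -
  have "k_smooth_on k S g" if "k_smooth_on k S f" "\<And>x. x \<in> S \<Longrightarrow> f x = g x" for f g
    using that
  proof (induction k arbitrary: f g)
    case 0
    then show ?case using continuous_on_cong[of S S f g] by simp
  next
    case (Suc k)
    have 1: "g differentiable (at x)" if "x \<in> S" for x
      using Suc.prems that has_derivative_transform_within_open[OF _ assms(1)]
      unfolding k_smooth_on.simps differentiable_def by blast
    have 2: "frechet_derivative f (at x) v = frechet_derivative g (at x) v" if "x \<in> S" for x v
      using frechet_derivative_transform_within_open[of f x S g] Suc.prems that assms(1) by simp
    have 3: "k_smooth_on k S (\<lambda>x. frechet_derivative f (at x) v)" for v
      using Suc.prems(1) by simp
    have "k_smooth_on k S (\<lambda>x. frechet_derivative g (at x) v)" for v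
      by (rule Suc.IH[OF 3[of v]]) (rule 2)
    then show ?case using 1 by simp
  qed
  then show ?thesis using assms(2) by metis
qed

text \<open>On an open set a derivative found by the usual rules may replace the chosen
  \<open>frechet_derivative\<close>; this is the induction step of the closure properties
  below.\<close>

lemma k_smooth_on_SucI:
  assumes "open S" "\<And>x. x \<in> S \<Longrightarrow> (f has_derivative f' x) (at x)"
    and "\<And>v. k_smooth_on k S (\<lambda>x. f' x v)"
  shows "k_smooth_on (Suc k) S f"
proof -
  have "frechet_derivative f (at x) = f' x" if "x \<in> S" for x
    using assms(2)[OF that] frechet_derivative_at by metis
  then have "k_smooth_on k S (\<lambda>x. frechet_derivative f (at x) v)" for v
    using k_smooth_on_cong[OF assms(1), of "\<lambda>x. frechet_derivative f (at x) v" "\<lambda>x. f' x v"] assms(3) by simp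
  then show ?thesis using assms(2) by (auto simp: differentiable_def)
qed

lemma k_smooth_on_derivative:
  assumes "k_smooth_on (Suc k) S f" "x \<in> S"
  shows "(f has_derivative frechet_derivative f (at x)) (at x)"
  using assms frechet_derivative_works by auto

lemma k_smooth_on_Suc_imp: "k_smooth_on (Suc k) S f \<Longrightarrow> k_smooth_on k S f"
proof (induction k arbitrary: f)
  case 0
  then show ?case
    by (auto intro!: continuous_at_imp_continuous_on differentiable_imp_continuous_within)
next
  case (Suc k)
  then show ?case by (metis k_smooth_on.simps(2))
qed

lemma k_smooth_on_subset: "k_smooth_on k S f \<Longrightarrow> S' \<subseteq> S \<Longrightarrow> k_smooth_on k S' f"
  by (induction k arbitrary: f) (auto intro: continuous_on_subset)

text \<open>Both clauses of the definition are local: differentiability at x, and continuity on an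
  open \<open>W\<close>, refer to a full neighbourhood of the point.\<close>

lemma k_smooth_on_local:
  assumes "\<And>x. x \<in> S \<Longrightarrow> \<exists>W. open W \<and> x \<in> W \<and> k_smooth_on k W f"
  shows "k_smooth_on k S f"
  using assms
proof (induction k arbitrary: f)
  case 0
  have "isCont f x" if "x \<in> S" for x
    using 0[OF that] continuous_on_eq_continuous_at by auto
  then show ?case by (simp add: continuous_at_imp_continuous_on)
next
  case (Suc k)
  have "f differentiable (at x)" if "x \<in> S" for x
    using Suc.prems[OF that] by auto
  moreover have "k_smooth_on k S (\<lambda>x. frechet_derivative f (at x) v)" for v
    by (rule Suc.IH) (use Suc.prems in fastforce)
  ultimately show ?case by simp
qed

lemma k_smooth_on_const [simp]: "k_smooth_on k S (\<lambda>x. c)"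
  by (induction k arbitrary: c) auto

lemma k_smooth_on_bounded_linear_comp:
  assumes "open S" "bounded_linear L" "k_smooth_on k S f"
  shows "k_smooth_on k S (\<lambda>x. L (f x))"
  using assms(3)
proof (induction k arbitrary: f)
  case 0
  then show ?case using assms(2) by (simp add: bounded_linear.continuous_on)
next
  case (Suc k)
  show ?case
    using Suc.prems
    by (intro k_smooth_on_SucI[OF assms(1), where f'="\<lambda>x v. L (frechet_derivative f (at x) v)"]
          bounded_linear.has_derivative[OF assms(2)] k_smooth_on_derivative[OF Suc.prems] Suc.IH) auto
qed

lemma k_smooth_on_add:
  assumes "open S" "k_smooth_on k S f" "k_smooth_on k S g"
  shows "k_smooth_on k S (\<lambda>x. f x + g x)"
  using assms(2,3)
proof (induction k arbitrary: f g)
  case 0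
  then show ?case by (simp add: continuous_on_add)
next
  case (Suc k)
  show ?case
    using Suc.prems
    by (intro k_smooth_on_SucI[OF assms(1), where f'="\<lambda>x v. frechet_derivative f (at x) v + frechet_derivative g (at x) v"]
          has_derivative_add k_smooth_on_derivative[OF Suc.prems(1)] k_smooth_on_derivative[OF Suc.prems(2)] Suc.IH) auto
qed

lemma k_smooth_on_bilinear:
  assumes "open S" "bounded_bilinear B" "k_smooth_on k S f" "k_smooth_on k S g"
  shows "k_smooth_on k S (\<lambda>x. B (f x) (g x))"
  using assms(3,4)
proof (induction k arbitrary: f g)
  case 0
  then show ?case using assms(2) by (simp add: bounded_bilinear.continuous_on)
next
  case (Suc k)
  show ?case
  proof (rule k_smooth_on_SucI[OF assms(1), where f'="\<lambda>x v. B (f x) (frechet_derivative g (at x) v) + B (frechet_derivative f (at x) v) (g x)"])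
    fix x assume "x \<in> S"
    then show "((\<lambda>x. B (f x) (g x)) has_derivative (\<lambda>v. B (f x) (frechet_derivative g (at x) v) + B (frechet_derivative f (at x) v) (g x))) (at x)"
      by (intro bounded_bilinear.FDERIV[OF assms(2)] k_smooth_on_derivative[OF Suc.prems(1)]
          k_smooth_on_derivative[OF Suc.prems(2)])
  next
    fix v
    have "k_smooth_on k S f" "k_smooth_on k S g" using Suc.prems k_smooth_on_Suc_imp by auto
    then show "k_smooth_on k S (\<lambda>x. B (f x) (frechet_derivative g (at x) v) + B (frechet_derivative f (at x) v) (g x))"
      using Suc by (intro k_smooth_on_add[OF assms(1)]) auto
  qed
qed

lemma k_smooth_on_sum:
  assumes "open S" "\<And>i. i \<in> I \<Longrightarrow> k_smooth_on k S (f i)"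
  shows "k_smooth_on k S (\<lambda>x. \<Sum>i\<in>I. f i x)"
  using assms(2)
  by (induction I rule: infinite_finite_induct) (auto intro: k_smooth_on_add[OF assms(1)])

text \<open>The chain rule yields Dh (f x) (Df x v), where the direction fed to Dh moves with x.
  Expanding it in \<open>Basis\<close> gives a finite sum of smooth coefficients times Dh in fixed
  directions, and the induction hypothesis, general in \<open>h\<close>, covers the latter.\<close>

lemma k_smooth_on_compose:
  fixes f :: "'a::euclidean_space \<Rightarrow> 'b::euclidean_space" and h :: "'b \<Rightarrow> 'c::real_normed_vector"
  assumes "open S" "open T" "k_smooth_on k S f" "k_smooth_on k T h" "f ` S \<subseteq> T"
  shows "k_smooth_on k S (\<lambda>x. h (f x))"
  using assms(3,4)
proof (induction k arbitrary: h)
  case 0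
  then show ?case using assms(5) by (auto intro: continuous_on_compose2)
next
  case (Suc k)
  show ?case
  proof (rule k_smooth_on_SucI[OF assms(1), where f'="\<lambda>x v. frechet_derivative h (at (f x)) (frechet_derivative f (at x) v)"])
    fix x assume "x \<in> S"
    then show "((\<lambda>x. h (f x)) has_derivative (\<lambda>v. frechet_derivative h (at (f x)) (frechet_derivative f (at x) v))) (at x)"
      using k_smooth_on_derivative[OF Suc.prems(1)] k_smooth_on_derivative[OF Suc.prems(2), of "f x"] assms(5)
        diff_chain_at[of f _ x h] by (auto simp: o_def)
  next
    fix v
    have fk: "k_smooth_on k S f" using Suc.prems k_smooth_on_Suc_imp by auto
    have "k_smooth_on k S (\<lambda>x. \<Sum>b\<in>Basis. (frechet_derivative f (at x) v \<bullet> b) *\<^sub>R frechet_derivative h (at (f x)) b)"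
    proof (intro k_smooth_on_sum[OF assms(1)] k_smooth_on_bilinear[OF assms(1) bounded_bilinear_scaleR])
      fix b :: 'b assume "b \<in> Basis"
      show "k_smooth_on k S (\<lambda>x. frechet_derivative f (at x) v \<bullet> b)"
        using Suc.prems by (intro k_smooth_on_bounded_linear_comp[OF assms(1) bounded_linear_inner_left]) auto
      show "k_smooth_on k S (\<lambda>x. frechet_derivative h (at (f x)) b)"
        using Suc.IH[OF fk, of "\<lambda>y. frechet_derivative h (at y) b"] Suc.prems(2) by auto
    qed
    moreover have "(\<Sum>b\<in>Basis. (frechet_derivative f (at x) v \<bullet> b) *\<^sub>R frechet_derivative h (at (f x)) b)
        = frechet_derivative h (at (f x)) (frechet_derivative f (at x) v)" if "x \<in> S" for x
    proof -
      have "linear (frechet_derivative h (at (f x)))"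
        using Suc.prems(2) that assms(5) by (intro linear_frechet_derivative) auto
      then show ?thesis
        by (subst (2) euclidean_representation[symmetric])
           (simp add: linear_sum linear_scale)
    qed
    ultimately show "k_smooth_on k S (\<lambda>x. frechet_derivative h (at (f x)) (frechet_derivative f (at x) v))"
      by (subst k_smooth_on_cong[OF assms(1)]) auto
  qed
qed

lemma smooth_onD: "smooth_on S f \<Longrightarrow> k_smooth_on k S f"
  by (simp add: smooth_on_def)

lemma smooth_on_cong:
  assumes "open S" "\<And>x. x \<in> S \<Longrightarrow> f x = g x"
  shows "smooth_on S f \<longleftrightarrow> smooth_on S g"
  unfolding smooth_on_def using k_smooth_on_cong[OF assms] by simp

lemma smooth_on_subset: "smooth_on S f \<Longrightarrow> S' \<subseteq> S \<Longrightarrow> smooth_on S' f"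
  unfolding smooth_on_def using k_smooth_on_subset by blast

lemma smooth_on_local:
  assumes "\<And>x. x \<in> S \<Longrightarrow> \<exists>W. open W \<and> x \<in> W \<and> smooth_on W f"
  shows "smooth_on S f"
  unfolding smooth_on_def using assms k_smooth_on_local by (metis smooth_on_def)

lemma smooth_on_const [simp]: "smooth_on S (\<lambda>x. c)"
  by (simp add: smooth_on_def)

lemma smooth_on_derivative:
  assumes "smooth_on S f" "x \<in> S"
  shows "(f has_derivative frechet_derivative f (at x)) (at x)"
  using assms k_smooth_on_derivative[of 0 S f x] by (auto simp: smooth_on_def)

lemma smooth_on_frechet_derivative:
  "smooth_on S f \<Longrightarrow> smooth_on S (\<lambda>x. frechet_derivative f (at x) v)"
  unfolding smooth_on_def using k_smooth_on.simps(2) by blast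

lemma smooth_on_imp_continuous_on: "smooth_on S f \<Longrightarrow> continuous_on S f"
  using k_smooth_on.simps(1) smooth_on_def by blast

lemma smooth_onI:
  assumes "open S" "\<And>x. x \<in> S \<Longrightarrow> (f has_derivative f' x) (at x)"
    and "\<And>v. smooth_on S (\<lambda>x. f' x v)"
  shows "smooth_on S f"
proof -
  have "k_smooth_on (Suc k) S f" for k
    using k_smooth_on_SucI[OF assms(1,2)] assms(3) by (auto simp: smooth_on_def)
  then show ?thesis unfolding smooth_on_def using k_smooth_on_Suc_imp by blast
qed

lemma smooth_on_bounded_linear_comp:
  "open S \<Longrightarrow> bounded_linear L \<Longrightarrow> smooth_on S f \<Longrightarrow> smooth_on S (\<lambda>x. L (f x))"
  unfolding smooth_on_def using k_smooth_on_bounded_linear_comp by blast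

lemma smooth_on_bounded_linear: "open S \<Longrightarrow> bounded_linear L \<Longrightarrow> smooth_on S L"
  by (rule smooth_onI[where f'="\<lambda>x. L"]) (auto intro: bounded_linear_imp_has_derivative)

lemma smooth_on_id [simp]: "open S \<Longrightarrow> smooth_on S (\<lambda>x. x)"
  by (simp add: smooth_on_bounded_linear bounded_linear_ident)

lemma smooth_on_add:
  "open S \<Longrightarrow> smooth_on S f \<Longrightarrow> smooth_on S g \<Longrightarrow> smooth_on S (\<lambda>x. f x + g x)"
  unfolding smooth_on_def using k_smooth_on_add by blast

lemma smooth_on_sum:
  "open S \<Longrightarrow> (\<And>i. i \<in> I \<Longrightarrow> smooth_on S (f i)) \<Longrightarrow> smooth_on S (\<lambda>x. \<Sum>i\<in>I. f i x)"
  unfolding smooth_on_def using k_smooth_on_sum[of S I _ f] by simp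

lemma smooth_on_bilinear:
  "open S \<Longrightarrow> bounded_bilinear B \<Longrightarrow> smooth_on S f \<Longrightarrow> smooth_on S g \<Longrightarrow>
    smooth_on S (\<lambda>x. B (f x) (g x))"
  unfolding smooth_on_def using k_smooth_on_bilinear[of S B] by simp

lemma smooth_on_mult:
  fixes f g :: "'a::euclidean_space \<Rightarrow> real"
  shows "open S \<Longrightarrow> smooth_on S f \<Longrightarrow> smooth_on S g \<Longrightarrow> smooth_on S (\<lambda>x. f x * g x)"
  by (rule smooth_on_bilinear[OF _ bounded_bilinear_mult])

lemma smooth_on_diff:
  "open S \<Longrightarrow> smooth_on S f \<Longrightarrow> smooth_on S g \<Longrightarrow> smooth_on S (\<lambda>x. f x - g x)"
  using smooth_on_add[of S f "\<lambda>x. - g x"]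
    smooth_on_bounded_linear_comp[OF _ bounded_linear_minus[OF bounded_linear_ident], of S g]
  by simp

lemma smooth_on_compose:
  fixes f :: "'a::euclidean_space \<Rightarrow> 'b::euclidean_space"
  assumes "open S" "open T" "smooth_on S f" "smooth_on T h" "f ` S \<subseteq> T"
  shows "smooth_on S (\<lambda>x. h (f x))"
  unfolding smooth_on_def
  using k_smooth_on_compose[OF assms(1,2) smooth_onD[OF assms(3)] smooth_onD[OF assms(4)] assms(5)] by blast

text \<open>The derivative of \<open>inverse\<close> is a polynomial in \<open>inverse\<close>
  itself, so the induction closes on this one function.\<close>

lemma smooth_on_inverse: "smooth_on (-{0}) (inverse :: real \<Rightarrow> real)"
proof -
  have o: "open (-{0::real})" by (simp add: open_Compl)
  have "k_smooth_on k (-{0}) (inverse :: real \<Rightarrow> real)" for k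
  proof (induction k)
    case 0
    then show ?case by (auto intro!: continuous_intros)
  next
    case (Suc k)
    show ?case
    proof (rule k_smooth_on_SucI[OF o, where f'="\<lambda>x v. - (inverse x * inverse x) * v"])
      show "(inverse has_derivative (\<lambda>v. - (inverse x * inverse x) * v)) (at x)" if "x \<in> -{0}" for x :: real
        using that by (auto intro!: derivative_eq_intros simp: mult_ac)
      fix v
      show "k_smooth_on k (- {0}) (\<lambda>x::real. - (inverse x * inverse x) * v)"
        using k_smooth_on_bounded_linear_comp[OF o bounded_linear_mult_left[of "-v"] k_smooth_on_bilinear[OF o bounded_bilinear_mult Suc Suc]]
        by simp
    qed
  qed
  then show ?thesis by (simp add: smooth_on_def)
qed


section \<open>Smooth cutoff functions\<close>

definition flat_fun :: "nat \<Rightarrow> real \<Rightarrow> real" where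
  "flat_fun n x = (if x > 0 then inverse x ^ n * exp (- inverse x) else 0)"

lemma power_le_fact_exp:
  fixes y :: real
  assumes "0 \<le> y"
  shows "y ^ m \<le> fact m * exp y"
proof -
  have "(\<Sum>n<Suc m. y ^ n /\<^sub>R fact n) \<le> exp y"
    unfolding exp_def using assms by (intro sum_le_suminf summable_exp_generic) auto
  moreover have "y ^ m /\<^sub>R fact m \<le> (\<Sum>n<Suc m. y ^ n /\<^sub>R fact n)"
    using assms by (intro member_le_sum) auto
  ultimately have "y ^ m /\<^sub>R fact m \<le> exp y" by simp
  then show ?thesis by (simp add: divide_simps mult.commute)
qed

text \<open>One term of the exponential series beats the pole: two extra powers of 1/x are traded
  for the factor \<open>x\<^sup>2\<close>, so that the difference quotient at 0 is bounded by a
  multiple of \<open>\<bar>x\<bar>\<close>.\<close>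

lemma flat_fun_bound: "\<bar>flat_fun n x\<bar> \<le> fact (n + 2) * x\<^sup>2"
proof (cases "x > 0")
  case True
  have "inverse x ^ (n + 2) \<le> fact (n + 2) * exp (inverse x)"
    using True by (intro power_le_fact_exp) simp
  then have "inverse x ^ (n + 2) * exp (- inverse x) \<le> fact (n + 2) * exp (inverse x) * exp (- inverse x)"
    by (intro mult_right_mono) auto
  then have "inverse x ^ (n + 2) * exp (- inverse x) \<le> fact (n + 2)"
    by (simp only: mult.assoc exp_minus_inverse mult_1_right)
  then have "inverse x ^ (n + 2) * exp (- inverse x) * x\<^sup>2 \<le> fact (n + 2) * x\<^sup>2"
    by (intro mult_right_mono) auto
  moreover have "inverse x ^ (n + 2) * exp (- inverse x) * x\<^sup>2 = flat_fun n x"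
    using True by (simp add: flat_fun_def field_simps power2_eq_square)
  moreover have "flat_fun n x \<ge> 0" using True by (simp add: flat_fun_def)
  ultimately show ?thesis by simp
qed (simp add: flat_fun_def)

text \<open>Differentiation stays inside the family, which is why the power \<open>n\<close> is
  carried along: smoothness of all members follows by one simultaneous induction.\<close>

lemma flat_fun_has_derivative:
  "(flat_fun n has_field_derivative (flat_fun (n + 2) x - real n * flat_fun (n + 1) x)) (at x)"
proof -
  consider "x > 0" | "x < 0" | "x = 0" by linarith
  then show ?thesis
  proof cases
    case 1
    have "((\<lambda>x. inverse x ^ n * exp (- inverse x)) has_field_derivative
        (flat_fun (n + 2) x - real n * flat_fun (n + 1) x)) (at x)"
    proof -
      have d: "(inverse has_field_derivative - (inverse x ^ Suc (Suc 0))) (at x)"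
        using 1 by (intro DERIV_inverse) simp
      show ?thesis
        by (rule DERIV_cong[OF DERIV_mult[OF DERIV_power[OF d, of n] DERIV_chain2[OF DERIV_exp DERIV_minus[OF d]]]])
          (use 1 in \<open>cases n; simp add: flat_fun_def algebra_simps\<close>)
    qed

    then show ?thesis
      by (rule has_field_derivative_transform_within_open[where S="{0<..}"]) (use 1 in \<open>auto simp: flat_fun_def\<close>)
  next
    case 2
    have "((\<lambda>x. 0) has_field_derivative 0) (at x)" by simp
    then have "(flat_fun n has_field_derivative 0) (at x)"
      by (rule has_field_derivative_transform_within_open[where S="{..<0}"]) (use 2 in \<open>auto simp: flat_fun_def\<close>)
    then show ?thesis using 2 by (simp add: flat_fun_def)
  next
    case 3
    have "((\<lambda>y. (flat_fun n y - flat_fun n 0) / (y - 0)) \<longlongrightarrow> 0) (at 0)"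
    proof (rule Lim_null_comparison)
      show "\<forall>\<^sub>F y in at 0. norm ((flat_fun n y - flat_fun n 0) / (y - 0)) \<le> fact (n + 2) * \<bar>y\<bar>"
      proof (rule eventually_at_filter[THEN iffD2], rule always_eventually, intro allI impI)
        fix y :: real assume "y \<noteq> 0"
        then show "norm ((flat_fun n y - flat_fun n 0) / (y - 0)) \<le> fact (n + 2) * \<bar>y\<bar>"
          using flat_fun_bound[of n y]
          by (simp add: flat_fun_def[of n 0] divide_le_eq power2_eq_square mult.assoc del: fact_Suc)
      qed
      show "((\<lambda>y. fact (n + 2) * \<bar>y\<bar>) \<longlongrightarrow> 0) (at (0::real))"
        by (auto intro!: tendsto_eq_intros)
    qed
    then have "(flat_fun n has_field_derivative 0) (at 0)"
      by (simp add: has_field_derivative_iff)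
    then show ?thesis using 3 by (simp add: flat_fun_def)
  qed
qed

lemma smooth_on_flat_fun: "smooth_on UNIV (flat_fun n)"
proof -
  have "k_smooth_on k UNIV (flat_fun n)" for k n
  proof (induction k arbitrary: n)
    case 0
    show ?case using flat_fun_has_derivative
      by (auto intro!: continuous_at_imp_continuous_on DERIV_isCont)
  next
    case (Suc k)
    show ?case
    proof (rule k_smooth_on_SucI[OF open_UNIV])
      show "(flat_fun n has_derivative (*) (flat_fun (n + 2) x - real n * flat_fun (n + 1) x)) (at x)" for x
        using flat_fun_has_derivative[of n x] by (simp add: has_field_derivative_def)
      fix v
      have c: "k_smooth_on k UNIV (\<lambda>x. c *\<^sub>R flat_fun m x)" for c m
        by (rule k_smooth_on_bounded_linear_comp[OF open_UNIV bounded_linear_scaleR_right Suc])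
      have "k_smooth_on k UNIV (\<lambda>x. (v *\<^sub>R flat_fun (n + 2) x) + ((- real n * v) *\<^sub>R flat_fun (n + 1) x))"
        by (rule k_smooth_on_add[OF open_UNIV c c])
      then show "k_smooth_on k UNIV (\<lambda>x. (flat_fun (n + 2) x - real n * flat_fun (n + 1) x) * v)"
        by (simp add: algebra_simps)
    qed
  qed
  then show ?thesis by (simp add: smooth_on_def)
qed

lemma smooth_step:
  obtains \<sigma> :: "real \<Rightarrow> real"
  where "smooth_on UNIV \<sigma>" "\<And>t. t \<le> 0 \<Longrightarrow> \<sigma> t = 0" "\<And>t. 1 \<le> t \<Longrightarrow> \<sigma> t = 1"
proof
  let ?r = "flat_fun 0"
  \<comment> \<open>The denominator never vanishes since t and 1 - t are not both nonpositive; for t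
    \<ge> 1 its second summand is zero.\<close>
  let ?\<sigma> = "\<lambda>t. ?r t * inverse (?r t + ?r (1 - t))"
  have p: "?r t + ?r (1 - t) > 0" for t
    by (cases "t > 0"; cases "t < 1") (auto simp: flat_fun_def add_pos_pos)
  have 1: "smooth_on UNIV (\<lambda>t. ?r (1 - t))"
    by (rule smooth_on_compose[OF _ _ smooth_on_diff smooth_on_flat_fun]) auto
  have 2: "smooth_on UNIV (\<lambda>t. ?r t + ?r (1 - t))"
    by (intro smooth_on_add smooth_on_flat_fun 1) simp
  have "smooth_on UNIV (\<lambda>t. inverse (?r t + ?r (1 - t)))"
  proof (rule smooth_on_compose[OF _ _ 2 smooth_on_inverse])
    show "(\<lambda>t. ?r t + ?r (1 - t)) ` UNIV \<subseteq> - {0}"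
      using p by (auto simp: less_le)
  qed (auto simp: open_Compl)
  then show "smooth_on UNIV ?\<sigma>"
    by (intro smooth_on_mult smooth_on_flat_fun) simp
  show "?\<sigma> t = 0" if "t \<le> 0" for t using that by (simp add: flat_fun_def)
  show "?\<sigma> t = 1" if "1 \<le> t" for t using that by (simp add: flat_fun_def)
qed

lemma smooth_cutoff:
  fixes a :: "'e::euclidean_space"
  assumes "0 < r"
  obtains \<beta> :: "'e \<Rightarrow> real"
  where "smooth_on UNIV \<beta>" "\<And>x. x \<in> ball a r \<Longrightarrow> \<beta> x = 1" "\<And>x. x \<notin> ball a (2 * r) \<Longrightarrow> \<beta> x = 0"
proof -
  obtain \<sigma> :: "real \<Rightarrow> real"
    where \<sigma>: "smooth_on UNIV \<sigma>" "\<And>t. t \<le> 0 \<Longrightarrow> \<sigma> t = 0" "\<And>t. 1 \<le> t \<Longrightarrow> \<sigma> t = 1"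
    using smooth_step by blast
  \<comment> \<open>The squared distance keeps this smooth at the centre; the constants make it 1 at
    distance r and 0 at distance 2 r.\<close>
  let ?q = "\<lambda>x. (4 * r\<^sup>2 - (x - a) \<bullet> (x - a)) * inverse (3 * r\<^sup>2)"
  have "smooth_on UNIV ?q"
    by (intro smooth_on_mult smooth_on_diff smooth_on_const smooth_on_bilinear[OF _ bounded_bilinear_inner]) auto
  then have 1: "smooth_on UNIV (\<lambda>x. \<sigma> (?q x))"
    by (rule smooth_on_compose[OF open_UNIV open_UNIV _ \<sigma>(1) subset_UNIV])
  have n: "(x - a) \<bullet> (x - a) = (dist a x)\<^sup>2" for x
    by (metis dist_norm dist_commute power2_norm_eq_inner)
  show thesis
  proof (rule that[OF 1])
    fix x assume "x \<in> ball a r"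
    then have "(dist a x)\<^sup>2 \<le> r\<^sup>2" by (intro power_mono) auto
    then have "1 \<le> ?q x" using assms by (simp add: n divide_simps)
    then show "\<sigma> (?q x) = 1" by (rule \<sigma>(3))
  next
    fix x assume "x \<notin> ball a (2 * r)"
    then have "(2 * r)\<^sup>2 \<le> (dist a x)\<^sup>2" using assms by (intro power_mono) auto
    then have "?q x \<le> 0" using assms by (simp add: n divide_simps power_mult_distrib mult_le_0_iff)
    then show "\<sigma> (?q x) = 0" by (rule \<sigma>(2))
  qed
qed

section \<open>Symmetry of second derivatives\<close>

lemma ray_has_real_derivative:
  fixes a :: "'e::euclidean_space" and f :: "'e \<Rightarrow> real"
  assumes "smooth_on S f" "a + t *\<^sub>R w \<in> S"
  shows "((\<lambda>t. f (a + t *\<^sub>R w)) has_real_derivative frechet_derivative f (at (a + t *\<^sub>R w)) w) (at t)"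
proof -
  have "((\<lambda>t. a + t *\<^sub>R w) has_derivative (\<lambda>t. t *\<^sub>R w)) (at t)"
    by (auto intro!: derivative_eq_intros)
  from diff_chain_at[OF this smooth_on_derivative[OF assms]]
  have "((\<lambda>t. f (a + t *\<^sub>R w)) has_derivative (\<lambda>t'. frechet_derivative f (at (a + t *\<^sub>R w)) (t' *\<^sub>R w))) (at t)"
    by (simp add: o_def)
  moreover have "linear (frechet_derivative f (at (a + t *\<^sub>R w)))"
    using smooth_on_derivative[OF assms] has_derivative_linear by blast
  then have "(\<lambda>t'. frechet_derivative f (at (a + t *\<^sub>R w)) (t' *\<^sub>R w)) =
      (*) (frechet_derivative f (at (a + t *\<^sub>R w)) w)"
    by (auto simp: linear_scale mult.commute)
  ultimately show ?thesis by (simp add: has_field_derivative_def)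
qed

text \<open>Two mean value theorems turn the second difference into \<open>h\<^sup>2\<close> times
  the mixed derivative at an intermediate point, and continuity of that derivative controls the
  error.\<close>

lemma mixed_difference_estimate:
  fixes f :: "'e::euclidean_space \<Rightarrow> real"
  assumes S: "open S" "x \<in> S" and f: "smooth_on S f" and "0 < \<epsilon>"
  shows "\<exists>\<delta>>0. \<forall>h. 0 < h \<and> h < \<delta> \<longrightarrow>
    \<bar>f (x + h *\<^sub>R u + h *\<^sub>R v) - f (x + h *\<^sub>R u) - f (x + h *\<^sub>R v) + f x -
      h\<^sup>2 * frechet_derivative (\<lambda>y. frechet_derivative f (at y) u) (at x) v\<bar> \<le> \<epsilon> * h\<^sup>2"
proof -
  define fu where "fu = (\<lambda>y. frechet_derivative f (at y) u)"
  define fuv where "fuv = (\<lambda>y. frechet_derivative fu (at y) v)"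
  have sfu: "smooth_on S fu" unfolding fu_def by (rule smooth_on_frechet_derivative[OF f])
  have "continuous_on S fuv" unfolding fuv_def
    by (rule smooth_on_imp_continuous_on[OF smooth_on_frechet_derivative[OF sfu]])
  then have "\<forall>\<^sub>F y in nhds x. dist (fuv y) (fuv x) < \<epsilon> \<and> y \<in> S"
    using S \<open>0 < \<epsilon>\<close> by (intro eventually_conj eventually_nhds_in_open)
      (auto simp: continuous_on_eq_continuous_at isCont_def tendsto_iff eventually_at_filter
        dest!: bspec elim!: eventually_mono)
  then obtain \<rho> where \<rho>: "\<rho> > 0" "\<And>y. dist y x < \<rho> \<Longrightarrow> dist (fuv y) (fuv x) < \<epsilon> \<and> y \<in> S"
    unfolding eventually_nhds_metric by blast
  \<comment> \<open>At this scale all points x + s u + t v with s and t between 0 and h stay within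
    \<rho> of x; the summand 1 keeps the denominator positive when u and v vanish.\<close>
  define \<delta> where "\<delta> = \<rho> / (norm u + norm v + 1)"
  have "\<delta> > 0" using \<rho> by (simp add: \<delta>_def add_nonneg_pos)
  moreover have "\<bar>f (x + h *\<^sub>R u + h *\<^sub>R v) - f (x + h *\<^sub>R u) - f (x + h *\<^sub>R v) + f x - h\<^sup>2 * fuv x\<bar> \<le> \<epsilon> * h\<^sup>2"
    if h: "0 < h" "h < \<delta>" for h
  proof -
    have near: "dist (x + s *\<^sub>R u + t *\<^sub>R v) x < \<rho>" if "0 \<le> s" "s \<le> h" "0 \<le> t" "t \<le> h" for s t
    proof -
      have "norm (s *\<^sub>R u + t *\<^sub>R v) \<le> s * norm u + t * norm v"
        using norm_triangle_ineq[of "s *\<^sub>R u" "t *\<^sub>R v"] that by simp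
      also have "\<dots> \<le> h * norm u + h * norm v"
        using that by (intro add_mono mult_right_mono) auto
      also have "\<dots> < h * (norm u + norm v + 1)" using h by (simp add: algebra_simps)
      also have "\<dots> < \<delta> * (norm u + norm v + 1)" using h by (intro mult_strict_right_mono) (auto simp: add_nonneg_pos)
      also have "\<dots> = \<rho>" by (simp add: \<delta>_def add_nonneg_pos less_imp_neq[symmetric])
      finally show ?thesis by (simp add: dist_norm add.assoc)
    qed
    note line = ray_has_real_derivative
    \<comment> \<open>The mean value theorem is applied to the function sending s to f (x + h v + s
      u) - f (x + s u), whose increment over [0, h] is the second difference.\<close>
    have "\<exists>s. 0 < s \<and> s < h \<and>
       (f ((x + h *\<^sub>R v) + h *\<^sub>R u) - f (x + h *\<^sub>R u)) - (f ((x + h *\<^sub>R v) + 0 *\<^sub>R u) - f (x + 0 *\<^sub>R u))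
        = (h - 0) * (fu ((x + h *\<^sub>R v) + s *\<^sub>R u) - fu (x + s *\<^sub>R u))"
    proof (rule MVT2[OF h(1)])
      fix s assume "0 \<le> s" "s \<le> h"
      then have "x + h *\<^sub>R v + s *\<^sub>R u \<in> S" "x + s *\<^sub>R u \<in> S"
        using near[of s h] near[of s 0] h \<rho>(2) by (auto simp: algebra_simps)
      then show "((\<lambda>s. f (x + h *\<^sub>R v + s *\<^sub>R u) - f (x + s *\<^sub>R u)) has_real_derivative
          fu (x + h *\<^sub>R v + s *\<^sub>R u) - fu (x + s *\<^sub>R u)) (at s)"
        unfolding fu_def by (intro DERIV_diff line[OF f])
    qed
    then obtain s where s: "0 < s" "s < h"
      "(f ((x + h *\<^sub>R v) + h *\<^sub>R u) - f (x + h *\<^sub>R u)) - (f (x + h *\<^sub>R v) - f x)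
        = h * (fu ((x + h *\<^sub>R v) + s *\<^sub>R u) - fu (x + s *\<^sub>R u))" by auto
    have "\<exists>t. 0 < t \<and> t < h \<and> fu (x + s *\<^sub>R u + h *\<^sub>R v) - fu (x + s *\<^sub>R u + 0 *\<^sub>R v) = (h - 0) * fuv (x + s *\<^sub>R u + t *\<^sub>R v)"
    proof (rule MVT2[OF h(1)])
      fix t assume "0 \<le> t" "t \<le> h"
      then have "x + s *\<^sub>R u + t *\<^sub>R v \<in> S" using near[of s t] s \<rho>(2) by auto
      then show "((\<lambda>t. fu (x + s *\<^sub>R u + t *\<^sub>R v)) has_real_derivative fuv (x + s *\<^sub>R u + t *\<^sub>R v)) (at t)"
        unfolding fuv_def by (intro line[OF sfu])
    qed
    then obtain t where t: "0 < t" "t < h" "fu (x + s *\<^sub>R u + h *\<^sub>R v) - fu (x + s *\<^sub>R u) = h * fuv (x + s *\<^sub>R u + t *\<^sub>R v)"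
      by auto
    have e: "x + h *\<^sub>R v + s *\<^sub>R u = x + s *\<^sub>R u + h *\<^sub>R v" "x + h *\<^sub>R v + h *\<^sub>R u = x + h *\<^sub>R u + h *\<^sub>R v"
      by (simp_all add: algebra_simps)
    have eq: "f (x + h *\<^sub>R u + h *\<^sub>R v) - f (x + h *\<^sub>R u) - f (x + h *\<^sub>R v) + f x = h\<^sup>2 * fuv (x + s *\<^sub>R u + t *\<^sub>R v)"
      using s(3) unfolding e t(3) by (simp add: power2_eq_square)
    have "dist (fuv (x + s *\<^sub>R u + t *\<^sub>R v)) (fuv x) < \<epsilon>"
      using near[of s t] s t \<rho>(2) by simp
    then have "\<bar>fuv (x + s *\<^sub>R u + t *\<^sub>R v) - fuv x\<bar> * h\<^sup>2 \<le> \<epsilon> * h\<^sup>2"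
      by (intro mult_right_mono) (auto simp: dist_real_def)
    moreover have "h\<^sup>2 * fuv (x + s *\<^sub>R u + t *\<^sub>R v) - h\<^sup>2 * fuv x = (fuv (x + s *\<^sub>R u + t *\<^sub>R v) - fuv x) * h\<^sup>2"
      by (simp add: algebra_simps)
    ultimately show ?thesis unfolding eq by (simp add: abs_mult)
  qed
  ultimately show ?thesis unfolding fuv_def fu_def by blast
qed

text \<open>The second difference is symmetric in u and v, so both mixed derivatives approximate the
  same quantity to any accuracy relative to \<open>h\<^sup>2\<close>.\<close>

lemma smooth_on_derivatives_commute:
  fixes f :: "'e::euclidean_space \<Rightarrow> real"
  assumes S: "open S" "x \<in> S" and f: "smooth_on S f"
  shows "frechet_derivative (\<lambda>y. frechet_derivative f (at y) u) (at x) v =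
    frechet_derivative (\<lambda>y. frechet_derivative f (at y) v) (at x) u" (is "?a = ?b")
proof -
  have "\<bar>?a - ?b\<bar> \<le> e" if "e > 0" for e
  proof -
    obtain d1 where d1: "d1 > 0" "\<And>h. 0 < h \<Longrightarrow> h < d1 \<Longrightarrow>
      \<bar>f (x + h *\<^sub>R u + h *\<^sub>R v) - f (x + h *\<^sub>R u) - f (x + h *\<^sub>R v) + f x - h\<^sup>2 * ?a\<bar> \<le> (e/2) * h\<^sup>2"
      using mixed_difference_estimate[OF assms, of "e/2" u v] \<open>e > 0\<close> by auto
    obtain d2 where d2: "d2 > 0" "\<And>h. 0 < h \<Longrightarrow> h < d2 \<Longrightarrow>
      \<bar>f (x + h *\<^sub>R v + h *\<^sub>R u) - f (x + h *\<^sub>R v) - f (x + h *\<^sub>R u) + f x - h\<^sup>2 * ?b\<bar> \<le> (e/2) * h\<^sup>2"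
      using mixed_difference_estimate[OF assms, of "e/2" v u] \<open>e > 0\<close> by auto
    define h where "h = min d1 d2 / 2"
    have h: "0 < h" "h < d1" "h < d2" using d1(1) d2(1) by (auto simp: h_def)
    have c: "x + h *\<^sub>R v + h *\<^sub>R u = x + h *\<^sub>R u + h *\<^sub>R v" by (simp add: algebra_simps)
    have "\<bar>h\<^sup>2 * ?a - h\<^sup>2 * ?b\<bar> \<le> e * h\<^sup>2"
      using d1(2)[OF h(1,2)] d2(2)[OF h(1,3)] unfolding c by linarith
    then have "\<bar>?a - ?b\<bar> * h\<^sup>2 \<le> e * h\<^sup>2"
      by (simp add: right_diff_distrib[symmetric] abs_mult mult.commute)
    then show ?thesis using h by simp
  qed
  then have "\<bar>?a - ?b\<bar> \<le> 0" by (rule field_le_epsilon[of _ 0, simplified])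
  then show ?thesis by linarith
qed

section \<open>Integrals depending on a parameter\<close>

lemma param_integral_has_derivative:
  fixes F :: "'e::euclidean_space \<times> real \<Rightarrow> real"
  assumes S: "open S" "convex S" and W: "open W" "S \<times> {0..1} \<subseteq> W"
    and F: "k_smooth_on (Suc k) W F" and x: "x \<in> S"
  shows "((\<lambda>x. integral {0..1} (\<lambda>t. F (x, t))) has_derivative
    (\<lambda>v. integral {0..1} (\<lambda>t. frechet_derivative F (at (x, t)) (v, 0)))) (at x)"
proof -
  \<comment> \<open>\<open>leibniz_rule\<close> wants the derivative as a jointly continuous family
    of bounded linear maps; its continuity is checked on basis vectors.\<close>
  define fx where "fx = (\<lambda>x t. Blinfun (\<lambda>v. frechet_derivative F (at (x, t)) (v, 0)))"
  have D: "(F has_derivative frechet_derivative F (at (x, t))) (at (x, t))" if "x \<in> S" "t \<in> {0..1}" for x t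
    by (rule k_smooth_on_derivative[OF F]) (use that W(2) in auto)
  have bl: "bounded_linear (\<lambda>v. frechet_derivative F (at (x, t)) (v, 0))" if "x \<in> S" "t \<in> {0..1}" for x t
    using bounded_linear_compose[OF has_derivative_bounded_linear[OF D[OF that]], of "\<lambda>v. (v, 0)"]
    by (simp add: bounded_linear_Pair bounded_linear_ident bounded_linear_zero)
  have ap: "blinfun_apply (fx x t) v = frechet_derivative F (at (x, t)) (v, 0)" if "x \<in> S" "t \<in> {0..1}" for x t v
    unfolding fx_def using bounded_linear_Blinfun_apply[OF bl[OF that]] by simp
  have 0: "continuous_on W G" if "k_smooth_on k W G" for G :: "'e \<times> real \<Rightarrow> real"
    using that by (induction k) (auto simp del: k_smooth_on.simps(2) dest: k_smooth_on_Suc_imp)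
  have cD: "continuous_on (S \<times> {0..1}) (\<lambda>(x, t). frechet_derivative F (at (x, t)) (v, 0))" for v
  proof -
    have "continuous_on W (\<lambda>z. frechet_derivative F (at z) (v, 0))"
      using F by (intro 0) simp
    then show ?thesis using W(2) by (auto simp: split_beta intro: continuous_on_subset)
  qed
  have cfx: "continuous_on (S \<times> cbox 0 1) (\<lambda>(x, t). fx x t)"
  proof (rule continuous_on_blinfun_componentwise)
    fix i :: 'e
    show "continuous_on (S \<times> cbox 0 1) (\<lambda>z. blinfun_apply (case z of (x, t) \<Rightarrow> fx x t) i)"
      using cD[of i] unfolding cbox_interval by (rule continuous_on_eq) (auto simp: ap)
  qed
  have cF: "continuous_on (S \<times> {0..1}) F"
    using has_derivative_continuous[OF D] by (auto intro!: continuous_at_imp_continuous_on)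
  have cFx: "continuous_on {0..1} (\<lambda>t. F (x, t))" if "x \<in> S" for x
    using that by (intro continuous_on_compose2[OF cF] continuous_intros) auto
  have "((\<lambda>x. integral (cbox 0 1) (\<lambda>t. F (x, t))) has_derivative integral (cbox 0 1) (fx x)) (at x within S)"
  proof (rule leibniz_rule[OF _ _ cfx x S(2)])
    fix y and t :: real assume yt: "y \<in> S" "t \<in> cbox 0 1"
    then have t: "t \<in> {0..1}" by simp
    have "((\<lambda>y. (y, t)) has_derivative (\<lambda>v. (v, 0))) (at y within S)"
      by (auto intro!: derivative_eq_intros)
    then have "((\<lambda>y. F (y, t)) has_derivative (\<lambda>v. frechet_derivative F (at (y, t)) (v, 0))) (at y within S)"
      using has_derivative_in_compose[of "\<lambda>y. (y, t)" "\<lambda>v. (v, 0)" y S F]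
        has_derivative_at_withinI[OF D[OF yt(1) t]] by blast
    then show "((\<lambda>y. F (y, t)) has_derivative blinfun_apply (fx y t)) (at y within S)"
      using ap[OF yt(1) t] by presburger
  next
    show "(\<lambda>t. F (y, t)) integrable_on cbox 0 1" if "y \<in> S" for y
      using cFx[OF that] by (intro integrable_continuous) simp
  qed
  moreover have "blinfun_apply (integral (cbox 0 1) (fx x)) =
      (\<lambda>v. integral {0..1} (\<lambda>t. frechet_derivative F (at (x, t)) (v, 0)))"
  proof
    fix v
    have "continuous_on (cbox 0 1) (\<lambda>t::real. (x, t))"
      by (intro continuous_intros)
    then have "continuous_on (cbox 0 1) (fx x)"
      using x continuous_on_compose2[OF cfx, of "cbox 0 1" "\<lambda>t. (x, t)"]
      by (simp add: image_subset_iff)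
    then have "blinfun_apply (integral (cbox 0 1) (fx x)) v = integral (cbox 0 1) (\<lambda>t. blinfun_apply (fx x t) v)"
      using integral_linear[OF integrable_continuous, of 0 1 "fx x" "\<lambda>b. blinfun_apply b v"]
      by (simp add: o_def blinfun.bounded_linear_left)
    also have "\<dots> = integral {0..1} (\<lambda>t. frechet_derivative F (at (x, t)) (v, 0))"
      unfolding cbox_interval by (rule integral_cong) (use ap[OF x] in auto)
    finally show "blinfun_apply (integral (cbox 0 1) (fx x)) v =
      integral {0..1} (\<lambda>t. frechet_derivative F (at (x, t)) (v, 0))" .
  qed
  ultimately show ?thesis using S(1) x at_within_open[OF x S(1)] by simp
qed

text \<open>Derivatives at t = 0 and t = 1 are two-sided, hence the open set \<open>W\<close> around
  the closed strip. Differentiating in x turns \<open>F\<close> into its derivative in the direction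
  (v, 0), to which the induction hypothesis applies.\<close>

lemma k_smooth_on_param_integral:
  fixes F :: "'e::euclidean_space \<times> real \<Rightarrow> real"
  assumes S: "open S" "convex S" and W: "open W" "S \<times> {0..1} \<subseteq> W"
    and F: "k_smooth_on k W F"
  shows "k_smooth_on k S (\<lambda>x. integral {0..1} (\<lambda>t. F (x, t)))"
  using F
proof (induction k arbitrary: F)
  case 0
  then have "continuous_on (S \<times> cbox 0 1) (\<lambda>(x, t). F (x, t))"
    using W(2) by (auto intro: continuous_on_subset)
  then show ?case using integral_continuous_on_param[of S 0 1 "\<lambda>x t. F (x, t)"] by simp
next
  case (Suc k)
  show ?case
    by (rule k_smooth_on_SucI[OF S(1)])
      (use param_integral_has_derivative[OF S W Suc.prems]
        Suc.IH[of "\<lambda>z. frechet_derivative F (at z) (v, 0)" for v] Suc.prems in auto)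
qed

lemma smooth_on_param_integral:
  fixes F :: "'e::euclidean_space \<times> real \<Rightarrow> real"
  assumes "open S" "convex S" "open W" "S \<times> {0..1} \<subseteq> W" "smooth_on W F"
  shows "smooth_on S (\<lambda>x. integral {0..1} (\<lambda>t. F (x, t)))"
  using assms k_smooth_on_param_integral[OF assms(1-4)] unfolding smooth_on_def by blast


section \<open>Hadamard's lemma and the Poincare lemma on a ball\<close>

lemma smooth_on_linear_pair:
  "smooth_on UNIV (fst :: 'a::euclidean_space \<times> 'b::euclidean_space \<Rightarrow> 'a)"
  "smooth_on UNIV (snd :: 'a \<times> 'b \<Rightarrow> 'b)"
  by (auto intro: smooth_on_bounded_linear bounded_linear_fst bounded_linear_snd)

text \<open>The map involved is the contraction of the ball towards its centre. \<open>W\<close> is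
  where it lands in the ball, which provides the open set that
  \<open>smooth_on_param_integral\<close> asks for around the closed strip.\<close>

lemma ray_domain:
  fixes a :: "'e::euclidean_space" and r :: real and h :: "'e \<Rightarrow> real"
  defines "W \<equiv> {z::'e \<times> real. a + snd z *\<^sub>R (fst z - a) \<in> ball a r}"
  shows "open W" "ball a r \<times> {0..1} \<subseteq> W"
    and "smooth_on (ball a r) h \<Longrightarrow> smooth_on W (\<lambda>z. h (a + snd z *\<^sub>R (fst z - a)))"
proof -
  have s: "smooth_on UNIV (\<lambda>z::'e \<times> real. a + snd z *\<^sub>R (fst z - a))"
    by (intro smooth_on_add smooth_on_diff smooth_on_bilinear[OF _ bounded_bilinear_scaleR]
        smooth_on_linear_pair smooth_on_const open_UNIV)
  have "W = (\<lambda>z. a + snd z *\<^sub>R (fst z - a)) -` ball a r" by (auto simp: W_def)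
  then show o: "open W"
    using smooth_on_imp_continuous_on[OF s] by (simp add: continuous_on_open_vimage)
  show "ball a r \<times> {0..1} \<subseteq> W"
  proof
    fix z assume z: "z \<in> ball a r \<times> {0..1::real}"
    then have "\<bar>snd z\<bar> * norm (fst z - a) \<le> norm (fst z - a)"
      by (intro mult_left_le_one_le) auto
    also have "\<dots> < r" using z by (auto simp: dist_norm norm_minus_commute)
    finally show "z \<in> W" by (simp add: W_def dist_norm)
  qed
  show "smooth_on W (\<lambda>z. h (a + snd z *\<^sub>R (fst z - a)))" if "smooth_on (ball a r) h"
    by (rule smooth_on_compose[OF o open_ball smooth_on_subset[OF s subset_UNIV] that]) (auto simp: W_def)
qed

lemma frechet_derivative_Basis_sum:
  fixes a :: "'e::euclidean_space" and f :: "'e \<Rightarrow> real"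
  assumes "smooth_on S f" "x \<in> S"
  shows "frechet_derivative f (at x) w = (\<Sum>b\<in>Basis. (w \<bullet> b) * frechet_derivative f (at x) b)"
proof -
  have l: "linear (frechet_derivative f (at x))"
    using smooth_on_derivative[OF assms] has_derivative_linear by blast
  have "frechet_derivative f (at x) w = frechet_derivative f (at x) (\<Sum>b\<in>Basis. (w \<bullet> b) *\<^sub>R b)"
    by (simp add: euclidean_representation)
  then show ?thesis by (simp only: linear_sum[OF l] linear_scale[OF l] real_scaleR_def)
qed

text \<open>Integrate the derivative of f along the segment from a to x and take the coordinates of
  x - a out of the integral: the partial derivatives averaged over the segment remain as
  \<open>h\<close>. For x = a the segment degenerates, which gives their value there.\<close>

lemma hadamard:
  fixes f :: "'e::euclidean_space \<Rightarrow> real"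
  assumes f: "smooth_on (ball a r) f" and "0 < r"
  obtains h where "\<And>b. smooth_on (ball a r) (h b)"
    and "\<And>b. h b a = frechet_derivative f (at a) b"
    and "\<And>x. x \<in> ball a r \<Longrightarrow> f x = f a + (\<Sum>b\<in>Basis. ((x - a) \<bullet> b) * h b x)"
proof
  define D where "D = (\<lambda>b x. frechet_derivative f (at x) b)"
  define h where "h = (\<lambda>b x. integral {0..1} (\<lambda>t. D b (a + snd (x, t) *\<^sub>R (fst (x, t) - a))))"
  have D: "smooth_on (ball a r) (D b)" for b
    unfolding D_def by (rule smooth_on_frechet_derivative[OF f])
  show "smooth_on (ball a r) (h b)" for b
    unfolding h_def
    by (rule smooth_on_param_integral[OF open_ball convex_ball ray_domain(1,2)[of a r] ray_domain(3)[OF D]])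
  show "h b a = frechet_derivative f (at a) b" for b
    by (simp add: h_def D_def)
  fix x assume x: "x \<in> ball a r"
  have mem: "a + t *\<^sub>R (x - a) \<in> ball a r" if "t \<in> {0..1}" for t
    using subsetD[OF ray_domain(2)[of a r], of "(x, t)"] x that by auto
  have cD: "(\<lambda>t. D b (a + t *\<^sub>R (x - a))) integrable_on {0..1}" for b
    using mem by (intro integrable_continuous_real continuous_on_compose2[OF smooth_on_imp_continuous_on[OF D]]
        continuous_intros) auto
  have "((\<lambda>t. frechet_derivative f (at (a + t *\<^sub>R (x - a))) (x - a)) has_integral
      f (a + 1 *\<^sub>R (x - a)) - f (a + 0 *\<^sub>R (x - a))) {0..1}"
    using ray_has_real_derivative[OF f mem]
    by (intro fundamental_theorem_of_calculus)
      (auto simp: has_real_derivative_iff_has_vector_derivative[symmetric] intro: has_field_derivative_at_within)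
  then have "f x - f a = integral {0..1} (\<lambda>t. frechet_derivative f (at (a + t *\<^sub>R (x - a))) (x - a))"
    by (simp add: integral_unique)
  also have "\<dots> = integral {0..1} (\<lambda>t. \<Sum>b\<in>Basis. ((x - a) \<bullet> b) * D b (a + t *\<^sub>R (x - a)))"
    unfolding D_def by (rule integral_cong) (rule frechet_derivative_Basis_sum[OF f mem])
  also have "\<dots> = (\<Sum>b\<in>Basis. ((x - a) \<bullet> b) * h b x)"
    using cD by (subst integral_sum) (auto simp: h_def intro: integrable_on_mult_right)
  finally show "f x = f a + (\<Sum>b\<in>Basis. ((x - a) \<bullet> b) * h b x)" by simp
qed

text \<open>The primitive is the integral of the form along the segment from a. Closedness exchanges
  the derivative of \<open>A b\<close> in direction c for that of \<open>A c\<close> in direction b,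
  after which the differentiated integrand is a total derivative in t.\<close>

lemma poincare_ball:
  fixes A :: "'e::euclidean_space \<Rightarrow> 'e \<Rightarrow> real"
  assumes A: "\<And>b. b \<in> Basis \<Longrightarrow> smooth_on (ball a r) (A b)" and "0 < r"
    and closed: "\<And>b c x. b \<in> Basis \<Longrightarrow> c \<in> Basis \<Longrightarrow> x \<in> ball a r \<Longrightarrow>
      frechet_derivative (A b) (at x) c = frechet_derivative (A c) (at x) b"
  obtains f where "smooth_on (ball a r) f"
    and "\<And>x c. x \<in> ball a r \<Longrightarrow> c \<in> Basis \<Longrightarrow> frechet_derivative f (at x) c = A c x"
proof
  define W where "W = {z::'e \<times> real. a + snd z *\<^sub>R (fst z - a) \<in> ball a r}"
  have W: "open W" "ball a r \<times> {0..1} \<subseteq> W" unfolding W_def by (rule ray_domain)+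
  define F where "F = (\<lambda>z. \<Sum>b\<in>Basis. ((fst z - a) \<bullet> b) * A b (a + snd z *\<^sub>R (fst z - a)))"
  define f where "f = (\<lambda>x. integral {0..1} (\<lambda>t. F (x, t)))"
  have sA: "smooth_on W (\<lambda>z. A b (a + snd z *\<^sub>R (fst z - a)))" if "b \<in> Basis" for b
    unfolding W_def by (rule ray_domain(3)[OF A[OF that]])
  have sF: "smooth_on W F"
    unfolding F_def
    by (intro smooth_on_sum smooth_on_mult smooth_on_bilinear[OF _ bounded_bilinear_inner] smooth_on_diff
        smooth_on_const sA smooth_on_subset[OF smooth_on_linear_pair(1) subset_UNIV] W(1))
  show "smooth_on (ball a r) f"
    unfolding f_def by (rule smooth_on_param_integral[OF open_ball convex_ball W sF])
  fix x c assume x: "x \<in> ball a r" and c: "c \<in> (Basis :: 'e set)"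
  have mem: "a + t *\<^sub>R (x - a) \<in> ball a r" if "t \<in> {0..1}" for t
    using subsetD[OF ray_domain(2)[of a r], of "(x, t)"] x that by auto
  have "(f has_derivative (\<lambda>v. integral {0..1} (\<lambda>t. frechet_derivative F (at (x, t)) (v, 0)))) (at x)"
    unfolding f_def
    by (rule param_integral_has_derivative[OF open_ball convex_ball W smooth_onD[OF sF] x])
  then have "frechet_derivative f (at x) c = integral {0..1} (\<lambda>t. frechet_derivative F (at (x, t)) (c, 0))"
    by (metis frechet_derivative_at)
  also have "\<dots> = integral {0..1} (\<lambda>t. A c (a + t *\<^sub>R (x - a)) +
      t * frechet_derivative (A c) (at (a + t *\<^sub>R (x - a))) (x - a))"
  proof (rule integral_cong)
    fix t :: real assume t: "t \<in> {0..1}"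
    let ?y = "a + t *\<^sub>R (x - a)"
    let ?G = "\<lambda>v. \<Sum>b\<in>Basis. (v \<bullet> b) * A b ?y + ((x - a) \<bullet> b) * frechet_derivative (A b) (at ?y) (t *\<^sub>R v)"
    have d1: "((\<lambda>x. (x, t)) has_derivative (\<lambda>v. (v, 0))) (at x)"
      by (auto intro!: derivative_eq_intros)
    have "(F has_derivative frechet_derivative F (at (x, t))) (at (x, t))"
      by (rule smooth_on_derivative[OF sF]) (use W x t in auto)
    from diff_chain_at[OF d1 this]
    have 1: "((\<lambda>x. F (x, t)) has_derivative (\<lambda>v. frechet_derivative F (at (x, t)) (v, 0))) (at x)"
      by (simp add: o_def)
    have d2: "((\<lambda>x. a + t *\<^sub>R (x - a)) has_derivative (\<lambda>v. t *\<^sub>R v)) (at x)"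
      by (auto intro!: derivative_eq_intros)
    have d3: "((\<lambda>x. A b (a + t *\<^sub>R (x - a))) has_derivative (\<lambda>v. frechet_derivative (A b) (at ?y) (t *\<^sub>R v))) (at x)"
      if "b \<in> Basis" for b
      using diff_chain_at[OF d2 smooth_on_derivative[OF A[OF that] mem[OF t]]] by (simp add: o_def)
    have "((\<lambda>x. F (x, t)) has_derivative ?G) (at x)"
      unfolding F_def fst_conv snd_conv
      by (rule has_derivative_sum) (auto intro!: derivative_eq_intros d3)
    from fun_cong[OF has_derivative_unique[OF 1 this], of c]
    have "frechet_derivative F (at (x, t)) (c, 0) = ?G c" .
    also have "\<dots> = A c ?y + (\<Sum>b\<in>Basis. ((x - a) \<bullet> b) * frechet_derivative (A b) (at ?y) (t *\<^sub>R c))"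
      using c by (simp add: sum.distrib inner_Basis if_distrib[of "\<lambda>u. u * _"] sum.delta' cong: if_cong)
    also have "(\<Sum>b\<in>Basis. ((x - a) \<bullet> b) * frechet_derivative (A b) (at ?y) (t *\<^sub>R c))
        = (\<Sum>b\<in>Basis. ((x - a) \<bullet> b) * (t * frechet_derivative (A c) (at ?y) b))"
    proof (rule sum.cong[OF refl])
      fix b :: 'e assume b: "b \<in> Basis"
      have "linear (frechet_derivative (A b) (at ?y))"
        using smooth_on_derivative[OF A[OF b] mem[OF t]] has_derivative_linear by blast
      then show "((x - a) \<bullet> b) * frechet_derivative (A b) (at ?y) (t *\<^sub>R c) =
          ((x - a) \<bullet> b) * (t * frechet_derivative (A c) (at ?y) b)"
        using closed[OF b c mem[OF t]] by (simp add: linear_scale)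
    qed
    also have "\<dots> = t * frechet_derivative (A c) (at ?y) (x - a)"
      unfolding frechet_derivative_Basis_sum[OF A[OF c] mem[OF t], of "x - a"]
      by (simp add: sum_distrib_left mult_ac)
    finally show "frechet_derivative F (at (x, t)) (c, 0) =
      A c ?y + t * frechet_derivative (A c) (at ?y) (x - a)" .
  qed
  \<comment> \<open>The integrand is the t-derivative of t times \<open>A c\<close> at a + t (x -
    a), so only the endpoint t = 1 contributes.\<close>
  also have "\<dots> = 1 * A c (a + 1 *\<^sub>R (x - a)) - 0 * A c (a + 0 *\<^sub>R (x - a))"
  proof (rule integral_unique, rule fundamental_theorem_of_calculus)
    fix t :: real assume t: "t \<in> {0..1}"
    have "((\<lambda>t. t * A c (a + t *\<^sub>R (x - a))) has_real_derivative
      A c (a + t *\<^sub>R (x - a)) + t * frechet_derivative (A c) (at (a + t *\<^sub>R (x - a))) (x - a)) (at t)"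
      using DERIV_mult[OF DERIV_ident ray_has_real_derivative[OF A[OF c] mem[OF t]]]
      by (simp add: algebra_simps)
    then show "((\<lambda>t. t * A c (a + t *\<^sub>R (x - a))) has_vector_derivative
      A c (a + t *\<^sub>R (x - a)) + t * frechet_derivative (A c) (at (a + t *\<^sub>R (x - a))) (x - a)) (at t within {0..1})"
      by (simp add: has_real_derivative_iff_has_vector_derivative[symmetric] has_field_derivative_at_within)
  qed simp
  finally show "frechet_derivative f (at x) c = A c x" by simp
qed

section \<open>Smooth manifolds: extension of local data and tangent spaces\<close>

locale manifold =
  fixes \<A> :: "('m::t2_space, 'e::euclidean_space) chart set"
  assumes atlas: "smooth_atlas \<A>"
begin

abbreviation "SF \<equiv> smooth_functions \<A>"
abbreviation "VF \<equiv> vector_fields \<A>"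
abbreviation "TM \<equiv> tangent_space \<A>"

lemma chart_facts:
  assumes "(U, \<phi>) \<in> \<A>"
  shows "open U" "open (\<phi> ` U)" "homeomorphism U (\<phi> ` U) \<phi> (inv_into U \<phi>)"
proof -
  have "\<forall>(U, \<phi>)\<in>\<A>. open U \<and> open (\<phi> ` U) \<and> homeomorphism U (\<phi> ` U) \<phi> (inv_into U \<phi>)"
    using atlas unfolding smooth_atlas_def by blast
  from bspec[OF this assms] show "open U" "open (\<phi> ` U)" "homeomorphism U (\<phi> ` U) \<phi> (inv_into U \<phi>)"
    by simp_all
qed

lemma chart_at:
  obtains U \<phi> where "(U, \<phi>) \<in> \<A>" "p \<in> U"
proof -
  have "(\<Union>(U, \<phi>)\<in>\<A>. U) = UNIV"
    using atlas unfolding smooth_atlas_def by (rule conjunct1)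
  then have "p \<in> (\<Union>(U, \<phi>)\<in>\<A>. U)" by simp
  then show thesis using that by (auto simp del: UN_simps)
qed

lemma chart_inv:
  assumes "(U, \<phi>) \<in> \<A>"
  shows "x \<in> U \<Longrightarrow> inv_into U \<phi> (\<phi> x) = x" "y \<in> \<phi> ` U \<Longrightarrow> inv_into U \<phi> y \<in> U"
    "y \<in> \<phi> ` U \<Longrightarrow> \<phi> (inv_into U \<phi> y) = y"
  using homeomorphism_apply1[OF chart_facts(3)[OF assms]] by (auto simp: inv_into_into f_inv_into_f)

lemma chart_image_eq:
  assumes "(U, \<phi>) \<in> \<A>" "N \<subseteq> U"
  shows "\<phi> ` N = \<phi> ` U \<inter> inv_into U \<phi> -` N"
  using chart_inv[OF assms(1)] assms(2) by force

lemma chart_open_image: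
  assumes "(U, \<phi>) \<in> \<A>" "N \<subseteq> U" "open N"
  shows "open (\<phi> ` N)"
  unfolding chart_image_eq[OF assms(1,2)]
  using chart_facts[OF assms(1)] homeomorphism_cont2 assms(3)
  by (intro continuous_open_preimage) auto

lemma chart_open_preimage:
  assumes "(U, \<phi>) \<in> \<A>" "open B"
  shows "open {x \<in> U. \<phi> x \<in> B}"
  using continuous_open_preimage[OF homeomorphism_cont1[OF chart_facts(3)[OF assms(1)]] chart_facts(1)[OF assms(1)] assms(2)]
  by (simp add: vimage_def Int_def)

lemma SF_chart:
  assumes "f \<in> SF" "(U, \<phi>) \<in> \<A>"
  shows "smooth_on (\<phi> ` U) (\<lambda>x. f (inv_into U \<phi> x))"
  using assms unfolding smooth_functions_def smooth_map_def by (auto simp: o_def split_beta)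

text \<open>Smooth transition maps carry smoothness from the one given chart near a point to every
  other chart there; continuity, which \<open>smooth_map\<close> demands separately, then follows
  chart by chart.\<close>

lemma SF_localI:
  assumes "\<And>p. \<exists>U \<phi> N. (U, \<phi>) \<in> \<A> \<and> open N \<and> p \<in> N \<and> N \<subseteq> U \<and> smooth_on (\<phi> ` N) (\<lambda>x. f (inv_into U \<phi> x))"
  shows "f \<in> SF"
proof -
  have 1: "smooth_on (\<eta> ` V) (\<lambda>x. f (inv_into V \<eta> x))" if V: "(V, \<eta>) \<in> \<A>" for V \<eta>
  proof (rule smooth_on_local)
    fix y assume y: "y \<in> \<eta> ` V"
    define p where "p = inv_into V \<eta> y"
    have p: "p \<in> V" "\<eta> p = y" using chart_inv[OF V] y by (auto simp: p_def)
    obtain U \<phi> N where N: "(U, \<phi>) \<in> \<A>" "open N" "p \<in> N" "N \<subseteq> U"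
      "smooth_on (\<phi> ` N) (\<lambda>x. f (inv_into U \<phi> x))" using assms by blast
    have o: "open (\<eta> ` (V \<inter> N))"
      using chart_facts(1)[OF V] N(2) by (intro chart_open_image[OF V]) auto
    have "smooth_on (\<eta> ` (V \<inter> U)) (\<lambda>x. \<phi> (inv_into V \<eta> x))"
    proof -
      have "\<forall>(U, \<phi>)\<in>\<A>. \<forall>(V, \<psi>)\<in>\<A>. smooth_on (\<phi> ` (U \<inter> V)) (\<psi> \<circ> inv_into U \<phi>)"
        using atlas unfolding smooth_atlas_def by blast
      from bspec[OF this V] have "\<forall>(W, \<psi>)\<in>\<A>. smooth_on (\<eta> ` (V \<inter> W)) (\<psi> \<circ> inv_into V \<eta>)" by simp
      from bspec[OF this N(1)] show ?thesis by (simp add: o_def)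
    qed
    then have s: "smooth_on (\<eta> ` (V \<inter> N)) (\<lambda>x. \<phi> (inv_into V \<eta> x))"
      by (rule smooth_on_subset) (use N(4) in auto)
    have "smooth_on (\<eta> ` (V \<inter> N)) (\<lambda>x. f (inv_into U \<phi> (\<phi> (inv_into V \<eta> x))))"
      by (rule smooth_on_compose[OF o chart_open_image[OF N(1,4,2)] s N(5)]) (auto simp: chart_inv[OF V])
    then have "smooth_on (\<eta> ` (V \<inter> N)) (\<lambda>x. f (inv_into V \<eta> x))"
      by (subst smooth_on_cong[OF o, where g="\<lambda>x. f (inv_into U \<phi> (\<phi> (inv_into V \<eta> x)))"])
        (use N(4) in \<open>auto simp: chart_inv[OF V] chart_inv[OF N(1)] subset_iff\<close>)
    then show "\<exists>W. open W \<and> y \<in> W \<and> smooth_on W (\<lambda>x. f (inv_into V \<eta> x))"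
      using o p N(3) by blast
  qed
  have "isCont f p" for p
  proof -
    obtain U \<phi> where U: "(U, \<phi>) \<in> \<A>" "p \<in> U" by (rule chart_at)
    have "continuous_on U (\<lambda>q. f (inv_into U \<phi> (\<phi> q)))"
      by (rule continuous_on_compose2[OF smooth_on_imp_continuous_on[OF 1[OF U(1)]] homeomorphism_cont1[OF chart_facts(3)[OF U(1)]]]) auto
    then have "continuous_on U f"
      by (rule continuous_on_eq) (simp add: chart_inv[OF U(1)])
    then show ?thesis using chart_facts(1)[OF U(1)] U(2) by (simp add: continuous_on_eq_continuous_at)
  qed
  then have "continuous_on UNIV f" by (simp add: continuous_at_imp_continuous_on)
  then show ?thesis
    using 1 unfolding smooth_functions_def smooth_map_def by (auto simp: o_def)
qed

lemma SF_I: "(\<And>U \<phi>. (U, \<phi>) \<in> \<A> \<Longrightarrow> smooth_on (\<phi> ` U) (\<lambda>x. f (inv_into U \<phi> x))) \<Longrightarrow> f \<in> SF"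
  by (rule SF_localI) (meson chart_at chart_facts(1) order_refl)

lemma SF_local_eqI:
  assumes "\<And>p. \<exists>N f'. open N \<and> p \<in> N \<and> f' \<in> SF \<and> (\<forall>x\<in>N. f x = f' x)"
  shows "f \<in> SF"
proof (rule SF_localI)
  fix p
  obtain N f' where N: "open N" "p \<in> N" "f' \<in> SF" "\<forall>x\<in>N. f x = f' x" using assms by blast
  obtain U \<phi> where U: "(U, \<phi>) \<in> \<A>" "p \<in> U" by (rule chart_at)
  have o: "open (U \<inter> N)" using N chart_facts(1)[OF U(1)] by auto
  have "smooth_on (\<phi> ` (U \<inter> N)) (\<lambda>x. f' (inv_into U \<phi> x))"
    by (rule smooth_on_subset[OF SF_chart[OF N(3) U(1)]]) auto
  then have "smooth_on (\<phi> ` (U \<inter> N)) (\<lambda>x. f (inv_into U \<phi> x))"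
    by (subst smooth_on_cong[OF chart_open_image[OF U(1) _ o], where g="\<lambda>x. f' (inv_into U \<phi> x)"])
      (use N(4) in \<open>auto simp: chart_inv[OF U(1)]\<close>)
  then show "\<exists>U \<phi> N. (U, \<phi>) \<in> \<A> \<and> open N \<and> p \<in> N \<and> N \<subseteq> U \<and> smooth_on (\<phi> ` N) (\<lambda>x. f (inv_into U \<phi> x))"
    using U N o by blast
qed

lemma SF_const [simp]: "(\<lambda>x. c) \<in> SF"
  by (rule SF_I) simp

lemma SF_add: "f \<in> SF \<Longrightarrow> h \<in> SF \<Longrightarrow> (\<lambda>x. f x + h x) \<in> SF"
  by (rule SF_I) (intro smooth_on_add SF_chart chart_facts(2))

lemma SF_mult: "f \<in> SF \<Longrightarrow> h \<in> SF \<Longrightarrow> (\<lambda>x. f x * h x) \<in> SF"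
  by (rule SF_I) (intro smooth_on_mult SF_chart chart_facts(2))

lemma SF_cmult: "f \<in> SF \<Longrightarrow> (\<lambda>x. c * f x) \<in> SF"
  by (intro SF_mult SF_const)

lemma SF_diff: "f \<in> SF \<Longrightarrow> h \<in> SF \<Longrightarrow> (\<lambda>x. f x - h x) \<in> SF"
  by (rule SF_I) (intro smooth_on_diff SF_chart chart_facts(2))

lemma SF_sum: "(\<And>i. i \<in> I \<Longrightarrow> f i \<in> SF) \<Longrightarrow> (\<lambda>x. \<Sum>i\<in>I. f i x) \<in> SF"
  by (induction I rule: infinite_finite_induct) (auto intro: SF_add)

section \<open>Extension of local functions by cutoffs\<close>

definition extend :: "('e \<Rightarrow> real) \<Rightarrow> 'm set \<Rightarrow> ('m \<Rightarrow> 'e) \<Rightarrow> ('e \<Rightarrow> real) \<Rightarrow> 'm \<Rightarrow> real" where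
  "extend \<beta> U \<phi> h = (\<lambda>q. if q \<in> U then \<beta> (\<phi> q) * h (\<phi> q) else 0)"

text \<open>Tangent vectors act on global functions, so this collects what is needed to replace a
  smooth function on a coordinate ball by a global one that agrees with it on \<open>N\<close>.
  Convexity of the image of \<open>N\<close> serves for path connectedness and for local
  constancy.\<close>

definition cutoff :: "('e \<Rightarrow> real) \<Rightarrow> 'm set \<Rightarrow> ('m \<Rightarrow> 'e) \<Rightarrow> 'm set \<Rightarrow> 'e \<Rightarrow> real \<Rightarrow> bool" where
  "cutoff \<beta> U \<phi> N a R \<longleftrightarrow> 0 < R \<and> ball a R \<subseteq> \<phi> ` U \<and> open N \<and> N \<subseteq> U \<and> \<phi> ` N \<subseteq> ball a R \<and>
     convex (\<phi> ` N) \<and> (\<forall>q\<in>N. \<beta> (\<phi> q) = 1) \<and>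
     (\<forall>q\<in>U. \<beta> (\<phi> q) \<noteq> 0 \<longrightarrow> \<phi> q \<in> ball a R) \<and>
     (\<forall>h. smooth_on (ball a R) h \<longrightarrow> extend \<beta> U \<phi> h \<in> SF)"

lemma cutoff_exists:
  assumes U: "(U, \<phi>) \<in> \<A>" and p: "p \<in> U" and R: "0 < R" "ball (\<phi> p) R \<subseteq> \<phi> ` U"
  obtains \<beta> N where "p \<in> N" "cutoff \<beta> U \<phi> N (\<phi> p) R"
proof -
  let ?\<psi> = "inv_into U \<phi>"
  obtain \<beta> :: "'e \<Rightarrow> real" where \<beta>: "smooth_on UNIV \<beta>"
    "\<And>x. x \<in> ball (\<phi> p) (R/4) \<Longrightarrow> \<beta> x = 1" "\<And>x. x \<notin> ball (\<phi> p) (2 * (R/4)) \<Longrightarrow> \<beta> x = 0"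
    using smooth_cutoff[of "R/4" "\<phi> p"] R(1) by auto
  define N where "N = {x \<in> U. \<phi> x \<in> ball (\<phi> p) (R/4)}"
  have imN: "\<phi> ` N = ball (\<phi> p) (R/4)"
  proof -
    have "ball (\<phi> p) (R/4) \<subseteq> \<phi> ` U" using R subset_ball[of "R/4" R "\<phi> p"] by auto
    then show ?thesis by (auto simp: N_def)
  qed
  have supp: "\<phi> q \<in> ball (\<phi> p) R" if "\<beta> (\<phi> q) \<noteq> 0" for q
  proof -
    have "\<phi> q \<in> ball (\<phi> p) (2 * (R/4))" using \<beta>(3) that by blast
    then show ?thesis using R(1) by auto
  qed
  have sm: "extend \<beta> U \<phi> h \<in> SF" if h: "smooth_on (ball (\<phi> p) R) h" for h
  proof (rule SF_localI)
    fix q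
    \<comment> \<open>The cutoff is nonzero only over the ball of half the radius. The part
      \<open>K\<close> of the manifold over its closure is compact, hence closed by the Hausdorff
      property, so around points off \<open>K\<close> the extension vanishes identically.\<close>
    define K where "K = ?\<psi> ` cball (\<phi> p) (2 * (R/4))"
    have cb: "cball (\<phi> p) (2 * (R/4)) \<subseteq> ball (\<phi> p) R" using R(1) by auto
    then have "compact K" unfolding K_def
      using homeomorphism_cont2[OF chart_facts(3)[OF U]] R(2)
      by (intro compact_continuous_image compact_cball) (blast intro: continuous_on_subset)
    then have oK: "open (- K)" by (simp add: compact_imp_closed open_Compl)
    show "\<exists>V \<eta> N. (V, \<eta>) \<in> \<A> \<and> open N \<and> q \<in> N \<and> N \<subseteq> V \<and>
      smooth_on (\<eta> ` N) (\<lambda>x. extend \<beta> U \<phi> h (inv_into V \<eta> x))"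
    proof (cases "q \<in> K")
      case True
      let ?B = "{x \<in> U. \<phi> x \<in> ball (\<phi> p) R}"
      have im: "\<phi> ` ?B = ball (\<phi> p) R" using R(2) by auto
      have "q \<in> ?B"
      proof -
        obtain y where y: "y \<in> cball (\<phi> p) (2 * (R/4))" "q = ?\<psi> y" using True by (auto simp: K_def)
        then have "y \<in> ball (\<phi> p) R" using cb by blast
        then show ?thesis using y chart_inv(2,3)[OF U, of y] R(2) by auto
      qed
      moreover have "smooth_on (\<phi> ` ?B) (\<lambda>x. extend \<beta> U \<phi> h (?\<psi> x))"
      proof -
        have "smooth_on (ball (\<phi> p) R) (\<lambda>x. \<beta> x * h x)"
          by (intro smooth_on_mult h smooth_on_subset[OF \<beta>(1)]) auto
        then show ?thesis unfolding im
          by (subst smooth_on_cong[OF open_ball, where g="\<lambda>x. \<beta> x * h x"])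
            (use R(2) in \<open>auto simp: extend_def chart_inv[OF U] subset_iff\<close>)
      qed
      ultimately show ?thesis using U chart_open_preimage[OF U open_ball[of "\<phi> p" R]] by blast
    next
      case False
      obtain V \<eta> where V: "(V, \<eta>) \<in> \<A>" "q \<in> V" by (rule chart_at)
      have o: "open (V \<inter> - K)" using oK chart_facts(1)[OF V(1)] by blast
      have zero: "extend \<beta> U \<phi> h x = 0" if "x \<notin> K" for x
      proof (cases "x \<in> U \<and> \<beta> (\<phi> x) \<noteq> 0")
        case True
        then have "\<phi> x \<in> ball (\<phi> p) (2 * (R/4))" using \<beta>(3) by blast
        then have "\<phi> x \<in> cball (\<phi> p) (2 * (R/4))" using ball_subset_cball by blast
        then have "x \<in> K" using True chart_inv(1)[OF U, of x] unfolding K_def by (metis image_eqI)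
        then show ?thesis using that by simp
      qed (auto simp: extend_def)
      have "smooth_on (\<eta> ` (V \<inter> - K)) (\<lambda>x. extend \<beta> U \<phi> h (inv_into V \<eta> x))"
        by (subst smooth_on_cong[OF chart_open_image[OF V(1) _ o], where g="\<lambda>x. 0"])
          (auto simp: chart_inv[OF V(1)] zero)
      then show ?thesis using V o False by blast
    qed
  qed
  have "cutoff \<beta> U \<phi> N (\<phi> p) R"
    unfolding cutoff_def imN using R \<beta>(2) sm supp chart_open_preimage[OF U open_ball[of "\<phi> p" "R/4"]]
    by (auto simp: N_def)
  moreover have "p \<in> N" using p R(1) by (simp add: N_def)
  ultimately show thesis using that by blast
qed

lemma cutoff_subset_exists:
  assumes U: "(U, \<phi>) \<in> \<A>" and p: "p \<in> U" and M: "open M" "p \<in> M"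
  obtains \<beta> N R where "p \<in> N" "cutoff \<beta> U \<phi> N (\<phi> p) R" "ball (\<phi> p) R \<subseteq> \<phi> ` (U \<inter> M)"
proof -
  have "open (\<phi> ` (U \<inter> M))" using M chart_facts(1)[OF U] by (intro chart_open_image[OF U]) auto
  moreover have "\<phi> p \<in> \<phi> ` (U \<inter> M)" using p M by blast
  ultimately obtain R where R: "0 < R" "ball (\<phi> p) R \<subseteq> \<phi> ` (U \<inter> M)"
    by (rule openE)
  then have "ball (\<phi> p) R \<subseteq> \<phi> ` U" by blast
  from cutoff_exists[OF U p R(1) this] obtain \<beta> N where "p \<in> N" "cutoff \<beta> U \<phi> N (\<phi> p) R" .
  then show thesis using that R(2) by blast
qed

section \<open>Tangent vectors as derivations\<close>

lemma tangentD:
  assumes "v \<in> TM p"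
  shows "f \<notin> SF \<Longrightarrow> v f = 0" "f \<in> SF \<Longrightarrow> h \<in> SF \<Longrightarrow> v (\<lambda>x. f x + h x) = v f + v h"
    "f \<in> SF \<Longrightarrow> v (\<lambda>x. c * f x) = c * v f"
    "f \<in> SF \<Longrightarrow> h \<in> SF \<Longrightarrow> v (\<lambda>x. f x * h x) = f p * v h + h p * v f"
  using assms unfolding tangent_space_def by auto

text \<open>Leibniz's rule for 1 = 1 * 1 forces the value on 1 to be twice itself.\<close>

lemma tangent_const: "v \<in> TM p \<Longrightarrow> v (\<lambda>x. c) = 0"
  using tangentD(4)[of v p "\<lambda>x. 1" "\<lambda>x. 1"] tangentD(3)[of v p "\<lambda>x. 1" c] by simp

lemma tangent_diff: "v \<in> TM p \<Longrightarrow> f \<in> SF \<Longrightarrow> h \<in> SF \<Longrightarrow> v (\<lambda>x. f x - h x) = v f - v h"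
  using tangentD(2)[of v p f "\<lambda>x. (-1) * h x"] tangentD(3)[of v p h "-1"] SF_cmult[of h "-1"] by simp

lemma tangent_sum:
  "v \<in> TM p \<Longrightarrow> (\<And>i. i \<in> I \<Longrightarrow> f i \<in> SF) \<Longrightarrow> v (\<lambda>x. \<Sum>i\<in>I. f i x) = (\<Sum>i\<in>I. v (f i))"
proof (induction I rule: infinite_finite_induct)
  case (insert i I)
  have "(\<lambda>x. \<Sum>i\<in>I. f i x) \<in> SF" by (rule SF_sum) (use insert.prems in auto)
  then show ?case using insert tangentD(2)[OF insert.prems(1), of "f i"] by simp
qed (auto simp: tangent_const)

text \<open>Leibniz's rule is applied to the identically vanishing product b (f - h), where the
  cutoff b is 1 at p and nonzero only inside \<open>M\<close>.\<close>

lemma tangent_local: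
  assumes v: "v \<in> TM p" and f: "f \<in> SF" "h \<in> SF" and M: "open M" "p \<in> M" "\<And>x. x \<in> M \<Longrightarrow> f x = h x"
  shows "v f = v h"
proof -
  obtain U \<phi> where U: "(U, \<phi>) \<in> \<A>" "p \<in> U" by (rule chart_at)
  obtain \<beta> N R where N: "p \<in> N" "cutoff \<beta> U \<phi> N (\<phi> p) R" "ball (\<phi> p) R \<subseteq> \<phi> ` (U \<inter> M)"
    by (rule cutoff_subset_exists[OF U M(1,2)])
  define b where "b = extend \<beta> U \<phi> (\<lambda>x. 1)"
  have b: "b \<in> SF" unfolding b_def using N(2) smooth_on_const unfolding cutoff_def by blast
  have bp: "b p = 1" using N(1,2) U(2) by (auto simp: b_def cutoff_def extend_def)
  have z: "b x * (f x - h x) = 0" for x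
  proof (cases "b x = 0")
    case False
    then have x: "x \<in> U" "\<beta> (\<phi> x) \<noteq> 0" by (auto simp: b_def extend_def split: if_splits)
    then have "\<phi> x \<in> \<phi> ` (U \<inter> M)" using N(2,3) unfolding cutoff_def by blast
    then have "x \<in> M" using x(1) chart_inv(1)[OF U(1)] by (metis Int_iff imageE)
    then show ?thesis using M(3) by simp
  qed simp
  have "0 = v (\<lambda>x. b x * (f x - h x))" unfolding z using tangent_const[OF v, of 0] by simp
  also have "\<dots> = v (\<lambda>x. f x - h x)"
    using tangentD(4)[OF v b SF_diff[OF f]] bp M by simp
  also have "\<dots> = v f - v h" by (rule tangent_diff[OF v f])
  finally show ?thesis by simp
qed

lemma tangent_lincomb:
  assumes "\<And>i. i \<in> I \<Longrightarrow> v i \<in> TM p"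
  shows "(\<lambda>f. \<Sum>i\<in>I. c i * v i f) \<in> TM p"
proof -
  note t = tangentD[OF assms]
  let ?v = "\<lambda>f. \<Sum>i\<in>I. c i * v i f"
  have 1: "?v f = 0" if "f \<notin> SF" for f using that by (simp add: t(1))
  have 2: "?v (\<lambda>x. f x + h x) = ?v f + ?v h" if "f \<in> SF" "h \<in> SF" for f h
    using that by (simp add: t(2) sum.distrib distrib_left)
  have 3: "?v (\<lambda>x. d * f x) = d * ?v f" if "f \<in> SF" for f d
    using that by (simp add: t(3) sum_distrib_left mult.left_commute)
  have 4: "?v (\<lambda>x. f x * h x) = f p * ?v h + h p * ?v f" if "f \<in> SF" "h \<in> SF" for f h
    using that by (simp add: t(4) sum.distrib distrib_left sum_distrib_left mult.left_commute)
  show ?thesis unfolding tangent_space_def using 1 2 3 4 by blast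
qed

lemma tangent_add: "v \<in> TM p \<Longrightarrow> w \<in> TM p \<Longrightarrow> (\<lambda>f. v f + w f) \<in> TM p"
  unfolding tangent_space_def by (auto simp: algebra_simps)

lemma tangent_cmult: "v \<in> TM p \<Longrightarrow> (\<lambda>f. c * v f) \<in> TM p"
  unfolding tangent_space_def by (auto simp: algebra_simps)

lemma tangent_zero: "(\<lambda>f. 0) \<in> TM p"
  unfolding tangent_space_def by auto

definition dvec :: "'m set \<Rightarrow> ('m \<Rightarrow> 'e) \<Rightarrow> 'm \<Rightarrow> 'e \<Rightarrow> 'm tangent" where
  "dvec U \<phi> p w = (\<lambda>f. if f \<in> SF
     then frechet_derivative (\<lambda>x. f (inv_into U \<phi> x)) (at (\<phi> p)) w else 0)"

lemma SF_chart_derivative: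
  assumes "f \<in> SF" "(U, \<phi>) \<in> \<A>" "p \<in> U"
  shows "((\<lambda>x. f (inv_into U \<phi> x)) has_derivative (\<lambda>w. dvec U \<phi> p w f)) (at (\<phi> p))"
  using smooth_on_derivative[OF SF_chart[OF assms(1,2)], of "\<phi> p"] assms by (auto simp: dvec_def)

lemma dvec_eqI:
  assumes "f \<in> SF" "(U, \<phi>) \<in> \<A>" "p \<in> U"
    and "((\<lambda>x. f (inv_into U \<phi> x)) has_derivative D) (at (\<phi> p))"
  shows "dvec U \<phi> p w f = D w"
  using has_derivative_unique[OF SF_chart_derivative[OF assms(1-3)] assms(4)] by metis

lemma dvec_tangent:
  assumes U: "(U, \<phi>) \<in> \<A>" "p \<in> U"
  shows "dvec U \<phi> p w \<in> TM p"
proof -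
  note d = SF_chart_derivative[OF _ U]
  have "dvec U \<phi> p w (\<lambda>x. f x + h x) = dvec U \<phi> p w f + dvec U \<phi> p w h" if "f \<in> SF" "h \<in> SF" for f h
    using dvec_eqI[OF SF_add[OF that] U has_derivative_add[OF d[OF that(1)] d[OF that(2)]]] .
  moreover have "dvec U \<phi> p w (\<lambda>x. c * f x) = c * dvec U \<phi> p w f" if "f \<in> SF" for f c
    using dvec_eqI[OF SF_cmult[OF that] U has_derivative_mult_right[OF d[OF that]]] .
  moreover have "dvec U \<phi> p w (\<lambda>x. f x * h x) = f p * dvec U \<phi> p w h + h p * dvec U \<phi> p w f"
    if "f \<in> SF" "h \<in> SF" for f h
    using dvec_eqI[OF SF_mult[OF that] U has_derivative_mult[OF d[OF that(1)] d[OF that(2)]]]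
    by (simp add: chart_inv[OF U(1)] U(2) mult.commute)
  moreover have "f \<notin> SF \<Longrightarrow> dvec U \<phi> p w f = 0" for f by (simp add: dvec_def)
  ultimately show ?thesis unfolding tangent_space_def by blast
qed

lemma dvec_Basis_sum:
  assumes U: "(U, \<phi>) \<in> \<A>" "p \<in> U"
  shows "dvec U \<phi> p w = (\<lambda>f. \<Sum>b\<in>Basis. (w \<bullet> b) * dvec U \<phi> p b f)"
proof
  fix f
  show "dvec U \<phi> p w f = (\<Sum>b\<in>Basis. (w \<bullet> b) * dvec U \<phi> p b f)"
    using frechet_derivative_Basis_sum[OF SF_chart[OF _ U(1)], of f "\<phi> p" w] U(2)
    by (auto simp: dvec_def)
qed

lemma dvec_extend:
  assumes U: "(U, \<phi>) \<in> \<A>" and N: "cutoff \<beta> U \<phi> N a R" and q: "q \<in> N"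
    and h: "smooth_on (ball a R) h"
  shows "dvec U \<phi> q w (extend \<beta> U \<phi> h) = frechet_derivative h (at (\<phi> q)) w"
proof -
  have s: "extend \<beta> U \<phi> h \<in> SF" "q \<in> U" "\<phi> q \<in> ball a R" using N h q unfolding cutoff_def by auto
  have o: "open (\<phi> ` N)" using N by (intro chart_open_image[OF U]) (auto simp: cutoff_def)
  have "((\<lambda>x. extend \<beta> U \<phi> h (inv_into U \<phi> x)) has_derivative frechet_derivative h (at (\<phi> q))) (at (\<phi> q))"
    by (rule has_derivative_transform_within_open[OF smooth_on_derivative[OF h s(3)] o])
      (use q N chart_inv[OF U] in \<open>auto simp: extend_def cutoff_def subset_iff\<close>)
  then show ?thesis by (rule dvec_eqI[OF s(1) U s(2)])
qed

text \<open>Hadamard's lemma writes f near p as f p plus products of coordinate functions vanishing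
  at p with smooth factors. Leibniz's rule leaves only the values of v on the coordinate functions,
  and these are the components of \<open>w\<close>.\<close>

lemma tangent_eq_dvec:
  assumes U: "(U, \<phi>) \<in> \<A>" "p \<in> U" and v: "v \<in> TM p"
  obtains w where "v = dvec U \<phi> p w"
proof -
  obtain \<beta> N R where N: "p \<in> N" "cutoff \<beta> U \<phi> N (\<phi> p) R"
    using cutoff_subset_exists[OF U, of UNIV] by (metis UNIV_I open_UNIV)
  have R: "0 < R" "ball (\<phi> p) R \<subseteq> \<phi> ` U" "open N" using N(2) by (auto simp: cutoff_def)
  have N': "q \<in> N \<Longrightarrow> q \<in> U \<and> \<beta> (\<phi> q) = 1 \<and> \<phi> q \<in> ball (\<phi> p) R" for q using N(2) by (auto simp: cutoff_def)
  have ext: "smooth_on (ball (\<phi> p) R) h \<Longrightarrow> extend \<beta> U \<phi> h \<in> SF" for h using N(2) by (auto simp: cutoff_def)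
  define x where "x = (\<lambda>b. extend \<beta> U \<phi> (\<lambda>y. (y - \<phi> p) \<bullet> b))"
  have x: "x b \<in> SF" for b
    unfolding x_def by (intro ext smooth_on_bilinear[OF _ bounded_bilinear_inner] smooth_on_diff) auto
  define w where "w = (\<Sum>b\<in>Basis. v (x b) *\<^sub>R b)"
  have "v f = dvec U \<phi> p w f" for f
  proof (cases "f \<in> SF")
    case True
    let ?f = "\<lambda>x. f (inv_into U \<phi> x)"
    have sf: "smooth_on (ball (\<phi> p) R) ?f" using smooth_on_subset[OF SF_chart[OF True U(1)] R(2)] .
    obtain h where h: "\<And>b. smooth_on (ball (\<phi> p) R) (h b)" "\<And>b. h b (\<phi> p) = frechet_derivative ?f (at (\<phi> p)) b"
      "\<And>y. y \<in> ball (\<phi> p) R \<Longrightarrow> ?f y = ?f (\<phi> p) + (\<Sum>b\<in>Basis. ((y - \<phi> p) \<bullet> b) * h b y)"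
      using hadamard[OF sf R(1)] by blast
    define H where "H = (\<lambda>b. extend \<beta> U \<phi> (h b))"
    have H: "H b \<in> SF" for b unfolding H_def by (rule ext[OF h(1)])
    have s: "(\<lambda>q. \<Sum>b\<in>Basis. x b q * H b q) \<in> SF" by (intro SF_sum SF_mult x H)
    have "v f = v (\<lambda>q. f p + (\<Sum>b\<in>Basis. x b q * H b q))"
    proof (rule tangent_local[OF v True _ R(3) N(1)])
      show "(\<lambda>q. f p + (\<Sum>b\<in>Basis. x b q * H b q)) \<in> SF" by (intro SF_add SF_const s)
      show "f q = f p + (\<Sum>b\<in>Basis. x b q * H b q)" if "q \<in> N" for q
        using h(3)[of "\<phi> q"] N'[OF that] U(2) by (simp add: chart_inv[OF U(1)] x_def H_def extend_def)
    qed
    also have "\<dots> = (\<Sum>b\<in>Basis. v (\<lambda>q. x b q * H b q))"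
      using tangentD(2)[OF v SF_const s] tangent_const[OF v] tangent_sum[OF v SF_mult[OF x H]] by simp
    also have "\<dots> = (\<Sum>b\<in>Basis. v (x b) * frechet_derivative ?f (at (\<phi> p)) b)"
      using tangentD(4)[OF v x H] N'[OF N(1)] h(2)
      by (intro sum.cong) (auto simp: x_def H_def extend_def)
    also have "\<dots> = frechet_derivative ?f (at (\<phi> p)) w"
      using U(2) frechet_derivative_Basis_sum[OF SF_chart[OF True U(1)], of "\<phi> p" w]
      by (simp add: w_def inner_sum_left inner_Basis if_distrib sum.delta cong: if_cong)
    finally show ?thesis using True by (simp add: dvec_def)
  qed (simp add: dvec_def tangentD(1)[OF v])
  then show thesis using that by blast
qed

text \<open>The extended coordinate functions read off the components of \<open>w\<close>.\<close>

lemma dvec_inj: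
  assumes U: "(U, \<phi>) \<in> \<A>" "p \<in> U" and eq: "dvec U \<phi> p w = dvec U \<phi> p w'"
  shows "w = w'"
proof -
  obtain \<beta> N R where N: "p \<in> N" "cutoff \<beta> U \<phi> N (\<phi> p) R"
    using cutoff_subset_exists[OF U, of UNIV] by (metis UNIV_I open_UNIV)
  show ?thesis
  proof (rule euclidean_eqI)
    fix b :: 'e
    have bl: "bounded_linear (\<lambda>y. y \<bullet> b)" by (rule bounded_linear_inner_left)
    have "dvec U \<phi> p u (extend \<beta> U \<phi> (\<lambda>y. y \<bullet> b)) = u \<bullet> b" for u
      using dvec_extend[OF U(1) N(2,1) smooth_on_bounded_linear[OF open_ball bl], of u]
        frechet_derivative_at[OF bounded_linear_imp_has_derivative[OF bl]] by metis
    then show "w \<bullet> b = w' \<bullet> b" using eq by metis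
  qed
qed

section \<open>Vector fields and their brackets\<close>

lemma vector_fieldD:
  "X \<in> VF \<Longrightarrow> X p \<in> TM p" "X \<in> VF \<Longrightarrow> f \<in> SF \<Longrightarrow> (\<lambda>p. X p f) \<in> SF"
  by (auto simp: vector_fields_def)

lemma vector_field_SF: "X \<in> VF \<Longrightarrow> (\<lambda>p. X p f) \<in> SF"
  using vector_fieldD(2)[of X f] tangentD(1)[OF vector_fieldD(1), of X f] by (cases "f \<in> SF") auto

lemma VF_sum:
  assumes "\<And>i. i \<in> I \<Longrightarrow> c i \<in> SF" "\<And>i. i \<in> I \<Longrightarrow> X i \<in> VF"
  shows "(\<lambda>p f. \<Sum>i\<in>I. c i p * X i p f) \<in> VF"
proof -
  have "(\<lambda>f. \<Sum>i\<in>I. c i p * X i p f) \<in> TM p" for p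
    by (rule tangent_lincomb) (rule vector_fieldD(1)[OF assms(2)])
  moreover have "(\<lambda>p. \<Sum>i\<in>I. c i p * X i p f) \<in> SF" for f
    by (rule SF_sum, rule SF_mult) (rule assms(1) vector_field_SF[OF assms(2)], assumption)+
  ultimately show ?thesis unfolding vector_fields_def by blast
qed

definition coord_field :: "('e \<Rightarrow> real) \<Rightarrow> 'm set \<Rightarrow> ('m \<Rightarrow> 'e) \<Rightarrow> 'e \<Rightarrow> 'm vfield" where
  "coord_field \<beta> U \<phi> w = (\<lambda>q f. if q \<in> U then \<beta> (\<phi> q) * dvec U \<phi> q w f else 0)"

lemma coord_field_VF:
  assumes U: "(U, \<phi>) \<in> \<A>" and N: "cutoff \<beta> U \<phi> N a R"
  shows "coord_field \<beta> U \<phi> w \<in> VF"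
proof -
  have "coord_field \<beta> U \<phi> w q \<in> TM q" for q
    using tangent_cmult[OF dvec_tangent[OF U]] tangent_zero
    by (cases "q \<in> U") (auto simp: coord_field_def)
  moreover have "(\<lambda>q. coord_field \<beta> U \<phi> w q f) \<in> SF" if f: "f \<in> SF" for f
  proof -
    have "smooth_on (ball a R) (\<lambda>x. frechet_derivative (\<lambda>x. f (inv_into U \<phi> x)) (at x) w)"
      using N by (intro smooth_on_frechet_derivative smooth_on_subset[OF SF_chart[OF f U]]) (auto simp: cutoff_def)
    then have "extend \<beta> U \<phi> (\<lambda>x. frechet_derivative (\<lambda>x. f (inv_into U \<phi> x)) (at x) w) \<in> SF"
      using N by (auto simp: cutoff_def)
    then show ?thesis using f by (simp add: coord_field_def extend_def dvec_def cong: if_cong)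
  qed
  ultimately show ?thesis by (simp add: vector_fields_def)
qed

lemma coord_field_eq:
  "cutoff \<beta> U \<phi> N a R \<Longrightarrow> q \<in> N \<Longrightarrow> coord_field \<beta> U \<phi> w q = dvec U \<phi> q w"
  by (auto simp: coord_field_def cutoff_def)

text \<open>On \<open>N\<close> the cutoff is 1, so the bracket there is a difference of second
  derivatives of one function; elsewhere derivatives of the cutoff would enter.\<close>

lemma coord_fields_commute:
  assumes U: "(U, \<phi>) \<in> \<A>" and N: "cutoff \<beta> U \<phi> N a R" and q: "q \<in> N"
  shows "lie_bracket (coord_field \<beta> U \<phi> u) (coord_field \<beta> U \<phi> w) q = (\<lambda>f. 0)"
proof
  fix f
  let ?W = "coord_field \<beta> U \<phi>"
  show "lie_bracket (?W u) (?W w) q f = 0"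
  proof (cases "f \<in> SF")
    case True
    let ?f = "\<lambda>x. f (inv_into U \<phi> x)"
    have bR: "ball a R \<subseteq> \<phi> ` U" using N by (auto simp: cutoff_def)
    have s: "smooth_on (ball a R) (\<lambda>x. frechet_derivative ?f (at x) w)" for w
      using bR by (intro smooth_on_frechet_derivative smooth_on_subset[OF SF_chart[OF True U]])
    have "(\<lambda>q. ?W w q f) = extend \<beta> U \<phi> (\<lambda>x. frechet_derivative ?f (at x) w)" for w
      using True by (simp add: coord_field_def extend_def dvec_def cong: if_cong)
    then have *: "?W u q (\<lambda>q. ?W w q f) = frechet_derivative (\<lambda>x. frechet_derivative ?f (at x) w) (at (\<phi> q)) u" for u w
      using dvec_extend[OF U N q s] coord_field_eq[OF N q] by simp
    have "\<phi> q \<in> ball a R" using N q by (auto simp: cutoff_def)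
    then show ?thesis
      unfolding lie_bracket_def *
      using smooth_on_derivatives_commute[OF open_ball _ smooth_on_subset[OF SF_chart[OF True U] bR], of "\<phi> q" w u]
      by simp
  next
    case False
    then have "(\<lambda>q. ?W w q f) = (\<lambda>q. 0)" for w by (auto simp: coord_field_def dvec_def)
    then show ?thesis using tangent_const[OF vector_fieldD(1)[OF coord_field_VF[OF U N]], of _ q 0]
      by (simp add: lie_bracket_def)
  qed
qed

text \<open>In the product rule the mixed terms X(f) Y(h) + X(h) Y(f) are symmetric in X and Y and
  cancel.\<close>

lemma lie_bracket_tangent:
  assumes "X \<in> VF" "Y \<in> VF"
  shows "lie_bracket X Y p \<in> TM p"
proof -
  note X = vector_fieldD[OF assms(1)] and Y = vector_fieldD[OF assms(2)]
  note tX = tangentD[OF X(1)] and tY = tangentD[OF Y(1)]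
  have 1: "lie_bracket X Y p f = 0" if "f \<notin> SF" for f
    using that by (simp add: lie_bracket_def tX(1) tY(1) tangent_const[OF X(1)] tangent_const[OF Y(1)])
  have 2: "lie_bracket X Y p (\<lambda>x. f x * h x) = f p * lie_bracket X Y p h + h p * lie_bracket X Y p f"
    if "f \<in> SF" "h \<in> SF" for f h
    using that by (simp add: lie_bracket_def tX tY SF_mult SF_add X(2) Y(2) algebra_simps)
  have 3: "lie_bracket X Y p (\<lambda>x. f x + h x) = lie_bracket X Y p f + lie_bracket X Y p h"
    if "f \<in> SF" "h \<in> SF" for f h
    using that by (simp add: lie_bracket_def tX tY X(2) Y(2))
  have 4: "lie_bracket X Y p (\<lambda>x. c * f x) = c * lie_bracket X Y p f" if "f \<in> SF" for f c
    using that by (simp add: lie_bracket_def tX tY X(2) Y(2) algebra_simps)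
  show ?thesis unfolding tangent_space_def using 1 2 3 4 by blast
qed

lemma lie_bracket_VF: "X \<in> VF \<Longrightarrow> Y \<in> VF \<Longrightarrow> lie_bracket X Y \<in> VF"
proof -
  assume X: "X \<in> VF" and Y: "Y \<in> VF"
  have "(\<lambda>p. lie_bracket X Y p f) \<in> SF" for f
    unfolding lie_bracket_def
    by (rule SF_diff) (rule vector_field_SF[OF X] vector_field_SF[OF Y])+
  then show ?thesis unfolding vector_fields_def using lie_bracket_tangent[OF X Y] by blast
qed

end

text \<open>Stated for any family \<open>\<B>\<close> of open homeomorphic charts, so that it serves
  for the product atlas in the case of the multiplication and for \<open>\<A>\<close> itself in the
  case of the inverse.\<close>

lemma smooth_map_compose_function:
  fixes \<B> :: "('n::topological_space, 'f::euclidean_space) chart set"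
    and \<A> :: "('m::t2_space, 'e::euclidean_space) chart set"
  assumes B: "\<And>U \<phi>. (U, \<phi>) \<in> \<B> \<Longrightarrow> open U \<and> open (\<phi> ` U) \<and> homeomorphism U (\<phi> ` U) \<phi> (inv_into U \<phi>)"
    and A: "smooth_atlas \<A>" and h: "smooth_map \<B> \<A> h" and f: "f \<in> smooth_functions \<A>"
    and U: "(U, \<phi>) \<in> \<B>"
  shows "smooth_on (\<phi> ` U) (\<lambda>x. f (h (inv_into U \<phi> x)))"
proof (rule smooth_on_local)
  fix x assume x: "x \<in> \<phi> ` U"
  let ?\<psi> = "inv_into U \<phi>"
  interpret manifold \<A> by unfold_locales (rule A)
  obtain V \<eta> where V: "(V, \<eta>) \<in> \<A>" "h (?\<psi> x) \<in> V" by (rule chart_at)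
  note oV = chart_facts(1,2)[OF V(1)] and hV = chart_facts(3)[OF V(1)]
  have hU: "homeomorphism U (\<phi> ` U) \<phi> ?\<psi>" and oU: "open (\<phi> ` U)" using B[OF U] by auto
  have ch: "continuous_on UNIV h" using h by (simp add: smooth_map_def)
  have W: "\<phi> ` (U \<inter> h -` V) = \<phi> ` U \<inter> ?\<psi> -` (h -` V)"
    using homeomorphism_apply1[OF hU] homeomorphism_apply2[OF hU] homeomorphism_image2[OF hU] by force
  have oW: "open (\<phi> ` (U \<inter> h -` V))"
    unfolding W using oU homeomorphism_cont2[OF hU] ch oV(1)
    by (intro continuous_open_preimage) (auto simp: open_vimage)
  moreover have "x \<in> \<phi> ` (U \<inter> h -` V)" unfolding W using x V by auto
  moreover have "smooth_on (\<phi> ` (U \<inter> h -` V)) (\<lambda>x. f (h (?\<psi> x)))"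
  proof -
    have 1: "smooth_on (\<phi> ` (U \<inter> h -` V)) (\<lambda>x. \<eta> (h (?\<psi> x)))"
    proof -
      have "\<forall>(U, \<phi>)\<in>\<B>. \<forall>(V, \<psi>)\<in>\<A>. smooth_on (\<phi> ` (U \<inter> h -` V)) (\<psi> \<circ> h \<circ> inv_into U \<phi>)"
        using h unfolding smooth_map_def by blast
      from bspec[OF this U] have "\<forall>(V, \<psi>)\<in>\<A>. smooth_on (\<phi> ` (U \<inter> h -` V)) (\<psi> \<circ> h \<circ> ?\<psi>)" by simp
      from bspec[OF this V(1)] show ?thesis by (simp add: o_def)
    qed
    have 2: "smooth_on (\<eta> ` V) (\<lambda>y. f (inv_into V \<eta> y))"
      by (rule SF_chart[OF f V(1)])
    have "smooth_on (\<phi> ` (U \<inter> h -` V)) (\<lambda>x. f (inv_into V \<eta> (\<eta> (h (?\<psi> x)))))"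
      by (rule smooth_on_compose[OF oW oV(2) 1 2]) (unfold W, auto)
    then show ?thesis
      by (subst smooth_on_cong[OF oW, where g="\<lambda>x. f (inv_into V \<eta> (\<eta> (h (?\<psi> x))))"])
        (unfold W, auto simp: homeomorphism_apply1[OF hV])
  qed
  ultimately show "\<exists>W. open W \<and> x \<in> W \<and> smooth_on W (\<lambda>x. f (h (?\<psi> x)))" by blast
qed

section \<open>Gluing local primitives over a simply connected space\<close>

text \<open>A section along \<open>H\<close> plays the role of a lift of \<open>H\<close> to the covering space whose sheets are
  the local primitives shifted by constants; this avoids topologizing that covering.\<close>

definition section_on ::
  "('m::topological_space set \<times> ('m \<Rightarrow> real)) set \<Rightarrow> ('x::topological_space \<Rightarrow> 'm) \<Rightarrow> 'x set \<Rightarrow> ('x \<Rightarrow> real) \<Rightarrow> bool" where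
  "section_on L H A F \<longleftrightarrow> (\<forall>x\<in>A. \<exists>(U, f)\<in>L. \<exists>N c. open N \<and> x \<in> N \<and>
     (\<forall>y\<in>N \<inter> A. H y \<in> U \<and> F y = f (H y) + c))"

text \<open>Two primitives are asked to differ by a constant only near each common point, because
  the overlap of their domains may be disconnected.\<close>

locale local_primitives =
  fixes L :: "('m::topological_space set \<times> ('m \<Rightarrow> real)) set"
  assumes open_dom: "(U, f) \<in> L \<Longrightarrow> open U"
    and connected_dom: "(U, f) \<in> L \<Longrightarrow> path_connected U"
    and cover: "\<exists>(U, f)\<in>L. x \<in> U"
    and compat: "(U, f) \<in> L \<Longrightarrow> (V, h) \<in> L \<Longrightarrow> x \<in> U \<Longrightarrow> x \<in> V \<Longrightarrow>
      \<exists>W c. open W \<and> x \<in> W \<and> (\<forall>y\<in>W. f y = h y + c)"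
begin

lemma section_onD:
  assumes "section_on L H A F" "x \<in> A"
  obtains U f N c where "(U, f) \<in> L" "open N" "x \<in> N" "\<And>y. y \<in> N \<Longrightarrow> y \<in> A \<Longrightarrow> H y \<in> U"
    "\<And>y. y \<in> N \<Longrightarrow> y \<in> A \<Longrightarrow> F y = f (H y) + c"
proof -
  obtain z where "z \<in> L" "case z of (U, f) \<Rightarrow> \<exists>N c. open N \<and> x \<in> N \<and>
     (\<forall>y\<in>N \<inter> A. H y \<in> U \<and> F y = f (H y) + c)"
    using bspec[OF assms(1)[unfolded section_on_def] assms(2)] by (rule bexE)
  moreover obtain U f where "z = (U, f)" by (cases z)
  ultimately obtain N c where "(U, f) \<in> L" "open N" "x \<in> N" "\<forall>y\<in>N \<inter> A. H y \<in> U \<and> F y = f (H y) + c"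
    by auto
  then show thesis using that by simp
qed

lemma section_onI:
  assumes "\<And>x. x \<in> A \<Longrightarrow> \<exists>U f N c. (U, f) \<in> L \<and> open N \<and> x \<in> N \<and> (\<forall>y\<in>N \<inter> A. H y \<in> U \<and> F y = f (H y) + c)"
  shows "section_on L H A F"
  unfolding section_on_def
proof
  fix x assume "x \<in> A"
  from assms[OF this] obtain U f where "(U, f) \<in> L"
    "\<exists>N c. open N \<and> x \<in> N \<and> (\<forall>y\<in>N \<inter> A. H y \<in> U \<and> F y = f (H y) + c)" by blast
  then show "\<exists>(U, f)\<in>L. \<exists>N c. open N \<and> x \<in> N \<and> (\<forall>y\<in>N \<inter> A. H y \<in> U \<and> F y = f (H y) + c)"
    by (intro bexI[of _ "(U, f)"]) simp_all
qed

text \<open>One rule for restricting a section, for adding a constant to it, and for reading it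
  along an edge of a square or a piece of a path.\<close>

lemma section_on_pullback:
  assumes F: "section_on L H A F" and k: "continuous_on B k" "k ` B \<subseteq> A"
    and H': "\<And>x. x \<in> B \<Longrightarrow> H' x = H (k x)" and F': "\<And>x. x \<in> B \<Longrightarrow> F' x = F (k x) + d"
  shows "section_on L H' B F'"
proof (rule section_onI)
  fix x assume x: "x \<in> B"
  then have "k x \<in> A" using k by auto
  from section_onD[OF F this] obtain U f N c where N: "(U, f) \<in> L" "open N" "k x \<in> N"
    "\<And>y. y \<in> N \<Longrightarrow> y \<in> A \<Longrightarrow> H y \<in> U" "\<And>y. y \<in> N \<Longrightarrow> y \<in> A \<Longrightarrow> F y = f (H y) + c" by metis
  obtain M where M: "open M" "M \<inter> B = k -` N \<inter> B"
    using k(1) N(2) unfolding continuous_on_open_invariant by blast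
  have "\<forall>y\<in>M \<inter> B. H' y \<in> U \<and> F' y = f (H' y) + (c + d)"
  proof
    fix y assume "y \<in> M \<inter> B"
    then have "y \<in> B" "k y \<in> N" "k y \<in> A" using M(2) k(2) by auto
    then show "H' y \<in> U \<and> F' y = f (H' y) + (c + d)" using N(4,5)[of "k y"] H' F' by simp
  qed
  moreover have "x \<in> M" using M(2) x N(3) by auto
  ultimately show "\<exists>U f N c. (U, f) \<in> L \<and> open N \<and> x \<in> N \<and> (\<forall>y\<in>N \<inter> B. H' y \<in> U \<and> F' y = f (H' y) + c)"
    using M(1) N(1) by blast
qed


lemma section_on_subset: "section_on L H A F \<Longrightarrow> B \<subseteq> A \<Longrightarrow> section_on L H B F"
  by (rule section_on_pullback[where k="\<lambda>x. x" and d=0]) auto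

lemma section_on_add_const: "section_on L H A F \<Longrightarrow> section_on L H A (\<lambda>x. F x + d)"
  by (rule section_on_pullback[where k="\<lambda>x. x" and d=d]) auto

text \<open>Near \<open>H x\<close>, \<open>compat\<close> expresses the primitive used by
  \<open>G\<close> through the one used by \<open>F\<close>, and the difference is absorbed into the
  constant.\<close>

lemma section_on_common:
  assumes F: "section_on L H A F" and G: "section_on L H B G" and H: "continuous_on (A \<union> B) H"
    and x: "x \<in> A" "x \<in> B"
  obtains U f N a b where "(U, f) \<in> L" "open N" "x \<in> N"
    "\<And>y. y \<in> N \<Longrightarrow> y \<in> A \<Longrightarrow> H y \<in> U \<and> F y = f (H y) + a"
    "\<And>y. y \<in> N \<Longrightarrow> y \<in> B \<Longrightarrow> H y \<in> U \<and> G y = f (H y) + b"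
proof -
  obtain U f N c where N: "(U, f) \<in> L" "open N" "x \<in> N" "\<And>y. y \<in> N \<Longrightarrow> y \<in> A \<Longrightarrow> H y \<in> U"
    "\<And>y. y \<in> N \<Longrightarrow> y \<in> A \<Longrightarrow> F y = f (H y) + c" using section_onD[OF F x(1)] by metis
  obtain V h M d where M: "(V, h) \<in> L" "open M" "x \<in> M" "\<And>y. y \<in> M \<Longrightarrow> y \<in> B \<Longrightarrow> H y \<in> V"
    "\<And>y. y \<in> M \<Longrightarrow> y \<in> B \<Longrightarrow> G y = h (H y) + d" using section_onD[OF G x(2)] by metis
  obtain W e where W: "open W" "H x \<in> W" "\<And>y. y \<in> W \<Longrightarrow> f y = h y + e"
    using compat[OF N(1) M(1) N(4) M(4), of x] N(3) M(3) x by blast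
  have "open (U \<inter> W)" using W(1) open_dom[OF N(1)] by blast
  then obtain P where P: "open P" "P \<inter> (A \<union> B) = H -` (U \<inter> W) \<inter> (A \<union> B)"
    using H unfolding continuous_on_open_invariant by blast
  have "H x \<in> U" using N(3,4) x by blast
  then have xP: "x \<in> P" using P(2) x W(2) by auto
  have *: "H y \<in> U \<inter> W" if "y \<in> P" "y \<in> A \<or> y \<in> B" for y using P(2) that by blast
  show thesis
  proof (rule that[of U f "N \<inter> M \<inter> P" c "d - e"])
    show "open (N \<inter> M \<inter> P)" using N(2) M(2) P(1) by blast
    show "H y \<in> U \<and> F y = f (H y) + c" if "y \<in> N \<inter> M \<inter> P" "y \<in> A" for y using N that by blast
    show "H y \<in> U \<and> G y = f (H y) + (d - e)" if "y \<in> N \<inter> M \<inter> P" "y \<in> B" for y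
      using M(5)[of y] W(3)[of "H y"] *[of y] that by auto
  qed (use N M xP in auto)
qed

text \<open>By \<open>section_on_common\<close> the difference is locally constant, and the
  intersection is connected.\<close>

lemma section_on_unique:
  assumes F: "section_on L H A F" and G: "section_on L H B G" and H: "continuous_on (A \<union> B) H"
    and con: "connected (A \<inter> B)"
  obtains d where "\<And>y. y \<in> A \<inter> B \<Longrightarrow> F y = G y + d"
proof (cases "A \<inter> B = {}")
  case False
  then obtain x where x: "x \<in> A \<inter> B" by blast
  have "(\<lambda>y. F y - G y) y = (\<lambda>y. F y - G y) x" if "y \<in> A \<inter> B" for y
  proof (rule connected_local_const[OF con that x], rule ballI)
    fix z assume z: "z \<in> A \<inter> B"
    then obtain U f N a b where N: "(U, f) \<in> L" "open N" "z \<in> N"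
      "\<And>y. y \<in> N \<Longrightarrow> y \<in> A \<Longrightarrow> H y \<in> U \<and> F y = f (H y) + a"
      "\<And>y. y \<in> N \<Longrightarrow> y \<in> B \<Longrightarrow> H y \<in> U \<and> G y = f (H y) + b"
      using section_on_common[OF F G H] by (metis IntE)
    have "\<forall>w\<in>N. w \<in> A \<inter> B \<longrightarrow> F z - G z = F w - G w"
      using N(3-5) z by auto
    then show "\<forall>\<^sub>F w in at z within A \<inter> B. F z - G z = F w - G w"
      using N(2,3) unfolding eventually_at_topological by blast
  qed
  then show thesis using that[of "F x - G x"] by (metis (no_types, lifting) diff_add_cancel add.commute)
qed (use that in blast)

text \<open>\<open>G\<close> is first shifted by the constant by which the two sections differ on
  the overlap. Closedness gives a point outside one of the sets a neighbourhood that misses that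
  set.\<close>

lemma section_on_glue:
  assumes F: "section_on L H A F" and G: "section_on L H B G" and H: "continuous_on (A \<union> B) H"
    and cl: "closed A" "closed B" and con: "connected (A \<inter> B)"
  shows "\<exists>K. section_on L H (A \<union> B) K"
proof -
  obtain d where d: "\<And>y. y \<in> A \<inter> B \<Longrightarrow> F y = G y + d"
    by (rule section_on_unique[OF F G H con]) blast
  have G': "section_on L H B (\<lambda>y. G y + d)" by (rule section_on_add_const[OF G])
  define K where "K = (\<lambda>y. if y \<in> A then F y else G y + d)"
  have KA: "K y = F y" if "y \<in> A" for y using that by (simp add: K_def)
  have KB: "K y = G y + d" if "y \<in> B" for y using that d by (auto simp: K_def)
  have "section_on L H (A \<union> B) K"
  proof (rule section_onI)
    fix x assume x: "x \<in> A \<union> B"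
    show "\<exists>U f N c. (U, f) \<in> L \<and> open N \<and> x \<in> N \<and> (\<forall>y\<in>N \<inter> (A \<union> B). H y \<in> U \<and> K y = f (H y) + c)"
    proof (cases "x \<in> A \<and> x \<in> B")
      case True
      obtain U f N a b where N: "(U, f) \<in> L" "open N" "x \<in> N"
        "\<And>y. y \<in> N \<Longrightarrow> y \<in> A \<Longrightarrow> H y \<in> U \<and> F y = f (H y) + a"
        "\<And>y. y \<in> N \<Longrightarrow> y \<in> B \<Longrightarrow> H y \<in> U \<and> G y + d = f (H y) + b"
        using section_on_common[OF F G' H] True by metis
      have "a = b" using N(3) N(4)[of x] N(5)[of x] d[of x] True by auto
      then have "\<forall>y\<in>N \<inter> (A \<union> B). H y \<in> U \<and> K y = f (H y) + a"
        using N(4,5) KA KB by auto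
      then show ?thesis using N(1-3) by blast
    next
      case False
      then consider "x \<in> A" "x \<notin> B" | "x \<in> B" "x \<notin> A" using x by blast
      then show ?thesis
      proof cases
        case 1
        obtain U f N c where N: "(U, f) \<in> L" "open N" "x \<in> N" "\<And>y. y \<in> N \<Longrightarrow> y \<in> A \<Longrightarrow> H y \<in> U"
          "\<And>y. y \<in> N \<Longrightarrow> y \<in> A \<Longrightarrow> F y = f (H y) + c" using section_onD[OF F 1(1)] by metis
        have "\<forall>y\<in>(N - B) \<inter> (A \<union> B). H y \<in> U \<and> K y = f (H y) + c" using N(4,5) KA by auto
        then show ?thesis using N(1-3) 1(2) open_Diff[OF N(2) cl(2)] by blast
      next
        case 2
        obtain U f N c where N: "(U, f) \<in> L" "open N" "x \<in> N" "\<And>y. y \<in> N \<Longrightarrow> y \<in> B \<Longrightarrow> H y \<in> U"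
          "\<And>y. y \<in> N \<Longrightarrow> y \<in> B \<Longrightarrow> G y + d = f (H y) + c" using section_onD[OF G' 2(1)] by metis
        have "\<forall>y\<in>(N - A) \<inter> (A \<union> B). H y \<in> U \<and> K y = f (H y) + c" using N(4,5) KB by auto
        then show ?thesis using N(1-3) 2(2) open_Diff[OF N(2) cl(1)] by blast
      qed
    qed
  qed
  then show ?thesis by blast
qed

section \<open>Sections over the unit square\<close>

abbreviation "unit_rect a b c d \<equiv> ({a..b} \<inter> {0..1::real}) \<times> ({c..d} \<inter> {0..1::real})"

text \<open>Bolzano's bisection is used twice: rectangles are glued in the second coordinate to a
  strip around a fixed s, then strips are glued in the first coordinate. Neighbours meet in a
  connected rectangle of zero width, as gluing demands. Intersecting with the unit interval in
  \<open>unit_rect\<close> lets boundary points be treated like the others.\<close>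

lemma section_on_square:
  fixes H :: "real \<times> real \<Rightarrow> 'm"
  assumes H: "continuous_on ({0..1} \<times> {0..1}) H"
  obtains F where "section_on L H ({0..1} \<times> {0..1}) F"
proof -
  have sub: "continuous_on A H" if "A \<subseteq> {0..1} \<times> {0..1}" for A
    using H that by (rule continuous_on_subset)
  have closed_rect: "closed (unit_rect a b c d)" for a b c d
    by (intro closed_Times closed_Int) auto
  have conn_rect: "connected (unit_rect a b c d)" for a b c d
    by (intro convex_connected convex_Times convex_Int) auto
  have strip: "\<exists>e>0. \<exists>F. section_on L H (unit_rect (s - e) (s + e) 0 1) F" if s: "0 \<le> s" "s \<le> 1" for s
  proof -
    let ?Q = "\<lambda>c d. \<exists>e>0. \<exists>F. section_on L H (unit_rect (s - e) (s + e) c d) F"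
    have "?Q 0 1"
    proof (rule Bolzano[of 0 1 ?Q])
      show "(0::real) \<le> 1" by simp
    next
      fix a b c :: real
      assume 1: "?Q a b" and 2: "?Q b c" and le: "a \<le> b" "b \<le> c"
      obtain e1 F1 where e1: "e1 > 0" "section_on L H (unit_rect (s - e1) (s + e1) a b) F1" using 1 by blast
      obtain e2 F2 where e2: "e2 > 0" "section_on L H (unit_rect (s - e2) (s + e2) b c) F2" using 2 by blast
      \<comment> \<open>The width of the strip may shrink with every gluing, which is why it is
        quantified inside the bisected property.\<close>
      define e where "e = min e1 e2"
      have s1: "section_on L H (unit_rect (s - e) (s + e) a b) F1"
        by (rule section_on_subset[OF e1(2)]) (auto simp: e_def)
      have s2: "section_on L H (unit_rect (s - e) (s + e) b c) F2"
        by (rule section_on_subset[OF e2(2)]) (auto simp: e_def)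
      have i: "unit_rect (s - e) (s + e) a b \<inter> unit_rect (s - e) (s + e) b c = unit_rect (s - e) (s + e) b b"
        using le by auto
      have u: "unit_rect (s - e) (s + e) a b \<union> unit_rect (s - e) (s + e) b c = unit_rect (s - e) (s + e) a c"
        using le by auto
      have "\<exists>K. section_on L H (unit_rect (s - e) (s + e) a b \<union> unit_rect (s - e) (s + e) b c) K"
        by (rule section_on_glue[OF s1 s2 sub closed_rect closed_rect])
          (blast, unfold i, rule conn_rect)
      then show "?Q a c" unfolding u using e1(1) e2(1) by (auto simp: e_def intro!: exI[of _ "min e1 e2"])
    next
      fix t :: real assume t: "0 \<le> t" "t \<le> 1"
      obtain U f where U: "(U, f) \<in> L" "H (s, t) \<in> U" using cover[of "H (s, t)"] by blast
      obtain P where P: "open P" "P \<inter> ({0..1} \<times> {0..1}) = H -` U \<inter> ({0..1} \<times> {0..1})"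
        using H open_dom[OF U(1)] unfolding continuous_on_open_invariant by blast
      have "(s, t) \<in> P" using P(2) U(2) s t by auto
      then obtain A B where AB: "open A" "open B" "s \<in> A" "t \<in> B" "A \<times> B \<subseteq> P"
        using P(1) by (metis open_prod_elim mem_Sigma_iff)
      obtain e where e: "e > 0" "cball s e \<subseteq> A" using AB(1,3) open_contains_cball by blast
      obtain d where d: "d > 0" "ball t d \<subseteq> B" using AB(2,4) open_contains_ball by blast
      have "?Q a b" if "a \<le> t \<and> t \<le> b \<and> b - a < d" for a b
      proof -
        have "section_on L H (unit_rect (s - e) (s + e) a b) (f \<circ> H)"
        proof (rule section_onI)
          fix x assume x: "x \<in> unit_rect (s - e) (s + e) a b"
          have "H y \<in> U" if y: "y \<in> unit_rect (s - e) (s + e) a b" for y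
          proof -
            have "fst y \<in> cball s e" using y by (auto simp: dist_real_def)
            moreover have "snd y \<in> ball t d" using y \<open>a \<le> t \<and> t \<le> b \<and> b - a < d\<close> by (auto simp: dist_real_def)
            ultimately have "y \<in> P" using e(2) d(2) AB(5) by (metis subsetD mem_Sigma_iff prod.collapse)
            then show ?thesis using P(2) y by blast
          qed
          then have "\<forall>y\<in>UNIV \<inter> unit_rect (s - e) (s + e) a b. H y \<in> U \<and> (f \<circ> H) y = f (H y) + 0" by simp
          then show "\<exists>U fa N c. (U, fa) \<in> L \<and> open N \<and> x \<in> N \<and>
              (\<forall>y\<in>N \<inter> unit_rect (s - e) (s + e) a b. H y \<in> U \<and> (f \<circ> H) y = fa (H y) + c)"
            using U(1) open_UNIV by blast
        qed
        then show ?thesis using e(1) by blast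
      qed
      then show "\<exists>d>0. \<forall>a b. a \<le> t \<and> t \<le> b \<and> b - a < d \<longrightarrow> ?Q a b" using d(1) by blast
    qed
    then show ?thesis .
  qed
  let ?P = "\<lambda>a b. \<exists>F. section_on L H (unit_rect a b 0 1) F"
  have "?P 0 1"
  proof (rule Bolzano[of 0 1 ?P])
    show "(0::real) \<le> 1" by simp
  next
    fix a b c :: real
    assume "?P a b" "?P b c" and le: "a \<le> b" "b \<le> c"
    then obtain F1 F2 where s: "section_on L H (unit_rect a b 0 1) F1" "section_on L H (unit_rect b c 0 1) F2" by blast
    have i: "unit_rect a b 0 1 \<inter> unit_rect b c 0 1 = unit_rect b b 0 1" using le by auto
    have u: "unit_rect a b 0 1 \<union> unit_rect b c 0 1 = unit_rect a c 0 1" using le by auto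
    have "\<exists>K. section_on L H (unit_rect a b 0 1 \<union> unit_rect b c 0 1) K"
      by (rule section_on_glue[OF s sub closed_rect closed_rect])
          (blast, unfold i, rule conn_rect)
    then show "?P a c" unfolding u .
  next
    fix s :: real assume "0 \<le> s" "s \<le> 1"
    from strip[OF this] obtain e F where e: "e > 0" "section_on L H (unit_rect (s - e) (s + e) 0 1) F" by blast
    have "?P a b" if "a \<le> s \<and> s \<le> b \<and> b - a < e" for a b
      using section_on_subset[OF e(2), of "unit_rect a b 0 1"] that by fastforce
    then show "\<exists>d>0. \<forall>a b. a \<le> s \<and> s \<le> b \<and> b - a < d \<longrightarrow> ?P a b" using e(1) by blast
  qed
  then show thesis using that by auto
qed

section \<open>Increments along paths\<close>

definition increment :: "(real \<Rightarrow> 'm) \<Rightarrow> real \<Rightarrow> bool" where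
  "increment \<gamma> d \<longleftrightarrow> (\<exists>F. section_on L \<gamma> {0..1} F \<and> F 1 - F 0 = d)"

text \<open>The increment plays the role of the line integral of the common differential, for paths
  that are merely continuous. Existence comes from \<open>section_on_square\<close>, the path being
  made constant in the first coordinate.\<close>

lemma increment_exists:
  assumes "path \<gamma>"
  obtains d where "increment \<gamma> d"
proof -
  have c: "continuous_on ({0..1::real} \<times> {0..1}) (\<lambda>z. \<gamma> (snd z))"
    using assms unfolding path_def by (rule continuous_on_compose2) (auto intro!: continuous_intros)
  obtain F where F: "section_on L (\<lambda>z. \<gamma> (snd z)) ({0..1::real} \<times> {0..1}) F"
    by (rule section_on_square[OF c])
  have "section_on L \<gamma> {0..1} (\<lambda>t. F (0, t))"
    by (rule section_on_pullback[OF F, of _ "\<lambda>t. (0, t)" _ _ 0]) (auto intro!: continuous_intros)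
  then show thesis using that unfolding increment_def by blast
qed

lemma increment_eq:
  assumes "path \<gamma>" "increment \<gamma> d" "section_on L \<gamma> {0..1} F"
  shows "F 1 - F 0 = d"
proof -
  obtain G where G: "section_on L \<gamma> {0..1} G" "G 1 - G 0 = d" using assms(2) by (auto simp: increment_def)
  obtain c where "\<And>y. y \<in> {0..1} \<inter> {0..1} \<Longrightarrow> F y = G y + c"
    by (rule section_on_unique[OF assms(3) G(1)]) (use assms(1) in \<open>auto simp: path_def\<close>)
  from this[of 0] this[of 1] show ?thesis using G(2) by simp
qed

text \<open>A section along the joined path restricts to sections along its two halves, and by
  \<open>increment_eq\<close> any section computes the increment.\<close>

lemma increment_join:
  assumes "path \<gamma>" "path \<delta>" "pathfinish \<gamma> = pathstart \<delta>" "increment \<gamma> c" "increment \<delta> d" "increment (\<gamma> +++ \<delta>) e"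
  shows "e = c + d"
proof -
  obtain F where F: "section_on L (\<gamma> +++ \<delta>) {0..1} F" "F 1 - F 0 = e" using assms(6) by (auto simp: increment_def)
  have "section_on L \<gamma> {0..1} (\<lambda>t. F (t / 2))"
    by (rule section_on_pullback[OF F(1), of _ "\<lambda>t. t / 2" _ _ 0])
      (auto intro!: continuous_intros simp: joinpaths_def)
  then have 1: "F (1/2) - F 0 = c" using increment_eq[OF assms(1,4)] by fastforce
  have "section_on L \<delta> {0..1} (\<lambda>t. F (t / 2 + 1 / 2))"
    by (rule section_on_pullback[OF F(1), of _ "\<lambda>t. t / 2 + 1 / 2" _ _ 0])
      (use assms(3) in \<open>auto intro!: continuous_intros simp: joinpaths_def pathfinish_def pathstart_def\<close>)
  then have 2: "F 1 - F (1/2) = d" using increment_eq[OF assms(2,5)] by fastforce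
  show ?thesis using 1 2 F(2) by simp
qed

lemma increment_reverse:
  assumes "increment \<gamma> d"
  shows "increment (reversepath \<gamma>) (- d)"
proof -
  obtain F where F: "section_on L \<gamma> {0..1} F" "F 1 - F 0 = d" using assms by (auto simp: increment_def)
  have "section_on L (reversepath \<gamma>) {0..1} (\<lambda>t. F (1 - t))"
    by (rule section_on_pullback[OF F(1), of _ "\<lambda>t. 1 - t" _ _ 0])
      (auto intro!: continuous_intros simp: reversepath_def)
  then show ?thesis using F(2) unfolding increment_def by (intro exI[of _ "\<lambda>t. F (1 - t)"]) auto
qed

lemma increment_in_domain:
  assumes "(U, f) \<in> L" "path_image \<gamma> \<subseteq> U"
  shows "increment \<gamma> (f (pathfinish \<gamma>) - f (pathstart \<gamma>))"
proof -
  have "section_on L \<gamma> {0..1} (f \<circ> \<gamma>)"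
  proof (rule section_onI)
    fix t :: real
    have "\<forall>y\<in>UNIV \<inter> {0..1}. \<gamma> y \<in> U \<and> (f \<circ> \<gamma>) y = f (\<gamma> y) + 0" using assms(2) by (auto simp: path_image_def)
    then show "\<exists>U fa N c. (U, fa) \<in> L \<and> open N \<and> t \<in> N \<and> (\<forall>y\<in>N \<inter> {0..1}. \<gamma> y \<in> U \<and> (f \<circ> \<gamma>) y = fa (\<gamma> y) + c)"
      using assms(1) open_UNIV by blast
  qed
  then show ?thesis unfolding increment_def pathfinish_def pathstart_def by (intro exI[of _ "f \<circ> \<gamma>"]) simp
qed

text \<open>A section over a free homotopy to a constant loop grows by d along one edge of the
  square and by 0 along the opposite one. The other two edges are the same path, so the section
  grows equally along them, and comparing the corners gives d = 0.\<close>

lemma increment_loop: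
  assumes sc: "simply_connected (UNIV :: 'm set)" and \<gamma>: "path \<gamma>" "pathfinish \<gamma> = pathstart \<gamma>"
    and d: "increment \<gamma> d"
  shows "d = 0"
proof -
  let ?I = "{0..1::real}"
  have "homotopic_loops UNIV \<gamma> (\<lambda>_. pathstart \<gamma>)"
  proof -
    have "path (\<lambda>_::real. pathstart \<gamma>)" by (simp add: path_def)
    then show ?thesis using sc \<gamma> unfolding simply_connected_def by (simp add: pathstart_def pathfinish_def)
  qed
  then obtain h where h: "continuous_on (?I \<times> ?I) h" "\<And>x. x \<in> ?I \<Longrightarrow> h (0, x) = \<gamma> x"
    "\<And>x. x \<in> ?I \<Longrightarrow> h (1, x) = pathstart \<gamma>" "\<And>t. t \<in> ?I \<Longrightarrow> h (t, 1) = h (t, 0)"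
    unfolding homotopic_loops by (auto simp: pathstart_def pathfinish_def)
  obtain F where F: "section_on L h (?I \<times> ?I) F" by (rule section_on_square[OF h(1)])
  have s: "section_on L (\<lambda>t. h (t, 0)) ?I (\<lambda>t. F (t, 0))" "section_on L (\<lambda>t. h (t, 0)) ?I (\<lambda>t. F (t, 1))"
    by (rule section_on_pullback[OF F, of _ "\<lambda>t. (t, 0)" _ _ 0], auto intro!: continuous_intros)
      (rule section_on_pullback[OF F, of _ "\<lambda>t. (t, 1)" _ _ 0], auto intro!: continuous_intros simp: h(4))
  have "continuous_on (?I \<union> ?I) (\<lambda>t. h (t, 0))"
    by (rule continuous_on_compose2[OF h(1)]) (auto intro!: continuous_intros)
  from section_on_unique[OF s this] obtain c where c: "\<And>t. t \<in> ?I \<inter> ?I \<Longrightarrow> F (t, 0) = F (t, 1) + c" by auto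
  have "section_on L \<gamma> ?I (\<lambda>t. F (0, t))"
    by (rule section_on_pullback[OF F, of _ "\<lambda>t. (0, t)" _ _ 0]) (auto intro!: continuous_intros simp: h(2))
  from increment_eq[OF \<gamma>(1) d this] have 1: "F (0, 1) - F (0, 0) = d" .
  have p: "path (\<lambda>_::real. pathstart \<gamma>)" by (simp add: path_def)
  obtain U f where U: "(U, f) \<in> L" "pathstart \<gamma> \<in> U" using cover by blast
  have i0: "increment (\<lambda>_. pathstart \<gamma>) 0"
    using increment_in_domain[OF U(1), of "\<lambda>_. pathstart \<gamma>"] U(2) by (auto simp: path_image_def pathfinish_def pathstart_def)
  have "section_on L (\<lambda>_. pathstart \<gamma>) ?I (\<lambda>t. F (1, t))"
    by (rule section_on_pullback[OF F, of _ "\<lambda>t. (1, t)" _ _ 0]) (auto intro!: continuous_intros simp: h(3))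
  from increment_eq[OF p i0 this] have 2: "F (1, 1) - F (1, 0) = 0" .
  show ?thesis using 1 2 c[of 0] c[of 1] by simp
qed

text \<open>\<open>simply_connected\<close> says that any two loops are freely homotopic. For two
  constant loops the base point of the homotopy traces a path between them.\<close>

lemma simply_connected_paths:
  assumes sc: "simply_connected (UNIV :: 'm set)"
  obtains \<gamma> where "path \<gamma>" "pathstart \<gamma> = (p::'m)" "pathfinish \<gamma> = q"
proof -
  let ?I = "{0..1::real}"
  have "path (\<lambda>_::real. p)" "path (\<lambda>_::real. q)" by (simp_all add: path_def)
  then have "homotopic_loops UNIV (\<lambda>_. p) (\<lambda>_. q)"
    using sc unfolding simply_connected_def by (simp add: pathstart_def pathfinish_def)
  then obtain h where h: "continuous_on (?I \<times> ?I) h" "\<And>x. x \<in> ?I \<Longrightarrow> h (0, x) = p"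
    "\<And>x. x \<in> ?I \<Longrightarrow> h (1, x) = q"
    unfolding homotopic_loops by auto
  have "continuous_on ?I (\<lambda>t. h (t, 0))"
    by (rule continuous_on_compose2[OF h(1)]) (auto intro!: continuous_intros)
  then show thesis using that[of "\<lambda>t. h (t, 0)"] h(2,3)[of 0] by (simp add: path_def pathstart_def pathfinish_def)
qed

text \<open>The value of y at p is the increment along some path from a base point to p. For two
  points of one domain, the two chosen paths and a path inside the domain close up to a loop, whose
  increment vanishes.\<close>

proposition global_primitive:
  assumes sc: "simply_connected (UNIV :: 'm set)"
  obtains y where "\<And>U f. (U, f) \<in> L \<Longrightarrow> \<exists>c. \<forall>x\<in>U. y x = f x + c"
proof -
  fix o' :: 'm
  have "\<exists>d. \<exists>\<gamma>. path \<gamma> \<and> pathstart \<gamma> = o' \<and> pathfinish \<gamma> = p \<and> increment \<gamma> d" for p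
  proof -
    obtain \<gamma> where "path \<gamma>" "pathstart \<gamma> = o'" "pathfinish \<gamma> = p" by (rule simply_connected_paths[OF sc])
    moreover obtain d where "increment \<gamma> d" by (rule increment_exists[OF \<open>path \<gamma>\<close>])
    ultimately show ?thesis by blast
  qed
  then obtain y where y: "\<And>p. \<exists>\<gamma>. path \<gamma> \<and> pathstart \<gamma> = o' \<and> pathfinish \<gamma> = p \<and> increment \<gamma> (y p)" by metis
  have "y q - f q = y p - f p" if U: "(U, f) \<in> L" and pq: "p \<in> U" "q \<in> U" for U f p q
  proof -
    obtain \<gamma> where g: "path \<gamma>" "pathstart \<gamma> = o'" "pathfinish \<gamma> = p" "increment \<gamma> (y p)" using y by blast
    obtain \<delta> where d: "path \<delta>" "pathstart \<delta> = o'" "pathfinish \<delta> = q" "increment \<delta> (y q)" using y by blast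
    obtain \<sigma> where s: "path \<sigma>" "path_image \<sigma> \<subseteq> U" "pathstart \<sigma> = p" "pathfinish \<sigma> = q"
      using connected_dom[OF U] pq unfolding path_connected_def by blast
    have i1: "increment \<sigma> (f q - f p)" using increment_in_domain[OF U s(2)] s by simp
    have i2: "increment (reversepath \<delta>) (- y q)" by (rule increment_reverse[OF d(4)])
    have p1: "path (\<sigma> +++ reversepath \<delta>)" using s d by simp
    obtain e where e: "increment (\<sigma> +++ reversepath \<delta>) e" by (rule increment_exists[OF p1])
    have e': "e = (f q - f p) + (- y q)"
      by (rule increment_join[OF s(1) _ _ i1 i2 e]) (use s d in auto)
    have p2: "path (\<gamma> +++ (\<sigma> +++ reversepath \<delta>))" using p1 g s by simp
    obtain k where k: "increment (\<gamma> +++ (\<sigma> +++ reversepath \<delta>)) k" by (rule increment_exists[OF p2])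
    have "k = y p + e" by (rule increment_join[OF g(1) p1 _ g(4) e k]) (use g s in auto)
    moreover have "k = 0" by (rule increment_loop[OF sc p2 _ k]) (use g d in auto)
    ultimately show ?thesis using e' by simp
  qed
  then have "\<exists>c. \<forall>x\<in>U. y x = f x + c" if "(U, f) \<in> L" for U f
    using that by (metis diff_add_cancel add.commute)
  then show thesis using that by blast
qed

end

context manifold
begin

section \<open>Closed one-forms\<close>

definition one_form :: "('m \<Rightarrow> 'm tangent \<Rightarrow> real) \<Rightarrow> bool" where
  "one_form \<alpha> \<longleftrightarrow>
     (\<forall>p. \<forall>v\<in>TM p. \<forall>w\<in>TM p. \<alpha> p (\<lambda>f. v f + w f) = \<alpha> p v + \<alpha> p w) \<and>
     (\<forall>p c. \<forall>v\<in>TM p. \<alpha> p (\<lambda>f. c * v f) = c * \<alpha> p v) \<and>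
     (\<forall>X\<in>VF. (\<lambda>p. \<alpha> p (X p)) \<in> SF)"

text \<open>This is d\<alpha>(X, Y) = 0, with the exterior derivative spelled out by Cartan's
  formula.\<close>

definition closed_form :: "('m \<Rightarrow> 'm tangent \<Rightarrow> real) \<Rightarrow> bool" where
  "closed_form \<alpha> \<longleftrightarrow> (\<forall>X\<in>VF. \<forall>Y\<in>VF. \<forall>p.
     X p (\<lambda>q. \<alpha> q (Y q)) - Y p (\<lambda>q. \<alpha> q (X q)) = \<alpha> p (lie_bracket X Y p))"

lemma one_formD:
  assumes "one_form \<alpha>"
  shows "v \<in> TM p \<Longrightarrow> w \<in> TM p \<Longrightarrow> \<alpha> p (\<lambda>f. v f + w f) = \<alpha> p v + \<alpha> p w"
    and "v \<in> TM p \<Longrightarrow> \<alpha> p (\<lambda>f. c * v f) = c * \<alpha> p v"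
    and "X \<in> VF \<Longrightarrow> (\<lambda>p. \<alpha> p (X p)) \<in> SF"
proof -
  note a = assms[unfolded one_form_def]
  show "v \<in> TM p \<Longrightarrow> w \<in> TM p \<Longrightarrow> \<alpha> p (\<lambda>f. v f + w f) = \<alpha> p v + \<alpha> p w"
    by (rule bspec[OF bspec[OF spec[OF conjunct1[OF a]]]])
  show "v \<in> TM p \<Longrightarrow> \<alpha> p (\<lambda>f. c * v f) = c * \<alpha> p v"
    by (rule bspec[OF spec[OF spec[OF conjunct1[OF conjunct2[OF a]]]]])
  show "X \<in> VF \<Longrightarrow> (\<lambda>p. \<alpha> p (X p)) \<in> SF"
    by (rule bspec[OF conjunct2[OF conjunct2[OF a]]])
qed

lemma one_form_zero: "one_form \<alpha> \<Longrightarrow> \<alpha> p (\<lambda>f. 0) = 0"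
  using one_formD(2)[OF _ tangent_zero, of \<alpha> p 0] by simp

lemma tangent_linear_sum:
  fixes l :: "'m tangent \<Rightarrow> real"
  assumes add: "\<And>v w. v \<in> TM p \<Longrightarrow> w \<in> TM p \<Longrightarrow> l (\<lambda>f. v f + w f) = l v + l w"
    and cmult: "\<And>c v. v \<in> TM p \<Longrightarrow> l (\<lambda>f. c * v f) = c * l v"
    and v: "\<And>i. i \<in> I \<Longrightarrow> v i \<in> TM p"
  shows "l (\<lambda>f. \<Sum>i\<in>I. c i * v i f) = (\<Sum>i\<in>I. c i * l (v i))"
proof -
  have zero: "l (\<lambda>f. 0) = 0" using cmult[OF tangent_zero, of 0] by simp
  show ?thesis
    using v
  proof (induction I rule: infinite_finite_induct)
    case (insert i I)
    have "(\<lambda>f. c i * v i f) \<in> TM p" using insert.prems by (intro tangent_cmult) simp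
    moreover have "(\<lambda>f. \<Sum>i\<in>I. c i * v i f) \<in> TM p" using insert.prems by (intro tangent_lincomb) simp
    ultimately have "l (\<lambda>f. c i * v i f + (\<Sum>i\<in>I. c i * v i f)) = l (\<lambda>f. c i * v i f) + l (\<lambda>f. \<Sum>i\<in>I. c i * v i f)"
      by (rule add)
    moreover have "l (\<lambda>f. c i * v i f) = c i * l (v i)"
      using insert.prems by (intro cmult) simp
    ultimately show ?case using insert by simp
  qed (auto simp: zero)
qed

lemma one_form_sum:
  assumes "one_form \<alpha>" and "\<And>i. i \<in> I \<Longrightarrow> v i \<in> TM p"
  shows "\<alpha> p (\<lambda>f. \<Sum>i\<in>I. c i * v i f) = (\<Sum>i\<in>I. c i * \<alpha> p (v i))"
  by (rule tangent_linear_sum[OF one_formD(1,2)[OF assms(1)] assms(2)])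

lemma tangent_eq_on_Basis:
  assumes \<alpha>: "one_form \<alpha>" and U: "(U, \<phi>) \<in> \<A>" "q \<in> U"
    and eq: "\<And>b. b \<in> Basis \<Longrightarrow> dvec U \<phi> q b f = \<alpha> q (dvec U \<phi> q b)" and v: "v \<in> TM q"
  shows "v f = \<alpha> q v"
proof -
  obtain w where w: "v = dvec U \<phi> q w" by (rule tangent_eq_dvec[OF U v])
  have "\<alpha> q v = \<alpha> q (\<lambda>f. \<Sum>b\<in>Basis. (w \<bullet> b) * dvec U \<phi> q b f)"
    unfolding w by (subst dvec_Basis_sum[OF U]) simp
  also have "\<dots> = (\<Sum>b\<in>Basis. (w \<bullet> b) * \<alpha> q (dvec U \<phi> q b))"
    by (rule one_form_sum[OF \<alpha> dvec_tangent[OF U]])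
  also have "\<dots> = v f"
    unfolding w by (subst dvec_Basis_sum[OF U]) (simp add: eq)
  finally show ?thesis by simp
qed

text \<open>Two cutoffs are nested. The outer one yields global fields that commute on
  \<open>N\<close>, so that closedness of \<alpha> becomes the hypothesis of
  \<open>poincare_ball\<close> for a ball inside the image of \<open>N\<close>. The inner one
  extends the primitive found on that ball to a global function.\<close>

lemma closed_form_local_primitive:
  assumes \<alpha>: "one_form \<alpha>" and closed: "closed_form \<alpha>"
  obtains N f where "open N" "p \<in> N" "path_connected N" "f \<in> SF"
    "\<And>q v. q \<in> N \<Longrightarrow> v \<in> TM q \<Longrightarrow> v f = \<alpha> q v"
proof -
  obtain U \<phi> where U: "(U, \<phi>) \<in> \<A>" "p \<in> U" by (rule chart_at)
  obtain \<beta> N R where N: "p \<in> N" "cutoff \<beta> U \<phi> N (\<phi> p) R"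
    using cutoff_subset_exists[OF U, of UNIV] by (metis UNIV_I open_UNIV)
  have NU: "N \<subseteq> U" "open N" using N(2) by (auto simp: cutoff_def)
  obtain \<beta>' N' r where N': "p \<in> N'" "cutoff \<beta>' U \<phi> N' (\<phi> p) r" "ball (\<phi> p) r \<subseteq> \<phi> ` (U \<inter> N)"
    by (rule cutoff_subset_exists[OF U NU(2) N(1)])
  have c': "0 < r" "N' \<subseteq> U" "open N'" "\<phi> ` N' \<subseteq> ball (\<phi> p) r" "convex (\<phi> ` N')" "ball (\<phi> p) r \<subseteq> \<phi> ` U"
    "\<And>h. smooth_on (ball (\<phi> p) r) h \<Longrightarrow> extend \<beta>' U \<phi> h \<in> SF"
    using N'(2) by (auto simp: cutoff_def)
  have ballN: "inv_into U \<phi> x \<in> N \<and> \<phi> (inv_into U \<phi> x) = x" if "x \<in> ball (\<phi> p) r" for x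
    using N'(3) that chart_inv(1)[OF U(1)] by fastforce
  have N'N: "q \<in> N" if "q \<in> N'" for q
  proof -
    have "q \<in> U" "\<phi> q \<in> ball (\<phi> p) r" using c'(2,4) that by blast+
    then show ?thesis using ballN[of "\<phi> q"] chart_inv(1)[OF U(1), of q] by simp
  qed
  let ?W = "coord_field \<beta> U \<phi>"
  have W: "?W b \<in> VF" for b by (rule coord_field_VF[OF U(1) N(2)])
  have aW: "(\<lambda>q. \<alpha> q (?W b q)) \<in> SF" for b by (rule one_formD(3)[OF \<alpha> W])
  define A where "A = (\<lambda>b x. \<alpha> (inv_into U \<phi> x) (?W b (inv_into U \<phi> x)))"
  have sA: "smooth_on (ball (\<phi> p) r) (A b)" for b
    unfolding A_def by (rule smooth_on_subset[OF SF_chart[OF aW U(1)] c'(6)])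
  have dA: "frechet_derivative (A b) (at x) c = ?W c (inv_into U \<phi> x) (\<lambda>q. \<alpha> q (?W b q))"
    if "x \<in> ball (\<phi> p) r" for x b c
    using coord_field_eq[OF N(2), of "inv_into U \<phi> x" c] ballN[OF that] aW by (simp add: dvec_def A_def)
  obtain h where h: "smooth_on (ball (\<phi> p) r) h"
    "\<And>x c. x \<in> ball (\<phi> p) r \<Longrightarrow> c \<in> Basis \<Longrightarrow> frechet_derivative h (at x) c = A c x"
  proof (rule poincare_ball[OF sA c'(1)])
    fix b c :: 'e and x assume x: "x \<in> ball (\<phi> p) r"
    let ?q = "inv_into U \<phi> x"
    have "?W c ?q (\<lambda>q. \<alpha> q (?W b q)) - ?W b ?q (\<lambda>q. \<alpha> q (?W c q)) = \<alpha> ?q (lie_bracket (?W c) (?W b) ?q)"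
      using closed W unfolding closed_form_def by blast
    also have "\<dots> = 0"
      using coord_fields_commute[OF U(1) N(2), of ?q] ballN[OF x] one_form_zero[OF \<alpha>] by simp
    finally show "frechet_derivative (A b) (at x) c = frechet_derivative (A c) (at x) b"
      by (simp add: dA[OF x])
  qed blast
  define f where "f = extend \<beta>' U \<phi> h"
  show thesis
  proof (rule that[OF c'(3) N'(1)])
    show "f \<in> SF" unfolding f_def by (rule c'(7)[OF h(1)])
    have "N' = inv_into U \<phi> ` \<phi> ` N'"
      using chart_inv(1)[OF U(1)] c'(2) by force
    moreover have "path_connected (inv_into U \<phi> ` \<phi> ` N')"
    proof (rule path_connected_continuous_image)
      show "continuous_on (\<phi> ` N') (inv_into U \<phi>)"
        by (rule continuous_on_subset[OF homeomorphism_cont2[OF chart_facts(3)[OF U(1)]]]) (use c'(2) in blast)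
      show "path_connected (\<phi> ` N')" by (rule convex_imp_path_connected[OF c'(5)])
    qed
    ultimately show "path_connected N'" by simp
    fix q v assume q: "q \<in> N'" and v: "v \<in> TM q"
    have qU: "q \<in> U" "\<phi> q \<in> ball (\<phi> p) r" "q \<in> N" using q c'(2,4) N'N by auto
    show "v f = \<alpha> q v"
    proof (rule tangent_eq_on_Basis[OF \<alpha> U(1) qU(1) _ v])
      fix b :: 'e assume b: "b \<in> Basis"
      have "dvec U \<phi> q b f = A b (\<phi> q)"
        unfolding f_def using dvec_extend[OF U(1) N'(2) q h(1)] h(2)[OF qU(2) b] by simp
      also have "\<dots> = \<alpha> q (dvec U \<phi> q b)"
        using coord_field_eq[OF N(2) qU(3)] chart_inv(1)[OF U(1) qU(1)] by (simp add: A_def)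
      finally show "dvec U \<phi> q b f = \<alpha> q (dvec U \<phi> q b)" .
    qed
  qed
qed

lemma locally_constant:
  assumes k: "k \<in> SF" and M: "open M" "x \<in> M" and z: "\<forall>q\<in>M. \<forall>v\<in>TM q. v k = 0"
  obtains W c where "open W" "x \<in> W" "\<And>y. y \<in> W \<Longrightarrow> k y = c"
proof -
  obtain U \<phi> where U: "(U, \<phi>) \<in> \<A>" "x \<in> U" by (rule chart_at)
  obtain \<beta> N R where N: "x \<in> N" "cutoff \<beta> U \<phi> N (\<phi> x) R" "ball (\<phi> x) R \<subseteq> \<phi> ` (U \<inter> M)"
    by (rule cutoff_subset_exists[OF U M])
  have c: "N \<subseteq> U" "open N" "\<phi> ` N \<subseteq> ball (\<phi> x) R" "convex (\<phi> ` N)" using N(2) by (auto simp: cutoff_def)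
  have NM: "q \<in> M" if q: "q \<in> N" for q
  proof -
    have "\<phi> q \<in> \<phi> ` (U \<inter> M)" using q c(3) N(3) by blast
    then obtain q' where "q' \<in> U" "q' \<in> M" "\<phi> q = \<phi> q'" by blast
    then show ?thesis using chart_inv(1)[OF U(1)] q c(1) by (metis subsetD)
  qed
  have "((\<lambda>y. k (inv_into U \<phi> y)) has_derivative (\<lambda>w. 0)) (at y within \<phi> ` N)" if "y \<in> \<phi> ` N" for y
  proof -
    from that obtain q where q: "q \<in> N" "y = \<phi> q" by blast
    then have qU: "q \<in> U" using c(1) by blast
    have "(\<lambda>w. dvec U \<phi> q w k) = (\<lambda>w. 0)"
      using bspec[OF bspec[OF z NM[OF q(1)]] dvec_tangent[OF U(1) qU]] by auto
    then show ?thesis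
      using SF_chart_derivative[OF k U(1) qU] unfolding q(2) by (metis has_derivative_at_withinI)
  qed
  from has_derivative_zero_constant[OF c(4) this] obtain d where "\<forall>y\<in>\<phi> ` N. k (inv_into U \<phi> y) = d" by blast
  then have "k q = d" if "q \<in> N" for q
    using chart_inv(1)[OF U(1), of q] c(1) that by force
  then show thesis using that c(2) N(1) by blast
qed

text \<open>The local primitives are compatible since every tangent vector on an overlap kills the
  difference of two of them, which is therefore locally constant. The glued function differs from
  each by a constant on its domain, so it is smooth and has the same differential.\<close>

proposition closed_form_exact:
  assumes \<alpha>: "one_form \<alpha>" and closed: "closed_form \<alpha>" and sc: "simply_connected (UNIV :: 'm set)"
  obtains y where "y \<in> SF" "\<And>p v. v \<in> TM p \<Longrightarrow> v y = \<alpha> p v"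
proof -
  define L where "L = {(U, f). open U \<and> path_connected U \<and> f \<in> SF \<and> (\<forall>q\<in>U. \<forall>v\<in>TM q. v f = \<alpha> q v)}"
  interpret local_primitives L
  proof
    show "\<exists>(U, f)\<in>L. x \<in> U" for x
    proof -
      obtain N f where "open N" "x \<in> N" "path_connected N" "f \<in> SF" "\<And>q v. q \<in> N \<Longrightarrow> v \<in> TM q \<Longrightarrow> v f = \<alpha> q v"
        using closed_form_local_primitive[OF \<alpha> closed, of x] by metis
      then have "(N, f) \<in> L" "x \<in> N" unfolding L_def by simp_all
      then show ?thesis by blast
    qed
    fix U f V h x
    assume f: "(U, f) \<in> L" and h: "(V, h) \<in> L" and x: "x \<in> U" "x \<in> V"
    have SF: "f \<in> SF" "h \<in> SF" and o: "open (U \<inter> V)" using f h by (auto simp: L_def)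
    have z: "\<forall>q\<in>U \<inter> V. \<forall>v\<in>TM q. v (\<lambda>x. f x - h x) = 0"
    proof (intro ballI)
      fix q v assume "q \<in> U \<inter> V" and v: "v \<in> TM q"
      then have "v f = \<alpha> q v" "v h = \<alpha> q v" using f h by (auto simp: L_def)
      then show "v (\<lambda>x. f x - h x) = 0" using tangent_diff[OF v SF] by simp
    qed
    have "x \<in> U \<inter> V" using x by blast
    from locally_constant[OF SF_diff[OF SF] o this z]
    obtain W c where W: "open W" "x \<in> W" and c: "\<And>y. y \<in> W \<Longrightarrow> f y - h y = c" by blast
    have "\<forall>y\<in>W. f y = h y + c"
    proof
      fix y assume "y \<in> W"
      from c[OF this] show "f y = h y + c" by simp
    qed
    then show "\<exists>W c. open W \<and> x \<in> W \<and> (\<forall>y\<in>W. f y = h y + c)"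
      using W by blast
  qed (auto simp: L_def)
  obtain y where y: "\<And>U f. (U, f) \<in> L \<Longrightarrow> \<exists>c. \<forall>x\<in>U. y x = f x + c"
    using global_primitive[OF sc] by blast
  have loc: "\<exists>U f c. open U \<and> p \<in> U \<and> f \<in> SF \<and> (\<forall>q\<in>U. y q = f q + c) \<and> (\<forall>v\<in>TM p. v f = \<alpha> p v)" for p
  proof -
    obtain U f where U: "(U, f) \<in> L" "p \<in> U" using cover[of p] by blast
    moreover obtain c where "\<forall>x\<in>U. y x = f x + c" using y[OF U(1)] by blast
    ultimately show ?thesis unfolding L_def by blast
  qed
  have ySF: "y \<in> SF"
  proof (rule SF_local_eqI)
    fix p
    obtain U f c where "open U" "p \<in> U" "f \<in> SF" "\<forall>q\<in>U. y q = f q + c" using loc[of p] by blast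
    then show "\<exists>N f'. open N \<and> p \<in> N \<and> f' \<in> SF \<and> (\<forall>x\<in>N. y x = f' x)"
      using SF_add[OF _ SF_const, of f c] by blast
  qed
  moreover have "v y = \<alpha> p v" if v: "v \<in> TM p" for p v
  proof -
    obtain U f c where U: "open U" "p \<in> U" "f \<in> SF" "\<forall>q\<in>U. y q = f q + c" "\<forall>v\<in>TM p. v f = \<alpha> p v"
      using loc[of p] by blast
    have "v y = v (\<lambda>q. f q + c)"
      by (rule tangent_local[OF v ySF SF_add[OF U(3) SF_const] U(1,2)]) (use U(4) in blast)
    then show ?thesis using tangentD(2)[OF v U(3) SF_const] tangent_const[OF v] U(5) v by simp
  qed
  ultimately show thesis using that by blast
qed

end

section \<open>Smooth functions of two variables\<close>

lemma homeomorphism_map_prod: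
  assumes "homeomorphism U (\<phi> ` U) \<phi> (inv_into U \<phi>)" "homeomorphism V (\<psi> ` V) \<psi> (inv_into V \<psi>)"
  shows "homeomorphism (U \<times> V) (map_prod \<phi> \<psi> ` (U \<times> V)) (map_prod \<phi> \<psi>) (inv_into (U \<times> V) (map_prod \<phi> \<psi>))"
    and "x \<in> U \<Longrightarrow> y \<in> V \<Longrightarrow> inv_into (U \<times> V) (map_prod \<phi> \<psi>) (\<phi> x, \<psi> y) = (x, y)"
proof -
  have inj: "inj_on \<phi> U" "inj_on \<psi> V"
    using homeomorphism_apply1[OF assms(1)] homeomorphism_apply1[OF assms(2)] by (metis inj_onI)+
  have injp: "inj_on (map_prod \<phi> \<psi>) (U \<times> V)" by (rule map_prod_inj_on[OF inj])
  show *: "inv_into (U \<times> V) (map_prod \<phi> \<psi>) (\<phi> x, \<psi> y) = (x, y)" if "x \<in> U" "y \<in> V" for x y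
    using inv_into_f_f[OF injp, of "(x, y)"] that by simp
  have im: "map_prod \<phi> \<psi> ` (U \<times> V) = \<phi> ` U \<times> \<psi> ` V" by (rule map_prod_surj_on) simp_all
  have "continuous_on (U \<times> V) (\<lambda>z. (\<phi> (fst z), \<psi> (snd z)))"
    by (intro continuous_on_Pair continuous_on_compose2[OF homeomorphism_cont1[OF assms(1)]]
        continuous_on_compose2[OF homeomorphism_cont1[OF assms(2)]] continuous_intros) auto
  then have c1: "continuous_on (U \<times> V) (map_prod \<phi> \<psi>)"
    by (simp add: map_prod_def split_beta)
  have "continuous_on (\<phi> ` U \<times> \<psi> ` V) (\<lambda>z. (inv_into U \<phi> (fst z), inv_into V \<psi> (snd z)))"
    by (intro continuous_on_Pair continuous_on_compose2[OF homeomorphism_cont2[OF assms(1)]]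
        continuous_on_compose2[OF homeomorphism_cont2[OF assms(2)]] continuous_intros) auto
  then have c2: "continuous_on (map_prod \<phi> \<psi> ` (U \<times> V)) (inv_into (U \<times> V) (map_prod \<phi> \<psi>))"
    unfolding im
    by (rule continuous_on_eq)
      (auto simp: * homeomorphism_apply1[OF assms(1)] homeomorphism_apply1[OF assms(2)])
  show "homeomorphism (U \<times> V) (map_prod \<phi> \<psi> ` (U \<times> V)) (map_prod \<phi> \<psi>) (inv_into (U \<times> V) (map_prod \<phi> \<psi>))"
    using c1 c2 inv_into_image_cancel[OF injp order_refl] inv_into_f_f[OF injp]
    by (auto simp: homeomorphism_def f_inv_into_f)
qed

lemma partial_derivatives:
  fixes G :: "'a::euclidean_space \<times> 'b::euclidean_space \<Rightarrow> real"
  assumes G: "smooth_on (A \<times> B) G" and s: "s \<in> A" "t \<in> B"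
  shows "((\<lambda>s. G (s, t)) has_derivative (\<lambda>v. frechet_derivative G (at (s, t)) (v, 0))) (at s)"
    and "((\<lambda>t. G (s, t)) has_derivative (\<lambda>w. frechet_derivative G (at (s, t)) (0, w))) (at t)"
proof -
  have D: "(G has_derivative frechet_derivative G (at (s, t))) (at (s, t))"
    by (rule smooth_on_derivative[OF G]) (use s in auto)
  have "((\<lambda>s. (s, t)) has_derivative (\<lambda>v. (v, 0))) (at s)"
    by (auto intro!: derivative_eq_intros)
  from diff_chain_at[OF this D]
  show "((\<lambda>s. G (s, t)) has_derivative (\<lambda>v. frechet_derivative G (at (s, t)) (v, 0))) (at s)"
    by (simp add: o_def)
  have "((\<lambda>t. (s, t)) has_derivative (\<lambda>w. (0, w))) (at t)"
    by (auto intro!: derivative_eq_intros)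
  from diff_chain_at[OF this D]
  show "((\<lambda>t. G (s, t)) has_derivative (\<lambda>w. frechet_derivative G (at (s, t)) (0, w))) (at t)"
    by (simp add: o_def)
qed

lemma smooth_on_slice:
  fixes G :: "'a::euclidean_space \<times> 'b::euclidean_space \<Rightarrow> real"
  assumes "open A" "open B" "smooth_on (A \<times> B) G" "t \<in> B"
  shows "smooth_on A (\<lambda>s. G (s, t))"
proof (rule smooth_on_compose[OF assms(1) _ _ assms(3)])
  show "smooth_on A (\<lambda>s. (s, t))"
    by (rule smooth_onI[OF assms(1), where f'="\<lambda>x v. (v, 0)"]) (auto intro!: derivative_eq_intros)
qed (use assms in \<open>auto intro: open_Times\<close>)

context manifold
begin

text \<open>Smoothness on the product manifold, tested in products of charts, so that tangent
  vectors of the product never have to be considered.\<close>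

definition smooth2 :: "('m \<Rightarrow> 'm \<Rightarrow> real) \<Rightarrow> bool" where
  "smooth2 F \<longleftrightarrow> (\<forall>U \<phi> V \<psi>. (U, \<phi>) \<in> \<A> \<longrightarrow> (V, \<psi>) \<in> \<A> \<longrightarrow>
     smooth_on (\<phi> ` U \<times> \<psi> ` V) (\<lambda>z. F (inv_into U \<phi> (fst z)) (inv_into V \<psi> (snd z))))"

lemma smooth2D:
  "smooth2 F \<Longrightarrow> (U, \<phi>) \<in> \<A> \<Longrightarrow> (V, \<psi>) \<in> \<A> \<Longrightarrow>
    smooth_on (\<phi> ` U \<times> \<psi> ` V) (\<lambda>z. F (inv_into U \<phi> (fst z)) (inv_into V \<psi> (snd z)))"
  by (simp add: smooth2_def)

lemma smooth2_swap:
  assumes "smooth2 F"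
  shows "smooth2 (\<lambda>x y. F y x)"
  unfolding smooth2_def
proof (intro allI impI)
  fix U \<phi> V \<psi> assume U: "(U, \<phi>) \<in> \<A>" and V: "(V, \<psi>) \<in> \<A>"
  have o: "open (\<phi> ` U \<times> \<psi> ` V)" "open (\<psi> ` V \<times> \<phi> ` U)"
    by (intro open_Times chart_facts(2)[OF U] chart_facts(2)[OF V])+
  have "bounded_linear (\<lambda>z::'e \<times> 'e. (snd z, fst z))"
    by (intro bounded_linear_Pair bounded_linear_fst bounded_linear_snd)
  then have "smooth_on (\<phi> ` U \<times> \<psi> ` V) (\<lambda>z. (snd z, fst z))"
    by (rule smooth_on_bounded_linear[OF o(1)])
  from smooth_on_compose[OF o this smooth2D[OF assms V U]]
  show "smooth_on (\<phi> ` U \<times> \<psi> ` V) (\<lambda>z. F (inv_into V \<psi> (snd z)) (inv_into U \<phi> (fst z)))"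
    by (auto simp: image_subset_iff)
qed

lemma smooth2_slice_left:
  assumes F: "smooth2 F"
  shows "(\<lambda>x. F x q) \<in> SF"
proof (rule SF_I)
  fix U \<phi> assume U: "(U, \<phi>) \<in> \<A>"
  obtain V \<psi> where V: "(V, \<psi>) \<in> \<A>" "q \<in> V" by (rule chart_at)
  have "\<psi> q \<in> \<psi> ` V" using V(2) by blast
  from smooth_on_slice[OF chart_facts(2)[OF U] chart_facts(2)[OF V(1)] smooth2D[OF F U V(1)] this]
  show "smooth_on (\<phi> ` U) (\<lambda>s. F (inv_into U \<phi> s) q)"
    by (simp add: chart_inv(1)[OF V])
qed

lemma smooth2_slice_right: "smooth2 F \<Longrightarrow> (\<lambda>y. F p y) \<in> SF"
  using smooth2_slice_left[OF smooth2_swap] .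

text \<open>The second part identifies the partial derivative in product charts; it yields the first
  part and is what \<open>smooth2_commute\<close> differentiates once more.\<close>

lemma smooth2_partial_right:
  assumes F: "smooth2 F" and w: "w \<in> TM q"
  shows "(\<lambda>x. w (\<lambda>y. F x y)) \<in> SF"
    and "(V, \<psi>) \<in> \<A> \<Longrightarrow> q \<in> V \<Longrightarrow> w = dvec V \<psi> q w' \<Longrightarrow> (U, \<phi>) \<in> \<A> \<Longrightarrow> s \<in> \<phi> ` U \<Longrightarrow>
      w (\<lambda>y. F (inv_into U \<phi> s) y) = frechet_derivative
        (\<lambda>z. F (inv_into U \<phi> (fst z)) (inv_into V \<psi> (snd z))) (at (s, \<psi> q)) (0, w')"
proof -
  show *: "w (\<lambda>y. F (inv_into U \<phi> s) y) = frechet_derivative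
        (\<lambda>z. F (inv_into U \<phi> (fst z)) (inv_into V \<psi> (snd z))) (at (s, \<psi> q)) (0, w')"
    if V: "(V, \<psi>) \<in> \<A>" "q \<in> V" and w': "w = dvec V \<psi> q w'" and U: "(U, \<phi>) \<in> \<A>" "s \<in> \<phi> ` U"
    for U V \<phi> \<psi> w' s
  proof -
    have "\<psi> q \<in> \<psi> ` V" using V(2) by blast
    from partial_derivatives(2)[OF smooth2D[OF F U(1) V(1)] U(2) this]
    have "((\<lambda>t. F (inv_into U \<phi> s) (inv_into V \<psi> t)) has_derivative (\<lambda>w. frechet_derivative
        (\<lambda>z. F (inv_into U \<phi> (fst z)) (inv_into V \<psi> (snd z))) (at (s, \<psi> q)) (0, w))) (at (\<psi> q))"
      by simp
    from dvec_eqI[OF smooth2_slice_right[OF F] V this] show ?thesis by (simp add: w')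
  qed
  show "(\<lambda>x. w (\<lambda>y. F x y)) \<in> SF"
  proof (rule SF_I)
    fix U \<phi> assume U: "(U, \<phi>) \<in> \<A>"
    obtain V \<psi> where V: "(V, \<psi>) \<in> \<A>" "q \<in> V" by (rule chart_at)
    obtain w' where w': "w = dvec V \<psi> q w'" by (rule tangent_eq_dvec[OF V w])
    have q: "\<psi> q \<in> \<psi> ` V" using V(2) by blast
    from smooth_on_slice[OF chart_facts(2)[OF U] chart_facts(2)[OF V(1)]
        smooth_on_frechet_derivative[OF smooth2D[OF F U V(1)]] q]
    show "smooth_on (\<phi> ` U) (\<lambda>s. w (\<lambda>y. F (inv_into U \<phi> s) y))"
      by (subst smooth_on_cong[OF chart_facts(2)[OF U] *[OF V w' U]])
  qed
qed

lemma smooth2_partial_left: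
  assumes "smooth2 F" "v \<in> TM p"
  shows "(\<lambda>y. v (\<lambda>x. F x y)) \<in> SF"
  using smooth2_partial_right(1)[OF smooth2_swap[OF assms(1)] assms(2)] .

text \<open>In product charts both sides are second derivatives of one function in the directions
  (v', 0) and (0, w').\<close>

lemma smooth2_commute:
  assumes F: "smooth2 F" and v: "v \<in> TM p" and w: "w \<in> TM q"
  shows "v (\<lambda>x. w (\<lambda>y. F x y)) = w (\<lambda>y. v (\<lambda>x. F x y))"
proof -
  obtain U \<phi> where U: "(U, \<phi>) \<in> \<A>" "p \<in> U" by (rule chart_at)
  obtain V \<psi> where V: "(V, \<psi>) \<in> \<A>" "q \<in> V" by (rule chart_at)
  obtain v' where v': "v = dvec U \<phi> p v'" by (rule tangent_eq_dvec[OF U v])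
  obtain w' where w': "w = dvec V \<psi> q w'" by (rule tangent_eq_dvec[OF V w])
  have pq: "\<phi> p \<in> \<phi> ` U" "\<psi> q \<in> \<psi> ` V" using U(2) V(2) by auto
  define G where "G = (\<lambda>z. F (inv_into U \<phi> (fst z)) (inv_into V \<psi> (snd z)))"
  have G: "smooth_on (\<phi> ` U \<times> \<psi> ` V) G" unfolding G_def by (rule smooth2D[OF F U(1) V(1)])
  have oG: "open (\<phi> ` U \<times> \<psi> ` V)" by (intro open_Times chart_facts(2)[OF U(1)] chart_facts(2)[OF V(1)])
  have 1: "v (\<lambda>x. w (\<lambda>y. F x y)) =
    frechet_derivative (\<lambda>z. frechet_derivative G (at z) (0, w')) (at (\<phi> p, \<psi> q)) (v', 0)"
  proof -
    have "((\<lambda>s. w (\<lambda>y. F (inv_into U \<phi> s) y)) has_derivative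
      (\<lambda>v. frechet_derivative (\<lambda>z. frechet_derivative G (at z) (0, w')) (at (\<phi> p, \<psi> q)) (v, 0))) (at (\<phi> p))"
      by (rule has_derivative_transform_within_open[OF
            partial_derivatives(1)[OF smooth_on_frechet_derivative[OF G] pq] chart_facts(2)[OF U(1)] pq(1)])
        (simp add: smooth2_partial_right(2)[OF F w V w' U(1)] G_def)
    from dvec_eqI[OF smooth2_partial_right(1)[OF F w] U this] show ?thesis by (simp add: v')
  qed
  have 2: "w (\<lambda>y. v (\<lambda>x. F x y)) =
    frechet_derivative (\<lambda>z. frechet_derivative G (at z) (v', 0)) (at (\<phi> p, \<psi> q)) (0, w')"
  proof -
    have sl: "v (\<lambda>x. F x (inv_into V \<psi> t)) = frechet_derivative G (at (\<phi> p, t)) (v', 0)" if t: "t \<in> \<psi> ` V" for t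
    proof -
      have "((\<lambda>s. F (inv_into U \<phi> s) (inv_into V \<psi> t)) has_derivative
        (\<lambda>v. frechet_derivative G (at (\<phi> p, t)) (v, 0))) (at (\<phi> p))"
        using partial_derivatives(1)[OF G pq(1) t] by (simp add: G_def)
      from dvec_eqI[OF smooth2_slice_left[OF F] U this] show ?thesis by (simp add: v')
    qed
    have "((\<lambda>t. v (\<lambda>x. F x (inv_into V \<psi> t))) has_derivative
      (\<lambda>w. frechet_derivative (\<lambda>z. frechet_derivative G (at z) (v', 0)) (at (\<phi> p, \<psi> q)) (0, w))) (at (\<psi> q))"
      by (rule has_derivative_transform_within_open[OF
            partial_derivatives(2)[OF smooth_on_frechet_derivative[OF G] pq] chart_facts(2)[OF V(1)] pq(2)])
        (simp add: sl)
    from dvec_eqI[OF smooth2_partial_left[OF F v] V this] show ?thesis by (simp add: w')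
  qed
  show ?thesis
    unfolding 1 2 using pq by (intro smooth_on_derivatives_commute[OF oG _ G]) auto
qed

section \<open>Pushforward\<close>

lemma pushforward_tangent:
  assumes "\<And>f. f \<in> SF \<Longrightarrow> f \<circ> F \<in> SF" and v: "v \<in> TM p"
  shows "pushforward \<A> F v \<in> TM (F p)"
proof -
  have *: "(\<lambda>x. f (F x)) \<in> SF" if "f \<in> SF" for f using assms(1)[OF that] by (simp add: o_def)
  note t = tangentD[OF v]
  have "pushforward \<A> F v f = 0" if "f \<notin> SF" for f
    using that by (simp add: pushforward_def)
  moreover have "pushforward \<A> F v (\<lambda>x. f x + h x) = pushforward \<A> F v f + pushforward \<A> F v h"
    if "f \<in> SF" "h \<in> SF" for f h
    using that t(2)[OF * *] SF_add by (simp add: pushforward_def o_def)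
  moreover have "pushforward \<A> F v (\<lambda>x. c * f x) = c * pushforward \<A> F v f" if "f \<in> SF" for f c
    using that t(3)[OF *] SF_cmult by (simp add: pushforward_def o_def)
  moreover have "pushforward \<A> F v (\<lambda>x. f x * h x) = f (F p) * pushforward \<A> F v h + h (F p) * pushforward \<A> F v f"
    if "f \<in> SF" "h \<in> SF" for f h
    using that t(4)[OF * *] SF_mult by (simp add: pushforward_def o_def)
  ultimately show ?thesis unfolding tangent_space_def by blast
qed

lemma pushforward_compose:
  assumes "\<And>f. f \<in> SF \<Longrightarrow> f \<circ> G \<in> SF"
  shows "pushforward \<A> G (pushforward \<A> F v) = pushforward \<A> (G \<circ> F) v"
  using assms by (auto simp: pushforward_def o_assoc)

lemma pushforward_id: "v \<in> TM p \<Longrightarrow> pushforward \<A> (\<lambda>x. x) v = v"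
  using tangentD(1) by (auto simp: pushforward_def o_def)

lemma pushforward_sum:
  "pushforward \<A> F (\<lambda>f. \<Sum>i\<in>I. c i * v i f) = (\<lambda>f. \<Sum>i\<in>I. c i * pushforward \<A> F (v i) f)"
  by (auto simp: pushforward_def)

end

section \<open>Invariant vector fields on Lie groups\<close>

locale lie_group_manifold =
  fixes mul :: "'m::{t2_space,second_countable_topology} \<Rightarrow> 'm \<Rightarrow> 'm"
    and e :: 'm and \<iota> :: "'m \<Rightarrow> 'm" and \<A> :: "('m, 'e::euclidean_space) chart set"
  assumes lie_group: "lie_group mul e \<iota> \<A>"

sublocale lie_group_manifold \<subseteq> manifold \<A>
  using lie_group by unfold_locales (simp add: lie_group_def)

sublocale lie_group_manifold \<subseteq> G: Groups.group mul e \<iota>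
  using lie_group by (simp add: lie_group_def)

context lie_group_manifold
begin

lemma smooth2_mul:
  assumes f: "f \<in> SF"
  shows "smooth2 (\<lambda>x y. f (mul x y))"
  unfolding smooth2_def
proof (intro allI impI)
  fix U \<phi> V \<psi> assume U: "(U, \<phi>) \<in> \<A>" and V: "(V, \<psi>) \<in> \<A>"
  have im: "map_prod \<phi> \<psi> ` (U \<times> V) = \<phi> ` U \<times> \<psi> ` V" for U V \<phi> \<psi> by (rule map_prod_surj_on) simp_all
  have m: "smooth_map (prod_atlas \<A> \<A>) \<A> (\<lambda>(x, y). mul x y)" using lie_group by (simp add: lie_group_def)
  have P: "open W \<and> open (\<eta> ` W) \<and> homeomorphism W (\<eta> ` W) \<eta> (inv_into W \<eta>)"
    if "(W, \<eta>) \<in> prod_atlas \<A> \<A>" for W \<eta>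
  proof -
    from that obtain U \<phi> V \<psi> where W: "W = U \<times> V" "\<eta> = map_prod \<phi> \<psi>" "(U, \<phi>) \<in> \<A>" "(V, \<psi>) \<in> \<A>"
      unfolding prod_atlas_def by blast
    show ?thesis
      using homeomorphism_map_prod(1)[OF chart_facts(3)[OF W(3)] chart_facts(3)[OF W(4)]]
        chart_facts(1,2)[OF W(3)] chart_facts(1,2)[OF W(4)]
      unfolding W(1,2) im by (simp add: open_Times)
  qed
  have "(U \<times> V, map_prod \<phi> \<psi>) \<in> prod_atlas \<A> \<A>" unfolding prod_atlas_def using U V by blast
  from smooth_map_compose_function[OF P atlas m f this]
  have s: "smooth_on (\<phi> ` U \<times> \<psi> ` V) (\<lambda>z. f (case inv_into (U \<times> V) (map_prod \<phi> \<psi>) z of (x, y) \<Rightarrow> mul x y))"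
    unfolding im .
  show "smooth_on (\<phi> ` U \<times> \<psi> ` V) (\<lambda>z. f (mul (inv_into U \<phi> (fst z)) (inv_into V \<psi> (snd z))))"
  proof (rule smooth_on_cong[THEN iffD1, OF _ _ s])
    show "open (\<phi> ` U \<times> \<psi> ` V)" by (intro open_Times chart_facts(2)[OF U] chart_facts(2)[OF V])
    show "f (case inv_into (U \<times> V) (map_prod \<phi> \<psi>) z of (x, y) \<Rightarrow> mul x y) =
      f (mul (inv_into U \<phi> (fst z)) (inv_into V \<psi> (snd z)))" if "z \<in> \<phi> ` U \<times> \<psi> ` V" for z
      using that homeomorphism_map_prod(2)[OF chart_facts(3)[OF U] chart_facts(3)[OF V]]
      by (auto simp: chart_inv(1)[OF U] chart_inv(1)[OF V])
  qed
qed

lemma SF_inverse: "f \<in> SF \<Longrightarrow> (\<lambda>x. f (\<iota> x)) \<in> SF"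
  using smooth_map_compose_function[OF _ atlas, of \<A> \<iota> f] chart_facts lie_group
  by (intro SF_I) (auto simp: lie_group_def)

lemma SF_left: "f \<in> SF \<Longrightarrow> f \<circ> mul a \<in> SF"
  using smooth2_slice_right[OF smooth2_mul] by (simp add: o_def)

lemma SF_right: "f \<in> SF \<Longrightarrow> f \<circ> (\<lambda>x. mul x a) \<in> SF"
  using smooth2_slice_left[OF smooth2_mul] by (simp add: o_def)

definition lfield :: "'m tangent \<Rightarrow> 'm vfield" where
  "lfield v p = pushforward \<A> (mul p) v"

definition rfield :: "'m tangent \<Rightarrow> 'm vfield" where
  "rfield v p = pushforward \<A> (\<lambda>x. mul x p) v"

lemma lfield_VF:
  assumes "v \<in> TM e"
  shows "lfield v \<in> VF"
proof -
  have "lfield v p \<in> TM p" for p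
    using pushforward_tangent[OF SF_left assms] by (simp add: lfield_def)
  moreover have "(\<lambda>p. lfield v p f) \<in> SF" if "f \<in> SF" for f
    using smooth2_partial_right(1)[OF smooth2_mul[OF that] assms] that
    by (simp add: lfield_def pushforward_def o_def)
  ultimately show ?thesis by (simp add: vector_fields_def)
qed

lemma rfield_VF:
  assumes "v \<in> TM e"
  shows "rfield v \<in> VF"
proof -
  have "rfield v p \<in> TM p" for p
    using pushforward_tangent[OF SF_right assms] by (simp add: rfield_def)
  moreover have "(\<lambda>p. rfield v p f) \<in> SF" if "f \<in> SF" for f
    using smooth2_partial_left[OF smooth2_mul[OF that] assms] that
    by (simp add: rfield_def pushforward_def o_def)
  ultimately show ?thesis by (simp add: vector_fields_def)
qed

lemma push_lfield: "pushforward \<A> (mul a) (lfield v p) = lfield v (mul a p)"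
proof -
  have "mul a \<circ> mul p = mul (mul a p)" by (auto simp: G.assoc)
  then show ?thesis unfolding lfield_def by (subst pushforward_compose[OF SF_left]) simp_all
qed

lemma push_rfield: "pushforward \<A> (\<lambda>x. mul x a) (rfield v p) = rfield v (mul p a)"
  unfolding rfield_def by (subst pushforward_compose[OF SF_right]) (simp_all add: o_def G.assoc)

lemma lfield_lie_algebra: "v \<in> TM e \<Longrightarrow> lfield v \<in> lie_algebra mul \<A>"
  unfolding lie_algebra_def by (simp add: lfield_VF push_lfield)

lemma lfield_e: "v \<in> TM e \<Longrightarrow> lfield v e = v"
proof -
  have "mul e = (\<lambda>x. x)" by (auto simp: G.group_left_neutral)
  then show "v \<in> TM e \<Longrightarrow> lfield v e = v" using pushforward_id by (simp add: lfield_def)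
qed

lemma rfield_e: "v \<in> TM e \<Longrightarrow> rfield v e = v"
  using pushforward_id by (simp add: rfield_def)

text \<open>By associativity both iterated derivatives are mixed derivatives of f (x z) at x = e, z
  = p: the right invariant field moves the left factor, the left invariant field the right
  one.\<close>

lemma left_right_fields_commute:
  assumes v: "v \<in> TM e" and w: "w \<in> TM e"
  shows "lie_bracket (lfield w) (rfield v) p = (\<lambda>f. 0)"
proof
  fix f
  show "lie_bracket (lfield w) (rfield v) p f = 0"
  proof (cases "f \<in> SF")
    case True
    have w': "lfield w p \<in> TM p" by (rule vector_fieldD(1)[OF lfield_VF[OF w]])
    note F = smooth2_mul[OF True]
    have "rfield v p (\<lambda>q. lfield w q f) = v (\<lambda>x. lfield w p (\<lambda>z. f (mul x z)))"
    proof -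
      have "(\<lambda>q. lfield w q f) \<in> SF" by (rule vector_fieldD(2)[OF lfield_VF[OF w] True])
      moreover have "lfield w (mul x p) f = lfield w p (\<lambda>z. f (mul x z))" for x
        using True smooth2_slice_right[OF F] by (simp add: lfield_def pushforward_def o_def G.assoc)
      ultimately show ?thesis by (simp add: rfield_def pushforward_def o_def)
    qed
    also have "\<dots> = lfield w p (\<lambda>z. v (\<lambda>x. f (mul x z)))"
      by (rule smooth2_commute[OF F v w'])
    also have "\<dots> = lfield w p (\<lambda>q. rfield v q f)"
      using True by (simp add: rfield_def pushforward_def o_def)
    finally show ?thesis by (simp add: lie_bracket_def)
  next
    case False
    then show ?thesis
      using tangentD(1)[OF lie_bracket_tangent[OF lfield_VF[OF w] rfield_VF[OF v]] False] by simp
  qed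
qed

end

section \<open>Tensoriality\<close>

context manifold
begin

lemma symmetric_tensorD:
  assumes "B \<in> symmetric_tensors \<A>"
  shows "v \<in> TM p \<Longrightarrow> w \<in> TM p \<Longrightarrow> B p v w = B p w v"
    and "u \<in> TM p \<Longrightarrow> v \<in> TM p \<Longrightarrow> w \<in> TM p \<Longrightarrow> B p (\<lambda>f. u f + v f) w = B p u w + B p v w"
    and "v \<in> TM p \<Longrightarrow> w \<in> TM p \<Longrightarrow> B p (\<lambda>f. c * v f) w = c * B p v w"
    and "X \<in> VF \<Longrightarrow> Y \<in> VF \<Longrightarrow> (\<lambda>p. B p (X p) (Y p)) \<in> SF"
proof -
  note b = assms[unfolded symmetric_tensors_def mem_Collect_eq]
  show "v \<in> TM p \<Longrightarrow> w \<in> TM p \<Longrightarrow> B p v w = B p w v"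
    by (rule bspec[OF bspec[OF spec[OF conjunct1[OF conjunct2[OF b]]]]])
  show "u \<in> TM p \<Longrightarrow> v \<in> TM p \<Longrightarrow> w \<in> TM p \<Longrightarrow> B p (\<lambda>f. u f + v f) w = B p u w + B p v w"
    by (rule bspec[OF bspec[OF bspec[OF spec[OF conjunct1[OF conjunct2[OF conjunct2[OF b]]]]]]])
  show "v \<in> TM p \<Longrightarrow> w \<in> TM p \<Longrightarrow> B p (\<lambda>f. c * v f) w = c * B p v w"
    by (rule bspec[OF bspec[OF spec[OF spec[OF conjunct1[OF conjunct2[OF conjunct2[OF conjunct2[OF b]]]]]]]])
  show "X \<in> VF \<Longrightarrow> Y \<in> VF \<Longrightarrow> (\<lambda>p. B p (X p) (Y p)) \<in> SF"
    by (rule bspec[OF bspec[OF conjunct2[OF conjunct2[OF conjunct2[OF conjunct2[OF b]]]]]])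
qed

lemma tensor_sum_left:
  assumes B: "B \<in> symmetric_tensors \<A>" and "\<And>i. i \<in> I \<Longrightarrow> v i \<in> TM p" and w: "w \<in> TM p"
  shows "B p (\<lambda>f. \<Sum>i\<in>I. c i * v i f) w = (\<Sum>i\<in>I. c i * B p (v i) w)"
  by (rule tangent_linear_sum[where l="\<lambda>v. B p v w", OF symmetric_tensorD(2)[OF B _ _ w]
      symmetric_tensorD(3)[OF B _ w] assms(2)])

lemma tensor_sum_right:
  assumes B: "B \<in> symmetric_tensors \<A>" and v: "\<And>i. i \<in> I \<Longrightarrow> v i \<in> TM p" and w: "w \<in> TM p"
  shows "B p w (\<lambda>f. \<Sum>i\<in>I. c i * v i f) = (\<Sum>i\<in>I. c i * B p w (v i))"
proof -
  have "B p w (\<lambda>f. \<Sum>i\<in>I. c i * v i f) = B p (\<lambda>f. \<Sum>i\<in>I. c i * v i f) w"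
    by (rule symmetric_tensorD(1)[OF B w tangent_lincomb[OF v]])
  also have "\<dots> = (\<Sum>i\<in>I. c i * B p (v i) w)" by (rule tensor_sum_left[OF B v w])
  also have "\<dots> = (\<Sum>i\<in>I. c i * B p w (v i))"
    using symmetric_tensorD(1)[OF B v w] by simp
  finally show ?thesis .
qed

lemma tensor_one_form:
  assumes B: "B \<in> symmetric_tensors \<A>" and X: "X \<in> VF"
  shows "one_form (\<lambda>p v. B p (X p) v)"
proof -
  note x = vector_fieldD(1)[OF X]
  note s = symmetric_tensorD(1)[OF B x]
  have "B p (X p) (\<lambda>f. v f + w f) = B p (X p) v + B p (X p) w" if "v \<in> TM p" "w \<in> TM p" for p v w
    using that by (simp add: s tangent_add symmetric_tensorD(2)[OF B _ _ x])
  moreover have "B p (X p) (\<lambda>f. c * v f) = c * B p (X p) v" if "v \<in> TM p" for p v c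
    using that by (simp add: s tangent_cmult symmetric_tensorD(3)[OF B _ x])
  moreover have "(\<lambda>p. B p (X p) (Y p)) \<in> SF" if "Y \<in> VF" for Y
    by (rule symmetric_tensorD(4)[OF B X that])
  ultimately show ?thesis unfolding one_form_def by blast
qed

lemma one_form_lincomb:
  assumes \<theta>: "\<And>i. i \<in> I \<Longrightarrow> one_form (\<theta> i)" and c: "\<And>i. i \<in> I \<Longrightarrow> c i \<in> SF"
  shows "one_form (\<lambda>p v. \<Sum>i\<in>I. \<theta> i p v * c i p)"
proof -
  have "(\<Sum>i\<in>I. \<theta> i p (\<lambda>f. v f + w f) * c i p) = (\<Sum>i\<in>I. \<theta> i p v * c i p) + (\<Sum>i\<in>I. \<theta> i p w * c i p)"
    if "v \<in> TM p" "w \<in> TM p" for p v w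
    using one_formD(1)[OF \<theta> that] by (simp add: sum.distrib distrib_right)
  moreover have "(\<Sum>i\<in>I. \<theta> i p (\<lambda>f. d * v f) * c i p) = d * (\<Sum>i\<in>I. \<theta> i p v * c i p)"
    if "v \<in> TM p" for p v d
    using one_formD(2)[OF \<theta> that] by (simp add: sum_distrib_left mult.assoc)
  moreover have "(\<lambda>p. \<Sum>i\<in>I. \<theta> i p (Y p) * c i p) \<in> SF" if "Y \<in> VF" for Y
    by (rule SF_sum, rule SF_mult) (rule one_formD(3)[OF \<theta> that] c, assumption)+
  ultimately show ?thesis unfolding one_form_def by blast
qed

section \<open>Linearity over functions\<close>

lemma lie_bracket_sum_right:
  assumes X: "X \<in> VF" and c: "\<And>i. i \<in> I \<Longrightarrow> c i \<in> SF" and Y: "\<And>i. i \<in> I \<Longrightarrow> Y i \<in> VF"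
  shows "lie_bracket X (\<lambda>p f. \<Sum>i\<in>I. c i p * Y i p f) p =
    (\<lambda>f. (\<Sum>i\<in>I. X p (c i) * Y i p f) + (\<Sum>i\<in>I. c i p * lie_bracket X (Y i) p f))"
proof
  fix f
  note x = vector_fieldD(1)[OF X, of p]
  have sf: "i \<in> I \<Longrightarrow> (\<lambda>q. Y i q f) \<in> SF" for i by (rule vector_field_SF[OF Y])
  have "X p (\<lambda>q. \<Sum>i\<in>I. c i q * Y i q f) = (\<Sum>i\<in>I. X p (\<lambda>q. c i q * Y i q f))"
    by (rule tangent_sum[OF x SF_mult[OF c sf]])
  also have "\<dots> = (\<Sum>i\<in>I. c i p * X p (\<lambda>q. Y i q f) + Y i p f * X p (c i))"
    by (rule sum.cong[OF refl]) (rule tangentD(4)[OF x c sf])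
  finally show "lie_bracket X (\<lambda>p f. \<Sum>i\<in>I. c i p * Y i p f) p f =
    (\<Sum>i\<in>I. X p (c i) * Y i p f) + (\<Sum>i\<in>I. c i p * lie_bracket X (Y i) p f)"
    by (simp add: lie_bracket_def sum.distrib right_diff_distrib sum_subtractf mult.commute)
qed

lemma lie_bracket_swap: "lie_bracket Y X p = (\<lambda>f. (-1) * lie_bracket X Y p f)"
  by (auto simp: lie_bracket_def)

definition closed_defect :: "('m \<Rightarrow> 'm tangent \<Rightarrow> real) \<Rightarrow> 'm vfield \<Rightarrow> 'm vfield \<Rightarrow> 'm \<Rightarrow> real" where
  "closed_defect \<alpha> X Y p =
     X p (\<lambda>q. \<alpha> q (Y q)) - Y p (\<lambda>q. \<alpha> q (X q)) - \<alpha> p (lie_bracket X Y p)"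

lemma closed_defect_swap:
  assumes "one_form \<alpha>" "X \<in> VF" "Y \<in> VF"
  shows "closed_defect \<alpha> Y X p = - closed_defect \<alpha> X Y p"
  unfolding closed_defect_def lie_bracket_swap[of Y X]
  using one_formD(2)[OF assms(1) lie_bracket_tangent[OF assms(2,3)], of p "-1"] by simp

text \<open>The defect is d\<alpha>(X, Y). Leibniz's rule produces terms X(c_i) \<alpha>(Y_i) both
  in X(\<alpha>(Y)) and in \<alpha>([X, Y]), and they cancel.\<close>

lemma closed_defect_sum:
  assumes \<alpha>: "one_form \<alpha>" and X: "X \<in> VF"
    and c: "\<And>i. i \<in> I \<Longrightarrow> c i \<in> SF" and Y: "\<And>i. i \<in> I \<Longrightarrow> Y i \<in> VF"
  shows "closed_defect \<alpha> X (\<lambda>p f. \<Sum>i\<in>I. c i p * Y i p f) p = (\<Sum>i\<in>I. c i p * closed_defect \<alpha> X (Y i) p)"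
proof -
  note x = vector_fieldD(1)[OF X, of p] and y = vector_fieldD(1)[OF Y]
  have sf: "i \<in> I \<Longrightarrow> (\<lambda>q. \<alpha> q (Y i q)) \<in> SF" for i by (rule one_formD(3)[OF \<alpha> Y])
  have "X p (\<lambda>q. \<alpha> q (\<lambda>f. \<Sum>i\<in>I. c i q * Y i q f)) = X p (\<lambda>q. \<Sum>i\<in>I. c i q * \<alpha> q (Y i q))"
    by (subst one_form_sum[OF \<alpha> y]) simp_all
  also have "\<dots> = (\<Sum>i\<in>I. X p (\<lambda>q. c i q * \<alpha> q (Y i q)))"
    by (rule tangent_sum[OF x SF_mult[OF c sf]])
  also have "\<dots> = (\<Sum>i\<in>I. c i p * X p (\<lambda>q. \<alpha> q (Y i q)) + \<alpha> p (Y i p) * X p (c i))"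
    by (rule sum.cong[OF refl]) (rule tangentD(4)[OF x c sf])
  finally have 1: "X p (\<lambda>q. \<alpha> q (\<lambda>f. \<Sum>i\<in>I. c i q * Y i q f)) =
      (\<Sum>i\<in>I. c i p * X p (\<lambda>q. \<alpha> q (Y i q)) + \<alpha> p (Y i p) * X p (c i))" .
  have br: "lie_bracket X (\<lambda>p f. \<Sum>i\<in>I. c i p * Y i p f) p =
      (\<lambda>f. (\<Sum>i\<in>I. X p (c i) * Y i p f) + (\<Sum>i\<in>I. c i p * lie_bracket X (Y i) p f))"
    by (rule lie_bracket_sum_right[OF X c Y])
  have "\<alpha> p (lie_bracket X (\<lambda>p f. \<Sum>i\<in>I. c i p * Y i p f) p) =
      \<alpha> p (\<lambda>f. \<Sum>i\<in>I. X p (c i) * Y i p f) + \<alpha> p (\<lambda>f. \<Sum>i\<in>I. c i p * lie_bracket X (Y i) p f)"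
    unfolding br
    by (intro one_formD(1)[OF \<alpha>] tangent_lincomb y lie_bracket_tangent[OF X Y])
  also have "\<dots> = (\<Sum>i\<in>I. X p (c i) * \<alpha> p (Y i p)) + (\<Sum>i\<in>I. c i p * \<alpha> p (lie_bracket X (Y i) p))"
    by (rule arg_cong2[where f="(+)"], rule one_form_sum[OF \<alpha> y], assumption,
        rule one_form_sum[OF \<alpha> lie_bracket_tangent[OF X Y]])
  finally show ?thesis
    unfolding closed_defect_def 1
    by (simp add: sum.distrib right_diff_distrib sum_subtractf mult.commute)
qed

text \<open>\<open>closed_defect\<close> is antisymmetric and linear over functions in its second
  slot, so its values on pairs of frame fields decide. This lets the derivation property, which
  speaks of left invariant fields, give closedness.\<close>

lemma closed_form_frameI:
  assumes \<alpha>: "one_form \<alpha>" and E: "\<And>i. i \<in> I \<Longrightarrow> E i \<in> VF"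
    and frame: "\<And>Y. Y \<in> VF \<Longrightarrow> \<exists>c. (\<forall>i\<in>I. c i \<in> SF) \<and> Y = (\<lambda>p f. \<Sum>i\<in>I. c i p * E i p f)"
    and closed: "\<And>i j p. i \<in> I \<Longrightarrow> j \<in> I \<Longrightarrow>
      E i p (\<lambda>q. \<alpha> q (E j q)) - E j p (\<lambda>q. \<alpha> q (E i q)) = \<alpha> p (lie_bracket (E i) (E j) p)"
  shows "closed_form \<alpha>"
proof -
  have 1: "closed_defect \<alpha> (E i) Y p = 0" if i: "i \<in> I" and Y: "Y \<in> VF" for i Y p
  proof -
    obtain c where c: "\<forall>i\<in>I. c i \<in> SF" "Y = (\<lambda>p f. \<Sum>i\<in>I. c i p * E i p f)" using frame[OF Y] by blast
    have "closed_defect \<alpha> (E i) Y p = (\<Sum>j\<in>I. c j p * closed_defect \<alpha> (E i) (E j) p)"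
      unfolding c(2) using c(1) by (intro closed_defect_sum[OF \<alpha> E[OF i]] E) auto
    then show ?thesis using closed[OF i] by (simp add: closed_defect_def)
  qed
  have "closed_defect \<alpha> X Y p = 0" if X: "X \<in> VF" and Y: "Y \<in> VF" for X Y p
  proof -
    obtain c where c: "\<forall>i\<in>I. c i \<in> SF" "Y = (\<lambda>p f. \<Sum>i\<in>I. c i p * E i p f)" using frame[OF Y] by blast
    have "closed_defect \<alpha> X Y p = (\<Sum>j\<in>I. c j p * closed_defect \<alpha> X (E j) p)"
      unfolding c(2) using c(1) by (intro closed_defect_sum[OF \<alpha> X] E) auto
    moreover have "closed_defect \<alpha> X (E j) p = 0" if "j \<in> I" for j
      using closed_defect_swap[OF \<alpha> E[OF that] X] 1[OF that X] by simp
    ultimately show ?thesis by simp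
  qed
  then show ?thesis unfolding closed_form_def closed_defect_def by simp
qed

text \<open>As for \<open>closed_defect\<close>, the terms that differentiate the coefficients
  cancel.\<close>

lemma lie_derivative_sum:
  assumes B: "B \<in> symmetric_tensors \<A>" and X: "X \<in> VF" and Z: "Z \<in> VF"
    and c: "\<And>i. i \<in> I \<Longrightarrow> c i \<in> SF" and Y: "\<And>i. i \<in> I \<Longrightarrow> Y i \<in> VF"
  shows "lie_derivative X B (\<lambda>p f. \<Sum>i\<in>I. c i p * Y i p f) Z p = (\<Sum>i\<in>I. c i p * lie_derivative X B (Y i) Z p)"
proof -
  note x = vector_fieldD(1)[OF X, of p] and y = vector_fieldD(1)[OF Y] and z = vector_fieldD(1)[OF Z]
  have sf: "i \<in> I \<Longrightarrow> (\<lambda>q. B q (Y i q) (Z q)) \<in> SF" for i by (rule symmetric_tensorD(4)[OF B Y Z])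
  have "X p (\<lambda>q. B q (\<lambda>f. \<Sum>i\<in>I. c i q * Y i q f) (Z q)) = X p (\<lambda>q. \<Sum>i\<in>I. c i q * B q (Y i q) (Z q))"
    by (subst tensor_sum_left[OF B y z]) simp_all
  also have "\<dots> = (\<Sum>i\<in>I. X p (\<lambda>q. c i q * B q (Y i q) (Z q)))"
    by (rule tangent_sum[OF x SF_mult[OF c sf]])
  also have "\<dots> = (\<Sum>i\<in>I. c i p * X p (\<lambda>q. B q (Y i q) (Z q)) + B p (Y i p) (Z p) * X p (c i))"
    by (rule sum.cong[OF refl]) (rule tangentD(4)[OF x c sf])
  finally have 1: "X p (\<lambda>q. B q (\<lambda>f. \<Sum>i\<in>I. c i q * Y i q f) (Z q)) =
      (\<Sum>i\<in>I. c i p * X p (\<lambda>q. B q (Y i q) (Z q)) + B p (Y i p) (Z p) * X p (c i))" .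
  have br: "lie_bracket X (\<lambda>p f. \<Sum>i\<in>I. c i p * Y i p f) p =
      (\<lambda>f. (\<Sum>i\<in>I. X p (c i) * Y i p f) + (\<Sum>i\<in>I. c i p * lie_bracket X (Y i) p f))"
    by (rule lie_bracket_sum_right[OF X c Y])
  have "B p (lie_bracket X (\<lambda>p f. \<Sum>i\<in>I. c i p * Y i p f) p) (Z p) =
      B p (\<lambda>f. \<Sum>i\<in>I. X p (c i) * Y i p f) (Z p) + B p (\<lambda>f. \<Sum>i\<in>I. c i p * lie_bracket X (Y i) p f) (Z p)"
    unfolding br
    by (intro symmetric_tensorD(2)[OF B] tangent_lincomb y z lie_bracket_tangent[OF X Y])
  also have "\<dots> = (\<Sum>i\<in>I. X p (c i) * B p (Y i p) (Z p)) + (\<Sum>i\<in>I. c i p * B p (lie_bracket X (Y i) p) (Z p))"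
    by (rule arg_cong2[where f="(+)"], rule tensor_sum_left[OF B y z], assumption,
        rule tensor_sum_left[OF B lie_bracket_tangent[OF X Y] z])
  finally have 2: "B p (lie_bracket X (\<lambda>p f. \<Sum>i\<in>I. c i p * Y i p f) p) (Z p) =
    (\<Sum>i\<in>I. X p (c i) * B p (Y i p) (Z p)) + (\<Sum>i\<in>I. c i p * B p (lie_bracket X (Y i) p) (Z p))" .
  have 3: "B p (\<lambda>f. \<Sum>i\<in>I. c i p * Y i p f) (lie_bracket X Z p) = (\<Sum>i\<in>I. c i p * B p (Y i p) (lie_bracket X Z p))"
    by (rule tensor_sum_left[OF B y lie_bracket_tangent[OF X Z]])
  show ?thesis
    unfolding lie_derivative_def 1 2 3
    by (simp add: sum.distrib right_diff_distrib sum_subtractf mult.commute)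
qed

lemma lie_derivative_swap:
  assumes B: "B \<in> symmetric_tensors \<A>" and X: "X \<in> VF" and Y: "Y \<in> VF" and Z: "Z \<in> VF"
  shows "lie_derivative X B Y Z p = lie_derivative X B Z Y p"
  unfolding lie_derivative_def
  using symmetric_tensorD(1)[OF B vector_fieldD(1)[OF Y] vector_fieldD(1)[OF Z]]
    symmetric_tensorD(1)[OF B vector_fieldD(1)[OF Y] lie_bracket_tangent[OF X Z]]
    symmetric_tensorD(1)[OF B lie_bracket_tangent[OF X Y] vector_fieldD(1)[OF Z]]
  by simp

section \<open>Nondegeneracy of the metric and dual bases\<close>

lemma metric_nondegenerate:
  assumes g: "g \<in> riemannian_metrics \<A>" and v: "v \<in> TM p" and w: "w \<in> TM p"
    and eq: "\<And>u. u \<in> TM p \<Longrightarrow> g p v u = g p w u"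
  shows "v = w"
proof (rule ccontr)
  assume "v \<noteq> w"
  have B: "g \<in> symmetric_tensors \<A>" using g by (simp add: riemannian_metrics_def)
  have w': "(\<lambda>f. (-1) * w f) \<in> TM p" by (rule tangent_cmult[OF w])
  let ?d = "\<lambda>f. v f + (-1) * w f"
  have d: "?d \<in> TM p" by (rule tangent_add[OF v w'])
  have "?d \<noteq> (\<lambda>f. 0)" using \<open>v \<noteq> w\<close> by (auto simp: fun_eq_iff)
  then have "g p ?d ?d > 0" using g d unfolding riemannian_metrics_def by blast
  moreover have "g p ?d ?d = 0"
    using symmetric_tensorD(2)[OF B v w' d] symmetric_tensorD(3)[OF B w d, of "-1"] eq[OF d] by simp
  ultimately show False by simp
qed

text \<open>The Gram map \<open>\<Phi>\<close> of a coordinate basis is injective by positive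
  definiteness, hence surjective; the preimages of the standard basis give the dual vectors. A dual
  pair of bases takes the place of an orthonormal basis.\<close>

lemma dual_basis_exists:
  assumes g: "g \<in> riemannian_metrics \<A>"
  obtains \<epsilon> \<delta> :: "'e \<Rightarrow> 'm tangent" where "\<And>i. \<epsilon> i \<in> TM p" "\<And>i. \<delta> i \<in> TM p"
    "\<And>i j. i \<in> Basis \<Longrightarrow> j \<in> Basis \<Longrightarrow> g p (\<delta> i) (\<epsilon> j) = (if i = j then 1 else 0)"
    "\<And>v. v \<in> TM p \<Longrightarrow> v = (\<lambda>f. \<Sum>i\<in>Basis. g p (\<delta> i) v * \<epsilon> i f)"
proof -
  have B: "g \<in> symmetric_tensors \<A>" using g by (simp add: riemannian_metrics_def)
  obtain U \<phi> where U: "(U, \<phi>) \<in> \<A>" "p \<in> U" by (rule chart_at)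
  let ?d = "dvec U \<phi> p"
  note d = dvec_tangent[OF U]
  have exp: "g p v (?d w) = (\<Sum>b\<in>Basis. (w \<bullet> b) * g p v (?d b))" if "v \<in> TM p" for v w
    by (subst dvec_Basis_sum[OF U]) (rule tensor_sum_right[OF B d that])
  define \<Phi> where "\<Phi> = (\<lambda>w. \<Sum>i\<in>Basis. (\<Sum>b\<in>Basis. (w \<bullet> b) * g p (?d i) (?d b)) *\<^sub>R i)"
  have \<Phi>: "\<Phi> w \<bullet> i = g p (?d w) (?d i)" if "i \<in> Basis" for w i
    using that exp[OF d, of i w] symmetric_tensorD(1)[OF B d d, of i w]
    by (simp add: \<Phi>_def inner_sum_left inner_Basis if_distrib sum.delta cong: if_cong)
  have lin: "linear \<Phi>"
    unfolding \<Phi>_def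
    by (rule linearI)
      (simp_all add: inner_add_left distrib_right sum.distrib scaleR_left_distrib scaleR_right.sum
        sum_distrib_left mult.assoc)
  have "inj \<Phi>"
    unfolding linear_injective_0[OF lin]
  proof (intro allI impI)
    fix w assume w: "\<Phi> w = 0"
    have "g p (?d w) (?d w) = (\<Sum>b\<in>Basis. (w \<bullet> b) * g p (?d w) (?d b))" by (rule exp[OF d])
    also have "\<dots> = 0" using \<Phi>[of _ w] w by (intro sum.neutral) auto
    finally have "?d w = (\<lambda>f. 0)" using g d[of w] unfolding riemannian_metrics_def by fastforce
    moreover have "?d 0 = (\<lambda>f. 0)" by (subst dvec_Basis_sum[OF U]) simp
    ultimately show "w = 0" using dvec_inj[OF U] by metis
  qed
  then have "surj \<Phi>" by (rule linear_inj_imp_surj[OF lin])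
  then obtain u where u: "\<And>i. \<Phi> (u i) = i" by (metis surjD)
  have dual: "g p (?d (u i)) (?d j) = (if i = j then 1 else 0)" if "i \<in> Basis" "j \<in> Basis" for i j
    using \<Phi>[OF that(2), of "u i"] that by (simp add: u inner_Basis)
  show thesis
  proof (rule that[of ?d "\<lambda>i. ?d (u i)", OF d d dual])
    fix v assume "v \<in> TM p"
    then obtain w where w: "v = ?d w" by (rule tangent_eq_dvec[OF U])
    have "g p (?d (u i)) v = w \<bullet> i" if "i \<in> Basis" for i
    proof -
      have "g p (?d (u i)) v = (\<Sum>b\<in>Basis. (w \<bullet> b) * g p (?d (u i)) (?d b))"
        unfolding w by (rule exp[OF d])
      also have "\<dots> = (\<Sum>b\<in>Basis. if i = b then w \<bullet> b else 0)"
        using dual[OF that] by (intro sum.cong) auto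
      finally show ?thesis using that by simp
    qed
    then show "v = (\<lambda>f. \<Sum>i\<in>Basis. g p (?d (u i)) v * ?d i f)"
      using dvec_Basis_sum[OF U, of w] w by simp
  qed
qed

end

section \<open>Algebraic solitons on simply connected Lie groups\<close>

text \<open>The dual bases are given at the identity only. Left translation spreads them over the
  group with the same pairings, since g is left invariant.\<close>

locale left_invariant_metric = lie_group_manifold mul e \<iota> \<A>
  for mul :: "'m::{t2_space,second_countable_topology} \<Rightarrow> 'm \<Rightarrow> 'm"
    and e \<iota> and \<A> :: "('m, 'e::euclidean_space) chart set" +
  fixes g :: "'m tensor2" and \<epsilon> \<delta> :: "'e \<Rightarrow> 'm tangent"
  assumes g: "g \<in> riemannian_metrics \<A>" and left: "left_invariant mul \<A> g"
    and \<epsilon>: "\<epsilon> i \<in> TM e" and \<delta>: "\<delta> i \<in> TM e"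
    and dual: "i \<in> Basis \<Longrightarrow> j \<in> Basis \<Longrightarrow> g e (\<delta> i) (\<epsilon> j) = (if i = j then 1 else 0)"
    and expand: "v \<in> TM e \<Longrightarrow> v = (\<lambda>f. \<Sum>i\<in>Basis. g e (\<delta> i) v * \<epsilon> i f)"
begin

abbreviation "E i \<equiv> lfield (\<epsilon> i)"
abbreviation "R i \<equiv> rfield (\<epsilon> i)"

text \<open>The coframe dual to \<open>E\<close>, as \<open>\<theta>_E\<close> shows; writing it
  through the metric makes it a smooth one-form at once.\<close>

definition \<theta> :: "'e \<Rightarrow> 'm \<Rightarrow> 'm tangent \<Rightarrow> real" where
  "\<theta> i p v = g p (lfield (\<delta> i) p) v"

lemma gB: "g \<in> symmetric_tensors \<A>"
  using g by (simp add: riemannian_metrics_def)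

lemma E: "E i \<in> VF" and R: "R i \<in> VF"
  by (rule lfield_VF[OF \<epsilon>], rule rfield_VF[OF \<epsilon>])

lemma E_p: "E i p \<in> TM p" and R_p: "R i p \<in> TM p"
  by (rule vector_fieldD(1)[OF E], rule vector_fieldD(1)[OF R])

lemma \<theta>_one_form: "one_form (\<theta> i)"
  unfolding \<theta>_def by (rule tensor_one_form[OF gB lfield_VF[OF \<delta>]])

lemma mul_right_id: "mul p e = p" and mul_inv: "mul p (\<iota> p) = e" "mul (\<iota> p) p = e"
  by simp_all

lemma g_lfield:
  assumes "v \<in> TM e" "w \<in> TM e"
  shows "g p (lfield v p) (lfield w p) = g e v w"
proof -
  have "\<forall>v\<in>TM e. \<forall>w\<in>TM e. g (mul p e) (pushforward \<A> (mul p) v) (pushforward \<A> (mul p) w) = g e v w"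
    using left unfolding left_invariant_def by blast
  then show ?thesis using assms by (simp add: lfield_def mul_right_id)
qed

lemma \<theta>_E: "i \<in> Basis \<Longrightarrow> j \<in> Basis \<Longrightarrow> \<theta> i p (E j p) = (if i = j then 1 else 0)"
  by (simp add: \<theta>_def g_lfield \<epsilon> \<delta> dual)

text \<open>The vector is translated to the identity, expanded there and translated back; invariance
  of g keeps the coefficients.\<close>

lemma expand_E:
  assumes v: "v \<in> TM p"
  shows "v = (\<lambda>f. \<Sum>i\<in>Basis. \<theta> i p v * E i p f)"
proof -
  define u where "u = pushforward \<A> (mul (\<iota> p)) v"
  have u: "u \<in> TM e"
    using pushforward_tangent[OF SF_left v, of "\<iota> p"] by (simp add: u_def mul_inv)
  have "mul p \<circ> mul (\<iota> p) = (\<lambda>x. x)"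
    by (auto simp: G.assoc[symmetric] mul_inv G.group_left_neutral)
  then have "pushforward \<A> (mul p) u = v"
    unfolding u_def by (subst pushforward_compose[OF SF_left]) (simp_all add: pushforward_id[OF v])
  then have v': "lfield u p = v" by (simp add: lfield_def)
  have "v = pushforward \<A> (mul p) (\<lambda>f. \<Sum>i\<in>Basis. g e (\<delta> i) u * \<epsilon> i f)"
    using expand[OF u] v' by (simp add: lfield_def)
  also have "\<dots> = (\<lambda>f. \<Sum>i\<in>Basis. g e (\<delta> i) u * E i p f)"
    unfolding pushforward_sum by (simp add: lfield_def)
  also have "\<dots> = (\<lambda>f. \<Sum>i\<in>Basis. \<theta> i p v * E i p f)"
    unfolding \<theta>_def v'[symmetric] g_lfield[OF \<delta> u] ..
  finally show ?thesis .
qed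

lemma expand_field:
  assumes Y: "Y \<in> VF"
  shows "Y = (\<lambda>p f. \<Sum>i\<in>Basis. \<theta> i p (Y p) * E i p f)"
proof (rule ext)
  fix p
  show "Y p = (\<lambda>f. \<Sum>i\<in>Basis. \<theta> i p (Y p) * E i p f)"
    by (rule expand_E[OF vector_fieldD(1)[OF Y]])
qed

lemma \<theta>_SF: "Y \<in> VF \<Longrightarrow> (\<lambda>p. \<theta> i p (Y p)) \<in> SF"
  by (rule one_formD(3)[OF \<theta>_one_form])

section \<open>Change between left and right invariant frames\<close>

definition Ad :: "'e \<Rightarrow> 'e \<Rightarrow> 'm \<Rightarrow> real" where
  "Ad i j p = \<theta> j p (R i p)"

lemma Ad_SF: "Ad i j \<in> SF"
  unfolding Ad_def by (rule \<theta>_SF[OF R])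

text \<open>Left translation by p is conjugation by p followed by right translation by p.
  Conjugation takes \<open>\<epsilon> k\<close> to the left translate to e of \<open>R k\<close> at
  the inverse of p, where \<open>Ad\<close>, the matrix of the adjoint representation at the inverse
  of its argument, has the coefficients. Thus no matrix has to be inverted.\<close>

lemma E_eq_R: "E k p = (\<lambda>f. \<Sum>l\<in>Basis. Ad k l (\<iota> p) * R l p f)"
proof -
  let ?q = "\<iota> p"
  have "pushforward \<A> (mul p) (R k ?q) = pushforward \<A> (mul p) (\<lambda>f. \<Sum>l\<in>Basis. Ad k l ?q * E l ?q f)"
    using expand_E[OF R_p[of k ?q]] by (simp add: Ad_def)
  also have "\<dots> = (\<lambda>f. \<Sum>l\<in>Basis. Ad k l ?q * \<epsilon> l f)"
    unfolding pushforward_sum push_lfield by (simp add: mul_inv lfield_e[OF \<epsilon>])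
  finally have 1: "pushforward \<A> (mul p) (R k ?q) = (\<lambda>f. \<Sum>l\<in>Basis. Ad k l ?q * \<epsilon> l f)" .
  have "(\<lambda>x. mul x p) \<circ> mul p \<circ> (\<lambda>x. mul x ?q) = mul p"
    by (auto simp: G.assoc mul_inv)
  then have "E k p = pushforward \<A> ((\<lambda>x. mul x p) \<circ> (mul p \<circ> (\<lambda>x. mul x ?q))) (\<epsilon> k)"
    by (simp add: lfield_def o_assoc)
  also have "\<dots> = pushforward \<A> (\<lambda>x. mul x p) (pushforward \<A> (mul p) (R k ?q))"
    unfolding rfield_def by (simp only: pushforward_compose[OF SF_left] pushforward_compose[OF SF_right])
  also have "\<dots> = (\<lambda>f. \<Sum>l\<in>Basis. Ad k l ?q * R l p f)"
    unfolding 1 pushforward_sum by (simp add: rfield_def)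
  finally show ?thesis .
qed

text \<open>Right translation moves the relation to the identity, where pairing with the dual basis
  isolates each coefficient.\<close>

lemma R_independent:
  assumes z: "\<And>f. (\<Sum>i\<in>Basis. c i * R i p f) = 0" and i: "i \<in> Basis"
  shows "c i = 0"
proof -
  have "(\<lambda>f. \<Sum>i\<in>Basis. c i * \<epsilon> i f) = pushforward \<A> (\<lambda>x. mul x (\<iota> p)) (\<lambda>f. \<Sum>i\<in>Basis. c i * R i p f)"
    unfolding pushforward_sum push_rfield by (simp add: mul_inv rfield_e[OF \<epsilon>])
  also have "\<dots> = (\<lambda>f. 0)" unfolding z by (simp add: pushforward_def)
  \<comment> \<open>The zero vector is written as an empty sum so that
    \<open>tensor_sum_right\<close> evaluates g on it as well.\<close>
  finally have "g e (\<delta> i) (\<lambda>f. \<Sum>i\<in>Basis. c i * \<epsilon> i f) = g e (\<delta> i) (\<lambda>f. \<Sum>i\<in>{}. c i * \<epsilon> i f)"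
    by simp
  also have "\<dots> = (\<Sum>j\<in>{}. c j * g e (\<delta> i) (\<epsilon> j))"
    by (rule tensor_sum_right[OF gB \<epsilon> \<delta>])
  also have "g e (\<delta> i) (\<lambda>f. \<Sum>i\<in>Basis. c i * \<epsilon> i f) = (\<Sum>j\<in>Basis. c j * g e (\<delta> i) (\<epsilon> j))"
    by (rule tensor_sum_right[OF gB \<epsilon> \<delta>])
  finally show ?thesis using dual[OF i] i by (simp add: if_distrib sum.delta cong: if_cong)
qed

text \<open>\<open>hat\<close> is a definite description, so a vector with the required pairing must
  be exhibited and be unique. The frame dual to \<open>E\<close> gives the witness, nondegeneracy of
  g the uniqueness.\<close>

lemma hat_tangent:
  assumes B: "B \<in> symmetric_tensors \<A>" and X: "X \<in> VF"
  shows "hat \<A> g B X p \<in> TM p" and "u \<in> TM p \<Longrightarrow> g p (hat \<A> g B X p) u = B p (X p) u"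
proof -
  let ?P = "\<lambda>w. w \<in> TM p \<and> (\<forall>u\<in>TM p. g p w u = B p (X p) u)"
  let ?F = "\<lambda>j. lfield (\<delta> j) p"
  have F: "?F j \<in> TM p" for j by (rule vector_fieldD(1)[OF lfield_VF[OF \<delta>]])
  define w where "w = (\<lambda>f. \<Sum>j\<in>Basis. B p (X p) (E j p) * ?F j f)"
  have w: "w \<in> TM p" unfolding w_def by (rule tangent_lincomb[OF F])
  have "g p w u = B p (X p) u" if u: "u \<in> TM p" for u
  proof -
    have "g p w u = (\<Sum>j\<in>Basis. B p (X p) (E j p) * \<theta> j p u)"
      unfolding w_def \<theta>_def by (rule tensor_sum_left[OF gB F u])
    also have "\<dots> = B p (X p) (\<lambda>f. \<Sum>j\<in>Basis. \<theta> j p u * E j p f)"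
      by (subst tensor_sum_right[OF B E_p vector_fieldD(1)[OF X]]) (simp add: mult.commute)
    finally show ?thesis using expand_E[OF u] by simp
  qed
  then have "?P w" using w by blast
  moreover have "w' = w" if "?P w'" for w'
    by (rule metric_nondegenerate[OF g, of _ p]) (use that \<open>?P w\<close> in auto)
  ultimately have "?P (hat \<A> g B X p)"
    unfolding hat_def by (rule theI)
  then show "hat \<A> g B X p \<in> TM p" "u \<in> TM p \<Longrightarrow> g p (hat \<A> g B X p) u = B p (X p) u"
    by blast+
qed

section \<open>The derivation and its one-forms\<close>

context
  fixes B :: "'m tensor2" and \<kappa> :: real and D :: "'m vfield \<Rightarrow> 'm vfield"
  assumes B: "B \<in> symmetric_tensors \<A>"
    and D_def: "D = (\<lambda>X p f. hat \<A> g B X p f - \<kappa> * X p f)"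
    and D_derivation: "lie_algebra_derivation (lie_algebra mul \<A>) D"
begin

lemma D_tangent:
  assumes X: "X \<in> VF"
  shows "D X p \<in> TM p" and "u \<in> TM p \<Longrightarrow> g p (D X p) u = B p (X p) u - \<kappa> * g p (X p) u"
proof -
  have eq: "D X p = (\<lambda>f. hat \<A> g B X p f + (- \<kappa>) * X p f)" by (simp add: D_def)
  note h = hat_tangent[OF B X] and x = vector_fieldD(1)[OF X]
  note k = tangent_cmult[OF x, of "- \<kappa>"]
  show "D X p \<in> TM p" unfolding eq by (rule tangent_add[OF h(1) k])
  show "g p (D X p) u = B p (X p) u - \<kappa> * g p (X p) u" if u: "u \<in> TM p"
    unfolding eq symmetric_tensorD(2)[OF gB h(1) k u] symmetric_tensorD(3)[OF gB x u] h(2)[OF u] by simp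
qed

text \<open>Raising an index is a pointwise operation, so \<open>D\<close> is linear over functions
  on all vector fields, although its derivation property concerns left invariant ones.\<close>

lemma D_frame:
  assumes X: "X \<in> VF"
  shows "D X p = (\<lambda>f. \<Sum>i\<in>Basis. \<theta> i p (X p) * D (E i) p f)"
proof (rule metric_nondegenerate[OF g D_tangent(1)[OF X] tangent_lincomb[OF D_tangent(1)[OF E]]])
  fix u assume u: "u \<in> TM p"
  have x: "X p = (\<lambda>f. \<Sum>i\<in>Basis. \<theta> i p (X p) * E i p f)" by (rule expand_E[OF vector_fieldD(1)[OF X]])
  have "g p (D X p) u = B p (\<lambda>f. \<Sum>i\<in>Basis. \<theta> i p (X p) * E i p f) u - \<kappa> * g p (\<lambda>f. \<Sum>i\<in>Basis. \<theta> i p (X p) * E i p f) u"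
    using D_tangent(2)[OF X u] x by simp
  also have "\<dots> = (\<Sum>i\<in>Basis. \<theta> i p (X p) * g p (D (E i) p) u)"
    unfolding tensor_sum_left[OF B E_p u] tensor_sum_left[OF gB E_p u] D_tangent(2)[OF E u]
    by (simp add: sum_distrib_left right_diff_distrib sum_subtractf mult.left_commute)
  also have "\<dots> = g p (\<lambda>f. \<Sum>i\<in>Basis. \<theta> i p (X p) * D (E i) p f) u"
    by (rule tensor_sum_left[OF gB D_tangent(1)[OF E] u, symmetric])
  finally show "g p (D X p) u = g p (\<lambda>f. \<Sum>i\<in>Basis. \<theta> i p (X p) * D (E i) p f) u" .
qed

text \<open>A derivation maps the Lie algebra to itself, and this supplies the smoothness of
  \<open>D (E k)\<close>.\<close>

lemma DE_VF: "D (E k) \<in> VF"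
  using D_derivation lfield_lie_algebra[OF \<epsilon>] unfolding lie_algebra_derivation_def lie_algebra_def by blast

text \<open>The coefficients of \<open>D (E k)\<close> in the right invariant frame, obtained by
  passing from \<open>E\<close> to \<open>R\<close> with \<open>E_eq_R\<close>.\<close>

definition \<omega> :: "'e \<Rightarrow> 'e \<Rightarrow> 'm \<Rightarrow> real" where
  "\<omega> k i p = (\<Sum>l\<in>Basis. \<theta> l p (D (E k) p) * Ad l i (\<iota> p))"

definition \<alpha> :: "'e \<Rightarrow> 'm \<Rightarrow> 'm tangent \<Rightarrow> real" where
  "\<alpha> i p v = (\<Sum>k\<in>Basis. \<theta> k p v * \<omega> k i p)"

lemma \<omega>_SF: "\<omega> k i \<in> SF"
proof -
  have "(\<lambda>p. \<Sum>l\<in>Basis. \<theta> l p (D (E k) p) * Ad l i (\<iota> p)) \<in> SF"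
    by (intro SF_sum SF_mult \<theta>_SF[OF DE_VF] SF_inverse[OF Ad_SF])
  then show ?thesis by (simp add: \<omega>_def[abs_def])
qed

lemma DE_eq_R: "D (E k) = (\<lambda>p f. \<Sum>i\<in>Basis. \<omega> k i p * R i p f)"
proof (intro ext)
  fix p f
  have "D (E k) p f = (\<Sum>l\<in>Basis. \<theta> l p (D (E k) p) * E l p f)"
    using fun_cong[OF expand_E[OF vector_fieldD(1)[OF DE_VF]]] .
  also have "\<dots> = (\<Sum>l\<in>Basis. \<Sum>i\<in>Basis. \<theta> l p (D (E k) p) * Ad l i (\<iota> p) * R i p f)"
    by (subst E_eq_R) (simp add: sum_distrib_left mult.assoc)
  also have "\<dots> = (\<Sum>i\<in>Basis. \<omega> k i p * R i p f)"
    by (subst sum.swap) (simp add: \<omega>_def sum_distrib_right)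
  finally show "D (E k) p f = (\<Sum>i\<in>Basis. \<omega> k i p * R i p f)" .
qed

lemma \<alpha>_one_form: "one_form (\<alpha> i)"
proof -
  have "one_form (\<lambda>p v. \<Sum>k\<in>Basis. \<theta> k p v * \<omega> k i p)"
    by (rule one_form_lincomb[OF \<theta>_one_form \<omega>_SF])
  then show ?thesis by (simp add: \<alpha>_def[abs_def])
qed

lemma \<alpha>_E: "k \<in> Basis \<Longrightarrow> \<alpha> i p (E k p) = \<omega> k i p"
  by (simp add: \<alpha>_def \<theta>_E if_distrib[of "\<lambda>x. x * _"] sum.delta cong: if_cong)

lemma D_eq_R:
  assumes "X \<in> VF"
  shows "D X p f = (\<Sum>i\<in>Basis. \<alpha> i p (X p) * R i p f)"
proof -
  have "D X p f = (\<Sum>k\<in>Basis. \<theta> k p (X p) * (\<Sum>i\<in>Basis. \<omega> k i p * R i p f))"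
    using fun_cong[OF D_frame[OF assms]] by (simp add: DE_eq_R)
  also have "\<dots> = (\<Sum>k\<in>Basis. \<Sum>i\<in>Basis. \<theta> k p (X p) * \<omega> k i p * R i p f)"
    by (simp add: sum_distrib_left mult.assoc)
  also have "\<dots> = (\<Sum>i\<in>Basis. \<alpha> i p (X p) * R i p f)"
    by (subst sum.swap) (simp add: \<alpha>_def sum_distrib_right)
  finally show ?thesis .
qed

text \<open>The brackets of \<open>E k\<close> with the frame fields vanish, so only the
  coefficients are differentiated. Both the closedness of \<open>\<alpha>\<close> and the bracket
  with the soliton field are read off from this.\<close>

lemma bracket_E_sum_R:
  assumes "\<And>i. i \<in> Basis \<Longrightarrow> c i \<in> SF"
  shows "lie_bracket (E k) (\<lambda>p f. \<Sum>i\<in>Basis. c i p * R i p f) p = (\<lambda>f. \<Sum>i\<in>Basis. E k p (c i) * R i p f)"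
proof -
  have "lie_bracket (E k) (\<lambda>p f. \<Sum>i\<in>Basis. c i p * R i p f) p = (\<lambda>f. (\<Sum>i\<in>Basis. E k p (c i) * R i p f) +
      (\<Sum>i\<in>Basis. c i p * lie_bracket (E k) (R i) p f))"
    by (rule lie_bracket_sum_right[OF E assms R])
  then show ?thesis by (simp add: left_right_fields_commute[OF \<epsilon> \<epsilon>])
qed

text \<open>Comparing the coefficients of the right invariant frame in
  \<open>D [E\<^sub>j, E\<^sub>k] = [D E\<^sub>j, E\<^sub>k] + [E\<^sub>j, D E\<^sub>k]\<close> gives closedness, since left and right invariant
  fields commute.\<close>

lemma \<alpha>_closed:
  assumes i: "i \<in> Basis"
  shows "closed_form (\<alpha> i)"
proof (rule closed_form_frameI[where I=Basis and E=E, OF \<alpha>_one_form E])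
  fix Y assume "Y \<in> VF"
  then show "\<exists>c. (\<forall>i\<in>Basis. c i \<in> SF) \<and> Y = (\<lambda>p f. \<Sum>i\<in>Basis. c i p * E i p f)"
    using expand_field \<theta>_SF by (intro exI[of _ "\<lambda>i p. \<theta> i p (Y p)"]) blast
next
  fix j k p assume jk: "j \<in> (Basis :: 'e set)" "k \<in> (Basis :: 'e set)"
  let ?c = "\<lambda>i. E j p (\<omega> k i) - E k p (\<omega> j i) - \<alpha> i p (lie_bracket (E j) (E k) p)"
  have br: "lie_bracket (E a) (D (E b)) p f = (\<Sum>i\<in>Basis. E a p (\<omega> b i) * R i p f)" for a b f
    unfolding DE_eq_R bracket_E_sum_R[OF \<omega>_SF] by simp
  have "(\<Sum>i\<in>Basis. ?c i * R i p f) = 0" for f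
  proof -
    have "D (lie_bracket (E j) (E k)) p f = lie_bracket (D (E j)) (E k) p f + lie_bracket (E j) (D (E k)) p f"
      using D_derivation lfield_lie_algebra[OF \<epsilon>] unfolding lie_algebra_derivation_def by simp
    also have "lie_bracket (D (E j)) (E k) p f = - lie_bracket (E k) (D (E j)) p f"
      by (simp add: lie_bracket_def)
    finally show ?thesis
      unfolding br D_eq_R[OF lie_bracket_VF[OF E E]]
      by (simp add: left_diff_distrib sum_subtractf)
  qed
  from R_independent[OF this i]
  show "E j p (\<lambda>q. \<alpha> i q (E k q)) - E k p (\<lambda>q. \<alpha> i q (E j q)) = \<alpha> i p (lie_bracket (E j) (E k) p)"
    by (simp add: \<alpha>_E jk)
qed

section \<open>The soliton field and its equation\<close>

lemma soliton_field_exists: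
  assumes "simply_connected (UNIV :: 'm set)"
  obtains X where "X \<in> VF"
    "\<And>k p. k \<in> Basis \<Longrightarrow> lie_bracket X (E k) p = (\<lambda>f. - (1/2) * D (E k) p f)"
proof -
  have "\<exists>y\<in>SF. \<forall>p. \<forall>v\<in>TM p. v y = \<alpha> i p v" if "i \<in> Basis" for i
    using closed_form_exact[OF \<alpha>_one_form \<alpha>_closed[OF that] assms] by metis
  then obtain y where y: "\<And>i. i \<in> Basis \<Longrightarrow> y i \<in> SF"
    "\<And>i p v. i \<in> Basis \<Longrightarrow> v \<in> TM p \<Longrightarrow> v (y i) = \<alpha> i p v" by metis
  \<comment> \<open>The Lie derivative of g contains the bracket with X in both slots, so half of
    each primitive is taken.\<close>
  define c where "c = (\<lambda>i p. 1/2 * y i p)"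
  have c: "c i \<in> SF" if "i \<in> Basis" for i unfolding c_def by (rule SF_cmult[OF y(1)[OF that]])
  define X where "X = (\<lambda>p f. \<Sum>i\<in>Basis. c i p * R i p f)"
  show thesis
  proof (rule that)
    show "X \<in> VF" unfolding X_def by (rule VF_sum[OF c R])
    fix k p assume k: "k \<in> (Basis :: 'e set)"
    have Ec: "E k p (c i) = 1/2 * \<omega> k i p" if "i \<in> Basis" for i
      unfolding c_def using tangentD(3)[OF E_p y(1)[OF that], of k p "1/2"] y(2)[OF that E_p] \<alpha>_E[OF k] by simp
    moreover have "lie_bracket (E k) X p = (\<lambda>f. \<Sum>i\<in>Basis. E k p (c i) * R i p f)"
      unfolding X_def by (rule bracket_E_sum_R[OF c])
    ultimately have "lie_bracket (E k) X p = (\<lambda>f. \<Sum>i\<in>Basis. (1/2 * \<omega> k i p) * R i p f)"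
      by (simp only: Ec cong: sum.cong)
    also have "\<dots> = (\<lambda>f. 1/2 * D (E k) p f)"
      unfolding DE_eq_R by (simp add: sum_distrib_left mult.assoc)
    finally show "lie_bracket X (E k) p = (\<lambda>f. - (1/2) * D (E k) p f)"
      by (subst lie_bracket_swap) (simp add: mult.assoc)
  qed
qed

text \<open>The witness for \<beta> is \<kappa>. The equation is checked on the frame
  \<open>E\<close> and extended to arbitrary fields one slot at a time by linearity over functions,
  the second slot being reached through the symmetry of the Lie derivative.\<close>

lemma soliton_equation:
  assumes "simply_connected (UNIV :: 'm set)"
  shows "\<exists>X\<in>VF. \<exists>\<beta>. \<forall>Y\<in>VF. \<forall>Z\<in>VF. \<forall>p.
    \<beta> * g p (Y p) (Z p) + lie_derivative X g Y Z p = B p (Y p) (Z p)"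
proof -
  obtain X where X: "X \<in> VF"
    and br: "\<And>k p. k \<in> Basis \<Longrightarrow> lie_bracket X (E k) p = (\<lambda>f. - (1/2) * D (E k) p f)"
    by (rule soliton_field_exists[OF assms]) blast
  have LE: "lie_derivative X g (E j) (E k) p = B p (E j p) (E k p) - \<kappa> * g p (E j p) (E k p)"
    if j: "j \<in> Basis" and k: "k \<in> Basis" for j k p
  proof -
    \<comment> \<open>The function differentiated here is constant because g is left
      invariant.\<close>
    have "X p (\<lambda>q. g q (E j q) (E k q)) = 0"
      using tangent_const[OF vector_fieldD(1)[OF X]] by (simp add: g_lfield[OF \<epsilon> \<epsilon>])
    moreover have h: "g p (lie_bracket X (E a) p) (E b p) = - (1/2) * (B p (E a p) (E b p) - \<kappa> * g p (E a p) (E b p))"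
      if "a \<in> Basis" for a b
      unfolding br[OF that] symmetric_tensorD(3)[OF gB D_tangent(1)[OF E] E_p] D_tangent(2)[OF E E_p] ..
    moreover have "g p (E j p) (lie_bracket X (E k) p) = g p (lie_bracket X (E k) p) (E j p)"
      by (rule symmetric_tensorD(1)[OF gB E_p lie_bracket_tangent[OF X E]])
    moreover have sym: "A p (E k p) (E j p) = A p (E j p) (E k p)" if "A \<in> symmetric_tensors \<A>" for A
      by (rule symmetric_tensorD(1)[OF that E_p E_p])
    \<comment> \<open>Symmetry of g and B makes the two bracket terms equal, each contributing half
      of B - \<kappa> g.\<close>
    ultimately show ?thesis
      unfolding lie_derivative_def
      using h[OF j, of k] h[OF k, of j] sym[OF B] sym[OF gB] by simp
  qed
  have LY: "lie_derivative X g Y Z p = (\<Sum>i\<in>Basis. \<theta> i p (Y p) * lie_derivative X g (E i) Z p)"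
    if Y: "Y \<in> VF" and Z: "Z \<in> VF" for Y Z p
    by (subst expand_field[OF Y]) (rule lie_derivative_sum[OF gB X Z \<theta>_SF[OF Y] E])
  have BY: "A p (Y p) (Z p) = (\<Sum>i\<in>Basis. \<theta> i p (Y p) * A p (E i p) (Z p))"
    if A: "A \<in> symmetric_tensors \<A>" and Y: "Y \<in> VF" and Z: "Z \<in> VF" for A Y Z p
    by (subst expand_E[OF vector_fieldD(1)[OF Y]]) (rule tensor_sum_left[OF A E_p vector_fieldD(1)[OF Z]])
  have LEZ: "lie_derivative X g (E i) Z p = B p (E i p) (Z p) - \<kappa> * g p (E i p) (Z p)"
    if i: "i \<in> Basis" and Z: "Z \<in> VF" for i Z p
  proof -
    have s: "A p (E i p) (Z p) = A p (Z p) (E i p)" if "A \<in> symmetric_tensors \<A>" for A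
      by (rule symmetric_tensorD(1)[OF that E_p vector_fieldD(1)[OF Z]])
    have "lie_derivative X g (E i) Z p = (\<Sum>k\<in>Basis. \<theta> k p (Z p) * lie_derivative X g (E k) (E i) p)"
      using lie_derivative_swap[OF gB X E Z] LY[OF Z E] by simp
    also have "\<dots> = (\<Sum>k\<in>Basis. \<theta> k p (Z p) * (B p (E k p) (E i p) - \<kappa> * g p (E k p) (E i p)))"
      using LE i by simp
    also have "\<dots> = B p (Z p) (E i p) - \<kappa> * g p (Z p) (E i p)"
      unfolding BY[OF B Z E] BY[OF gB Z E]
      by (simp add: right_diff_distrib sum_subtractf sum_distrib_left mult.left_commute)
    finally show ?thesis by (simp add: s[OF B] s[OF gB])
  qed
  have "\<kappa> * g p (Y p) (Z p) + lie_derivative X g Y Z p = B p (Y p) (Z p)"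
    if Y: "Y \<in> VF" and Z: "Z \<in> VF" for Y Z p
    unfolding LY[OF Y Z] BY[OF B Y Z] BY[OF gB Y Z]
    using LEZ[OF _ Z, of _ p]
    by (simp add: right_diff_distrib sum_subtractf sum_distrib_left mult.left_commute)
  then show ?thesis using X by blast
qed

end

end

theorem proposition2p2:
  fixes mul :: "'m::{t2_space,second_countable_topology} \<Rightarrow> 'm \<Rightarrow> 'm"
    and e :: 'm and \<iota> :: "'m \<Rightarrow> 'm"
    and \<A> :: "('m, real ^ 3) chart set"
    and T :: "'m tensor2 \<Rightarrow> 'm tensor2" and g :: "'m tensor2"
  assumes "lie_group mul e \<iota> \<A>"
    and "simply_connected (UNIV :: 'm set)"
    and "geometric_operator \<A> T"
    and "g \<in> riemannian_metrics \<A>" and "left_invariant mul \<A> g"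
    and "algebraic_soliton mul \<A> T g"
  shows "soliton \<A> T g"
proof -
  interpret lie_group_manifold mul e \<iota> \<A> by unfold_locales (rule assms(1))
  obtain \<epsilon> \<delta> :: "real ^ 3 \<Rightarrow> 'm tangent" where frame: "\<And>i. \<epsilon> i \<in> tangent_space \<A> e"
    "\<And>i. \<delta> i \<in> tangent_space \<A> e"
    "\<And>i j. i \<in> Basis \<Longrightarrow> j \<in> Basis \<Longrightarrow> g e (\<delta> i) (\<epsilon> j) = (if i = j then 1 else 0)"
    "\<And>v. v \<in> tangent_space \<A> e \<Longrightarrow> v = (\<lambda>f. \<Sum>i\<in>Basis. g e (\<delta> i) v * \<epsilon> i f)"
    by (rule dual_basis_exists[OF assms(4), of e]) blast
  interpret left_invariant_metric mul e \<iota> \<A> g \<epsilon> \<delta>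
    by unfold_locales (use assms(4,5) frame in auto)
  have B: "T g \<in> symmetric_tensors \<A>"
    using assms(3,4) unfolding geometric_operator_def by blast
  obtain \<kappa> where \<kappa>: "lie_algebra_derivation (lie_algebra mul \<A>) (\<lambda>X p f. hat \<A> g (T g) X p f - \<kappa> * X p f)"
    using assms(6) unfolding algebraic_soliton_def by blast
  show ?thesis
    unfolding soliton_def using assms(4) soliton_equation[OF B refl \<kappa> assms(2)] by blast
qed

end
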